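(* Let $(N,\Pi)$ be a generalized number system with zeta function $\zeta$. Then the following four statements are equivalent: (i) For some $a>0$, the generalized integer distribution function $N$ satisfies $$N(x)=ax+O\!\left(\frac{x}{\log^n x}\right)\quad\text{for all } n\in\mathbb{N}.$$ (ii) For some $a>0$, the function $G(s)=\zeta(s)-\frac{a}{s-1}$ has a $C^\infty$-extension to $\Re e\, s\ge 1$ and there is some $\varepsilon>0$ such that $$G^{(n)}(1+it)=O(|t|^{\varepsilon})\quad\text{for all } n\in\mathbb{N}.$$ (iii) For some $a>0$ and each $\varepsilon>0$, the function $G(s)=\zeta(s)-\frac{a}{s-1}$ satisfies $$G^{(n)}(\sigma+it)=O((1+|t|)^{\varepsilon}),\quad \sigma>1,\ t\in\mathbb{R},\quad\text{for all } n\in\mathbb{N},$$ with global $O_{\varepsilon,n}$-constants (i.e., for each $\varepsilon>0$ and $n$ there is a constant $C_{\varepsilon,n}$ with $|G^{(n)}(\sigma+it)|\le C_{\varepsilon,n}(1+|t|)^\varepsilon$ for all $\sigma>1$, $t\in\mathbb{R}$). (iv) The Riemann prime distribution function $\Pi$ satisfies $$\Pi(x)=\operatorname{Li}(x)+O\!\left(\frac{x}{\log^n x}\right)\quad\text{for all } n\in\mathbb{N}.$$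
   Context: A (Beurling) generalized number system is a pair of non-decreasing right-continuous functions $N$ and $\Pi$ with $N(1)=1$, $\Pi(1)=0$, both with support in $[1,\infty)$, linked via $$\zeta(s):=\int_{1^-}^\infty x^{-s}\,dN(x)=\exp\left(\int_1^\infty x^{-s}\,d\Pi(x)\right).$$ Standing assumption: these integrals converge (and the identity holds) at least on the half-plane $\Re e\, s>1$. The lower limit $1^-$ means that the point mass at $1$ is included. $N$ is called the generalized integer (number) distribution function and $\Pi$ the Riemann prime distribution function; neither needs to be a step function. $\operatorname{Li}$ is the logarithmic integral, e.g. $\operatorname{Li}(x)=\int_2^x\frac{du}{\log u}$. "$G$ has a $C^\infty$-extension to $\Re e\, s\ge1$" means that $G$, analytic on $\Re e\, s>1$, and all its derivatives extend continuously to $\Re e\, s\ge 1$; $G^{(n)}(1+it)$ denotes the boundary value of the extended $n$-th derivative. $\mathbb{N}$ includes $0$ (with $G^{(0)}=G$). Unless global constants are specified, $O$-estimates are for large arguments ($x\to\infty$, or $|t|\to\infty$), and implied constants may depend on $n$. *)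

theory Defs
  imports "HOL-Analysis.Analysis" "HOL-Library.Landau_Symbols"
begin

text \<open>For a non-decreasing right-continuous \<open>F\<close> the Lebesgue-Stieltjes measure \<open>dF\<close> is
  \<open>interval_measure F\<close>, which gives mass \<open>F b - F a\<close> to the interval \<open>{a<..b}\<close>.
  The lower limit \<open>1\<^sup>-\<close> is rendered by integrating over the closed half-line \<open>{1..}\<close>,
  so the atom at \<open>1\<close> counts. The values at \<open>s\<close> with \<open>Re s \<le> 1\<close> carry no meaning in general.\<close>

definition beurling_zeta :: "(real \<Rightarrow> real) \<Rightarrow> complex \<Rightarrow> complex" where
  "beurling_zeta N s = (LINT x:{1..}|interval_measure N. complex_of_real x powr (- s))"

text \<open>Convergence on \<open>Re s > 1\<close> means absolute convergence here: the half-plane contains the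
  real points \<open>s > 1\<close>, where the integrands are non-negative, and the absolute value of
  \<open>x powr (-s)\<close> is \<open>x powr (- Re s)\<close>.\<close>

definition generalized_number_system :: "(real \<Rightarrow> real) \<Rightarrow> (real \<Rightarrow> real) \<Rightarrow> bool" where
  "generalized_number_system N P \<longleftrightarrow>
     mono N \<and> (\<forall>x. continuous (at_right x) N) \<and> (\<forall>x<1. N x = 0) \<and> N 1 = 1 \<and>
     mono P \<and> (\<forall>x. continuous (at_right x) P) \<and> (\<forall>x<1. P x = 0) \<and> P 1 = 0 \<and>
     (\<forall>s. Re s > 1 \<longrightarrow>
        set_integrable (interval_measure N) {1..} (\<lambda>x. complex_of_real x powr (- s)) \<and>
        set_integrable (interval_measure P) {1<..} (\<lambda>x. complex_of_real x powr (- s)) \<and>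
        beurling_zeta N s =
          exp (LINT x:{1<..}|interval_measure P. complex_of_real x powr (- s)))"

definition zeta_minus_pole :: "(real \<Rightarrow> real) \<Rightarrow> real \<Rightarrow> complex \<Rightarrow> complex" where
  "zeta_minus_pole N a s = beurling_zeta N s - of_real a / (s - 1)"

definition Li :: "real \<Rightarrow> real" where
  "Li x = integral {2..x} (\<lambda>u. 1 / ln u)"

text \<open>\<open>H n\<close> is the continuous extension of the \<open>n\<close>-th derivative of \<open>G\<close> to \<open>Re s \<ge> 1\<close>. It is
  uniquely determined there, so \<open>H n (Complex 1 t)\<close> is the boundary value of that derivative
  at \<open>1 + \<i> t\<close>.\<close>

definition smooth_extension :: "(complex \<Rightarrow> complex) \<Rightarrow> (nat \<Rightarrow> complex \<Rightarrow> complex) \<Rightarrow> bool" where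
  "smooth_extension G H \<longleftrightarrow>
     G holomorphic_on {s. Re s > 1} \<and>
     (\<forall>n. continuous_on {s. Re s \<ge> 1} (H n) \<and>
          (\<forall>s. Re s > 1 \<longrightarrow> H n s = (deriv ^^ n) G s))"

end

theory Submission
  imports Defs "HOL-Probability.Probability" "HOL-Complex_Analysis.Complex_Analysis"
begin

text \<open>
  Everything is transported to the variable \<open>v = ln x\<close>. The functions \<open>N\<close> and \<open>P\<close> become the
  non-decreasing functions \<open>N (exp v)\<close> and \<open>P (exp v)\<close>, and integration by parts turns \<open>zeta\<close> and
  \<open>log zeta\<close> into \<open>s\<close> times their Laplace transforms. The functions they are compared with are the
  primitives of \<open>a exp v\<close>, whose transform times \<open>s\<close> is exactly \<open>a / (s - 1)\<close>, and of
  \<open>(exp v - 1) / v\<close>, which is \<open>Li (exp v)\<close> up to \<open>O(v)\<close> and whose transform times \<open>s\<close> is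
  \<open>log (s / (s - 1))\<close> up to a constant. Conditions (i) and (iv) both say that a difference \<open>g\<close> of
  such functions is \<open>O(exp v / (1 + v) ^ M)\<close> for every \<open>M\<close> (\<open>log_small\<close>).

  Such a \<open>g\<close> is linked with its transform \<open>D(s) = s * laplace g s\<close> in two ways.
  \<^item> Abelian: if \<open>g\<close> is \<open>log_small\<close>, the integrals of \<open>v ^ n g(v) exp (-s v)\<close> converge absolutely
    up to \<open>Re s = 1\<close>, so every derivative of \<open>D\<close> is continuous there and \<open>O(1 + |t|)\<close>.
  \<^item> Tauberian (\<open>tauberian\<close>): suppose that every derivative of \<open>D\<close> is \<open>O((1 + |t|) ^ A)\<close> in
    \<open>1 < Re s \<le> 2\<close>, with one \<open>A\<close> for all derivatives. Integrating \<open>g\<close> more than \<open>A + 1\<close> times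
    divides \<open>D\<close> by a power of \<open>s\<close> that makes the transform and all its derivatives absolutely
    integrable on vertical lines. Multiplication of a function by \<open>v ^ M\<close> differentiates its
    transform \<open>M\<close> times, so the Fourier bound \<open>2 pi |h| \<le> \<integral> |h^|\<close> (\<open>fourier_sup_bound\<close>) shows that
    the iterated primitive is \<open>log_small\<close>. The integrations are then undone one at a time by
    comparing difference quotients of non-decreasing functions over a step \<open>(1 + v) ^ (-M)\<close>
    (\<open>desmooth\<close>).

  Growth of a fixed order \<open>A\<close> already implies growth of every positive order: since
  \<open>zeta (\<sigma> + i t) = O(1 / (\<sigma> - 1))\<close>, one may expand around the point \<open>1 + T ^ (-\<delta>) + i t\<close>, with
  \<open>T = 1 + |t|\<close>, where Cauchy's estimates are good (\<open>interpolation\<close>). This gives (iii) from (i).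
  Condition (ii) speaks only of the line \<open>Re s = 1\<close>; the maximum modulus principle carries it into
  the strip (\<open>strip_bound_from_boundary\<close>).

  For the primes let \<open>Z(s) = (s - 1) zeta(s) / s\<close>, which is a constant times \<open>exp J\<close>, where
  \<open>J = log zeta - log (s / (s - 1))\<close> up to a constant. Given (i), \<open>Z\<close> has growth of every positive
  order, and \<open>3 + 4 cos x + cos 2x \<ge> 0\<close> yields the same for \<open>1 / Z\<close>; hence \<open>J' = Z' / Z\<close> has it as
  well and the Tauberian theorem applies to \<open>J\<close>. Given (iv), \<open>J\<close> and all its derivatives have
  growth of every positive order, \<open>Z = O(1 + |t|)\<close>, and the equation \<open>Z' = J' Z\<close> passes this bound
  on to all derivatives of \<open>Z\<close> at the cost of an arbitrarily small exponent. Then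
  \<open>zeta - a / (s - 1) = Z + (Z - a) / (s - 1)\<close>, where \<open>a = Z(1) > 0\<close>, satisfies the hypothesis of
  the Tauberian theorem.
\<close>

section \<open>Laplace transforms on the half-plane of absolute convergence\<close>

definition laplace :: "(real \<Rightarrow> real) \<Rightarrow> complex \<Rightarrow> complex" where
  "laplace f s = (LINT v|lborel. of_real (f v) * exp (- (s * of_real v)))"

text \<open>Because of the vanishing on the negative axis the two-sided integral in \<open>laplace\<close> is the usual
  one-sided transform, and it converges absolutely for \<open>Re s > 1\<close>.\<close>

definition transformable :: "(real \<Rightarrow> real) \<Rightarrow> bool" where
  "transformable f \<longleftrightarrow> f \<in> borel_measurable borel \<and> (\<forall>v<0. f v = 0) \<and>
     (\<forall>\<sigma>>1. integrable lborel (\<lambda>v. f v * exp (- (\<sigma> * v))))"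

lemma transformableD:
  assumes "transformable f"
  shows "f \<in> borel_measurable borel" "v < 0 \<Longrightarrow> f v = 0"
    "\<sigma> > 1 \<Longrightarrow> integrable lborel (\<lambda>v. f v * exp (- (\<sigma> * v)))"
  using assms by (auto simp: transformable_def)

lemma norm_laplace_integrand:
  "norm (of_real (f v) * exp (- (s * of_real v))) = \<bar>f v\<bar> * exp (- (Re s * v))"
  by (simp add: norm_mult)

lemma laplace_integrable:
  assumes "transformable f" "Re s > 1"
  shows "integrable lborel (\<lambda>v. of_real (f v) * exp (- (s * of_real v)))"
proof (rule Bochner_Integration.integrable_bound[OF transformableD(3)[OF assms]])
  have [measurable]: "f \<in> borel_measurable borel" using transformableD[OF assms(1)] by simp
  show "(\<lambda>v. of_real (f v) * exp (- (s * of_real v))) \<in> borel_measurable lborel"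
    by measurable
qed (simp add: norm_mult)

lemma norm_laplace_le:
  "norm (laplace f s) \<le> (LINT v|lborel. \<bar>f v\<bar> * exp (- (Re s * v)))"
  unfolding laplace_def using integral_norm_bound[of lborel "\<lambda>v. of_real (f v) * exp (- (s * of_real v))"]
  by (simp add: norm_laplace_integrand del: exp_minus)

lemma transformable_diff:
  assumes "transformable f" "transformable g" shows "transformable (\<lambda>v. f v - g v)"
  using assms unfolding transformable_def by (auto simp: left_diff_distrib)

lemma laplace_diff:
  assumes "transformable f" "transformable g" "Re s > 1"
  shows "laplace (\<lambda>v. f v - g v) s = laplace f s - laplace g s"
  unfolding laplace_def
  by (simp add: left_diff_distrib laplace_integrable assms)

lemma laplace_cmult: "laplace (\<lambda>v. c * f v) s = of_real c * laplace f s"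
  unfolding laplace_def by (simp add: mult.assoc)

lemma laplace_minus: "laplace (\<lambda>v. - f v) s = - laplace f s"
  unfolding laplace_def by simp

lemma power_le_exp:
  fixes v :: real
  assumes "v \<ge> 0" "\<delta> > 0"
  shows "v ^ n \<le> fact n / \<delta> ^ n * exp (\<delta> * v)"
proof -
  have "(\<delta> * v) ^ n /\<^sub>R fact n \<le> exp (\<delta> * v)"
  proof -
    have "(\<Sum>k\<in>{n}. (\<delta> * v) ^ k /\<^sub>R fact k) \<le> (\<Sum>k. (\<delta> * v) ^ k /\<^sub>R fact k)"
      using assms by (intro sum_le_suminf summable_exp_generic) auto
    then show ?thesis by (simp add: exp_def)
  qed
  then show ?thesis using assms by (simp add: field_simps power_mult_distrib)
qed

text \<open>A factor that is smaller than every exponential is harmless because the abscissa \<open>\<sigma>\<close> can be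
  lowered a little and still exceed 1.\<close>

lemma transformable_bound:
  assumes "transformable f" and [measurable]: "g \<in> borel_measurable borel"
    and z: "\<And>v. v < 0 \<Longrightarrow> g v = 0"
    and b: "\<And>\<delta>. \<delta> > 0 \<Longrightarrow> \<exists>C. \<forall>v\<ge>0. \<bar>g v\<bar> \<le> C * exp (\<delta> * v) * \<bar>f v\<bar>"
  shows "transformable g"
  unfolding transformable_def
proof (intro conjI allI impI)
  fix \<sigma> :: real assume \<sigma>: "\<sigma> > 1"
  define \<delta> where "\<delta> = (\<sigma> - 1) / 2"
  have \<delta>: "\<delta> > 0" "\<sigma> - \<delta> > 1" using \<sigma> by (auto simp: \<delta>_def field_simps)
  obtain C where C: "\<And>v. v \<ge> 0 \<Longrightarrow> \<bar>g v\<bar> \<le> C * exp (\<delta> * v) * \<bar>f v\<bar>" using b[OF \<delta>(1)] by blast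
  have "integrable lborel (\<lambda>v. C * (f v * exp (- ((\<sigma> - \<delta>) * v))))"
    using transformableD(3)[OF assms(1) \<delta>(2)] by simp
  then show "integrable lborel (\<lambda>v. g v * exp (- (\<sigma> * v)))"
  proof (rule Bochner_Integration.integrable_bound)
    show "AE v in lborel. norm (g v * exp (- (\<sigma> * v))) \<le> norm (C * (f v * exp (- ((\<sigma> - \<delta>) * v))))"
    proof (rule AE_I2)
      fix v :: real
      show "norm (g v * exp (- (\<sigma> * v))) \<le> norm (C * (f v * exp (- ((\<sigma> - \<delta>) * v))))"
      proof (cases "v < 0")
        case False
        then have "\<bar>g v\<bar> * exp (- (\<sigma> * v)) \<le> C * exp (\<delta> * v) * \<bar>f v\<bar> * exp (- (\<sigma> * v))"
          using C by (intro mult_right_mono) auto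
        also have "\<dots> = C * (\<bar>f v\<bar> * exp (- ((\<sigma> - \<delta>) * v)))"
          by (simp add: algebra_simps exp_diff exp_minus divide_inverse)
        also have "\<dots> \<le> \<bar>C\<bar> * (\<bar>f v\<bar> * exp (- ((\<sigma> - \<delta>) * v)))"
          by (intro mult_right_mono) auto
        finally show ?thesis by (simp add: abs_mult)
      qed (simp add: z)
    qed
  qed simp
qed (use z in auto)

lemma transformable_power:
  assumes "transformable f" shows "transformable (\<lambda>v. v ^ n * f v)"
proof (rule transformable_bound[OF assms])
  have [measurable]: "f \<in> borel_measurable borel" using transformableD[OF assms(1)] by simp
  show "(\<lambda>v. v ^ n * f v) \<in> borel_measurable borel" by measurable
  fix \<delta> :: real assume d: "\<delta> > 0"
  have "\<bar>v ^ n * f v\<bar> \<le> fact n / \<delta> ^ n * exp (\<delta> * v) * \<bar>f v\<bar>" if "v \<ge> 0" for v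
    using mult_right_mono[OF power_le_exp[OF that d, of n], of "\<bar>f v\<bar>"] that by (simp add: abs_mult)
  then show "\<exists>C. \<forall>v\<ge>0. \<bar>v ^ n * f v\<bar> \<le> C * exp (\<delta> * v) * \<bar>f v\<bar>" by blast
qed (use transformableD[OF assms] in auto)

lemma transformable_minus: "transformable f \<Longrightarrow> transformable (\<lambda>v. - f v)"
  by (auto simp: transformable_def)

lemma transformable_times:
  assumes "transformable f" shows "transformable (\<lambda>v. v * f v)"
  using transformable_power[OF assms, of 1] by simp

lemma norm_exp_quadratic:
  fixes z :: complex shows "norm (exp z - 1 - z) \<le> (norm z)\<^sup>2 * exp (norm z)"
proof -
  have "norm (exp z - (\<Sum>i\<le>1. z ^ i / fact i)) \<le> exp \<bar>Re z\<bar> * (norm z) ^ Suc 1 / fact 1"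
    by (rule Taylor_exp)
  also have "\<dots> \<le> exp (norm z) * (norm z)\<^sup>2"
    by (simp add: abs_Re_le_cmod power2_eq_square mult_right_mono)
  finally show ?thesis by (simp add: algebra_simps)
qed

text \<open>The remainder of the exponential is quadratic in the increment \<open>h\<close>, with the integrable constant
  \<open>v\<^sup>2 |f v|\<close>.\<close>

lemma laplace_has_field_derivative:
  assumes f: "transformable f" and s: "Re s > 1"
  shows "(laplace f has_field_derivative - laplace (\<lambda>v. v * f v) s) (at s)"
proof -
  define r where "r = (Re s - 1) / 2"
  have r: "r > 0" "Re s - r > 1" using s by (auto simp: r_def field_simps)
  define g where "g = (\<lambda>v. v ^ 2 * f v)"
  have g: "transformable g" unfolding g_def by (rule transformable_power[OF f])
  define K where "K = (LINT v|lborel. \<bar>g v\<bar> * exp (- ((Re s - r) * v)))"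
  have intK: "integrable lborel (\<lambda>v. \<bar>g v\<bar> * exp (- ((Re s - r) * v)))"
    using integrable_norm[OF transformableD(3)[OF g r(2)]] by (simp add: abs_mult)
  have bound: "norm (laplace f (s + h) - laplace f s + h * laplace (\<lambda>v. v * f v) s) \<le> K * (norm h)\<^sup>2"
    if h: "norm h < r" for h
  proof -
    have Re: "Re (s + h) > 1" using abs_Re_le_cmod[of h] h r by simp
    let ?I = "\<lambda>v. of_real (f v) * exp (- (s * of_real v)) * (exp (- h * of_real v) - 1 - (- h * of_real v))"
    have i1: "integrable lborel (\<lambda>v. h * (of_real (v * f v) * exp (- (s * of_real v))))"
      using laplace_integrable[OF transformable_times[OF f] s] by simp
    have "laplace f (s + h) - laplace f s + h * laplace (\<lambda>v. v * f v) s
       = (LINT v|lborel. (of_real (f v) * exp (- ((s + h) * of_real v)) - of_real (f v) * exp (- (s * of_real v)))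
            + h * (of_real (v * f v) * exp (- (s * of_real v))))"
      unfolding laplace_def using laplace_integrable[OF f s] laplace_integrable[OF f Re] i1
      by simp
    also have "\<dots> = (LINT v|lborel. ?I v)"
      by (intro Bochner_Integration.integral_cong refl)
         (simp add: algebra_simps exp_diff exp_minus exp_add divide_inverse)
    finally have eq: "laplace f (s + h) - laplace f s + h * laplace (\<lambda>v. v * f v) s = (LINT v|lborel. ?I v)" .
    have pw: "norm (?I v) \<le> (norm h)\<^sup>2 * (\<bar>g v\<bar> * exp (- ((Re s - r) * v)))" for v
    proof (cases "v < 0")
      case True then show ?thesis using transformableD(2)[OF f] by (simp add: g_def)
    next
      case False
      have "norm (exp (- h * of_real v) - 1 - (- h * of_real v)) \<le> (norm h * v)\<^sup>2 * exp (norm h * v)"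
        using norm_exp_quadratic[of "- h * of_real v"] False by (simp add: norm_mult)
      also have "\<dots> \<le> (norm h * v)\<^sup>2 * exp (r * v)"
        using False h by (intro mult_left_mono) (auto intro: mult_right_mono)
      finally have 1: "norm (exp (- h * of_real v) - 1 - (- h * of_real v)) \<le> (norm h * v)\<^sup>2 * exp (r * v)" .
      have "norm (?I v) \<le> \<bar>f v\<bar> * exp (- (Re s * v)) * ((norm h * v)\<^sup>2 * exp (r * v))"
        unfolding norm_mult[of "of_real (f v) * exp (- (s * of_real v))"] norm_laplace_integrand
        by (intro mult_left_mono 1) auto
      also have "\<dots> = (norm h)\<^sup>2 * (\<bar>g v\<bar> * exp (- ((Re s - r) * v)))"
        by (simp add: g_def abs_mult power_mult_distrib algebra_simps exp_diff exp_minus divide_inverse)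
      finally show ?thesis .
    qed
    have [measurable]: "f \<in> borel_measurable borel" using transformableD[OF f] by simp
    have bd: "integrable lborel (\<lambda>v. (norm h)\<^sup>2 * (\<bar>g v\<bar> * exp (- ((Re s - r) * v))))"
      using intK by simp
    have "integrable lborel ?I"
    proof (rule Bochner_Integration.integrable_bound[OF bd])
      show "?I \<in> borel_measurable lborel" by measurable
      show "AE v in lborel. norm (?I v) \<le> norm ((norm h)\<^sup>2 * (\<bar>g v\<bar> * exp (- ((Re s - r) * v))))"
        by (intro AE_I2 order_trans[OF pw]) simp
    qed
    then have "norm (LINT v|lborel. ?I v) \<le> (LINT v|lborel. (norm h)\<^sup>2 * (\<bar>g v\<bar> * exp (- ((Re s - r) * v))))"
      by (rule Bochner_Integration.integral_norm_bound_integral[OF _ bd pw])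
    then show ?thesis unfolding eq K_def by (simp add: mult.commute)
  qed
  have K0: "K \<ge> 0" unfolding K_def by (intro integral_nonneg_AE) auto
  show ?thesis
    unfolding has_field_derivative_def has_derivative_at
  proof (intro conjI)
    show "bounded_linear ((*) (- laplace (\<lambda>v. v * f v) s))" by (rule bounded_linear_mult_right)
    have "((\<lambda>h. norm (laplace f (s + h) - laplace f s - - laplace (\<lambda>v. v * f v) s * h) / norm h) \<longlongrightarrow> 0) (at 0)"
    proof (rule tendsto_sandwich[where f = "\<lambda>_. 0" and h = "\<lambda>h. K * norm h"])
      show "\<forall>\<^sub>F h in at 0. norm (laplace f (s + h) - laplace f s - - laplace (\<lambda>v. v * f v) s * h) / norm h \<le> K * norm h"
        unfolding eventually_at
      proof (intro exI[of _ r] conjI ballI impI)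
        fix h :: complex assume h: "h \<noteq> 0 \<and> dist h 0 < r"
        then have "norm (laplace f (s + h) - laplace f s - - laplace (\<lambda>v. v * f v) s * h) \<le> K * (norm h)\<^sup>2"
          using bound[of h] by (simp add: mult.commute)
        then show "norm (laplace f (s + h) - laplace f s - - laplace (\<lambda>v. v * f v) s * h) / norm h \<le> K * norm h"
          using h by (simp add: divide_le_eq power2_eq_square mult.assoc)
      qed (use r in auto)
      show "((\<lambda>h. K * norm h) \<longlongrightarrow> 0) (at (0::complex))"
        by (intro tendsto_mult_right_zero tendsto_norm_zero tendsto_ident_at)
    qed auto
    then show "((\<lambda>h. norm (laplace f (s + h) - laplace f s - - laplace (\<lambda>v. v * f v) s * h) / norm h) \<longlongrightarrow> 0) (at 0)" .
  qed
qed

abbreviation half_plane :: "complex set" where "half_plane \<equiv> {s. Re s > 1}"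

lemma open_half_plane: "open half_plane"
  by (rule open_halfspace_Re_gt)

lemma laplace_holomorphic:
  assumes "transformable f" shows "laplace f holomorphic_on half_plane"
  using laplace_has_field_derivative[OF assms]
  by (auto simp: holomorphic_on_def field_differentiable_def intro: has_field_derivative_at_within)

lemma higher_deriv_laplace:
  assumes "transformable f" "Re s > 1"
  shows "(deriv ^^ n) (laplace f) s = laplace (\<lambda>v. (- v) ^ n * f v) s"
  using assms(2)
proof (induction n arbitrary: s)
  case (Suc n)
  have ok: "transformable (\<lambda>v. (- v) ^ n * f v)"
  proof (cases "even n")
    case True then show ?thesis using transformable_power[OF assms(1), of n] by simp
  next
    case False then show ?thesis using transformable_minus[OF transformable_power[OF assms(1), of n]] by simp
  qed
  have ev: "\<forall>\<^sub>F w in nhds s. (deriv ^^ n) (laplace f) w = laplace (\<lambda>v. (- v) ^ n * f v) w"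
    using eventually_nhds_in_open[OF open_half_plane, of s] Suc
    by (auto elim: eventually_mono)
  have "(deriv ^^ Suc n) (laplace f) s = deriv ((deriv ^^ n) (laplace f)) s" by simp
  also have "\<dots> = deriv (laplace (\<lambda>v. (- v) ^ n * f v)) s" by (rule deriv_cong_ev[OF ev refl])
  also have "\<dots> = - laplace (\<lambda>v. v * ((- v) ^ n * f v)) s"
    by (rule DERIV_imp_deriv[OF laplace_has_field_derivative[OF ok Suc.prems]])
  finally show ?case by (simp add: laplace_minus[symmetric] mult.assoc)
qed simp

section \<open>Transforms of cumulative functions\<close>

lemma exp_tail_integrable_real:
  fixes a \<sigma> :: real assumes "\<sigma> > 0"
  shows "integrable lborel (\<lambda>v. indicator {a..} v * exp (- (\<sigma> * v)))"
    and "(LINT v|lborel. indicator {a..} v * exp (- (\<sigma> * v))) = exp (- (\<sigma> * a)) / \<sigma>"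
proof -
  have lim: "((\<lambda>v. - exp (- (\<sigma> * v)) / \<sigma>) \<longlongrightarrow> 0) at_top"
    using assms by real_asymp
  have "(\<integral>\<^sup>+v. ennreal (exp (- (\<sigma> * v))) * indicator {a..} v \<partial>lborel) = ennreal (0 - (- exp (- (\<sigma> * a)) / \<sigma>))"
    by (rule nn_integral_FTC_atLeast[OF _ _ _ lim]) (use assms in \<open>auto intro!: derivative_eq_intros\<close>)
  then have nn: "(\<integral>\<^sup>+v. ennreal (indicator {a..} v * exp (- (\<sigma> * v))) \<partial>lborel) = ennreal (exp (- (\<sigma> * a)) / \<sigma>)"
    by (simp add: indicator_mult_ennreal mult.commute)
  show "integrable lborel (\<lambda>v. indicator {a..} v * exp (- (\<sigma> * v)))"
    by (rule integrableI_nonneg) (auto simp: nn)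
  show "(LINT v|lborel. indicator {a..} v * exp (- (\<sigma> * v))) = exp (- (\<sigma> * a)) / \<sigma>"
    by (rule integral_eq_nn_integral[THEN trans]) (use assms in \<open>auto simp: nn\<close>)
qed

lemma exp_tail:
  assumes "Re s > 0"
  shows "integrable lborel (\<lambda>v. indicator {a..} v *\<^sub>R exp (- (s * of_real v)))"
    and "(LINT v|lborel. indicator {a..} v *\<^sub>R exp (- (s * of_real v))) = exp (- (s * of_real a)) / s"
proof -
  show int: "integrable lborel (\<lambda>v. indicator {a..} v *\<^sub>R exp (- (s * of_real v)))"
    by (rule Bochner_Integration.integrable_bound[OF exp_tail_integrable_real(1)[OF assms, of a]]) auto
  have s0: "s \<noteq> 0" using assms by auto
  define F where "F = (\<lambda>v::real. - exp (- (s * of_real v)) / s)"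
  have F: "(F has_vector_derivative exp (- (s * of_real v))) (at v)" for v
    unfolding F_def by (rule has_vector_derivative_real_field) (use s0 in \<open>auto intro!: derivative_eq_intros\<close>)
  have conv: "(\<lambda>n. LINT v|lborel. indicator {a..a + real n} v *\<^sub>R exp (- (s * of_real v)))
        \<longlonglongrightarrow> (LINT v|lborel. indicator {a..} v *\<^sub>R exp (- (s * of_real v)))"
  proof (rule integral_dominated_convergence[where w = "\<lambda>v. norm (indicator {a..} v *\<^sub>R exp (- (s * of_real v)))"])
    show "AE v in lborel. (\<lambda>n. indicator {a..a + real n} v *\<^sub>R exp (- (s * complex_of_real v)))
        \<longlonglongrightarrow> indicator {a..} v *\<^sub>R exp (- (s * complex_of_real v))"
    proof (rule AE_I2, rule tendsto_eventually)
      fix v :: real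
      obtain m :: nat where "real m \<ge> v - a" using real_arch_simple by blast
      then show "\<forall>\<^sub>F n in sequentially. indicator {a..a + real n} v *\<^sub>R exp (- (s * complex_of_real v))
          = indicator {a..} v *\<^sub>R exp (- (s * complex_of_real v))"
        by (intro eventually_sequentiallyI[of m]) (auto simp: indicator_def)
    qed
  qed (use integrable_norm[OF int] in \<open>auto simp: indicator_def\<close>)
  have "(LINT v|lborel. indicator {a..a + real n} v *\<^sub>R exp (- (s * of_real v))) = F (a + real n) - F a" for n
    by (rule integral_FTC_atLeastAtMost)
       (auto intro!: continuous_intros has_vector_derivative_at_within[OF F])
  then have conv': "(\<lambda>n. F (a + real n) - F a) \<longlonglongrightarrow> (LINT v|lborel. indicator {a..} v *\<^sub>R exp (- (s * of_real v)))"
    using conv by simp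
  have "(\<lambda>n. F (a + real n)) \<longlonglongrightarrow> 0"
  proof (rule tendsto_norm_zero_cancel)
    have "(\<lambda>n. exp (- (Re s * (a + real n))) / norm s) \<longlonglongrightarrow> 0"
      using assms s0 by real_asymp
    then show "(\<lambda>n. norm (F (a + real n))) \<longlonglongrightarrow> 0"
      by (simp add: F_def norm_divide)
  qed
  then have "(\<lambda>n. F (a + real n) - F a) \<longlonglongrightarrow> 0 - F a" by (intro tendsto_diff tendsto_const)
  from LIMSEQ_unique[OF conv' this]
  show "(LINT v|lborel. indicator {a..} v *\<^sub>R exp (- (s * of_real v))) = exp (- (s * of_real a)) / s"
    by (simp add: F_def)
qed

text \<open>Fubini for \<open>exp (- s l) = s \<integral> exp (- s v) dv\<close> over \<open>v \<ge> l\<close>. With a Stieltjes measure and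
  \<open>\<l> = ln\<close> this is integration by parts for Dirichlet integrals; with Lebesgue measure and
  \<open>\<l> = id\<close> it says that taking a primitive divides the transform by \<open>s\<close>.\<close>

lemma laplace_cumulative:
  fixes f \<l> :: "'a \<Rightarrow> real"
  assumes M: "sigma_finite_measure M"
    and [measurable]: "f \<in> borel_measurable M" "\<l> \<in> borel_measurable M"
    and nonneg: "\<And>y. y \<in> space M \<Longrightarrow> f y \<noteq> 0 \<Longrightarrow> \<l> y \<ge> 0"
    and int: "\<And>\<sigma>. \<sigma> > 1 \<Longrightarrow> integrable M (\<lambda>y. f y * exp (- (\<sigma> * \<l> y)))"
  defines "F \<equiv> \<lambda>v. LINT y|M. (if \<l> y \<le> v then f y else 0)"
  shows "transformable F"
    and "Re s > 1 \<Longrightarrow> laplace F s = (LINT y|M. of_real (f y) * exp (- (s * of_real (\<l> y)))) / s"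
proof -
  interpret M: sigma_finite_measure M by fact
  interpret P: pair_sigma_finite M lborel ..
  have F_meas [measurable]: "F \<in> borel_measurable borel"
    unfolding F_def by measurable
  define \<Phi> where "\<Phi> = (\<lambda>s y v. of_real (if \<l> y \<le> v then f y else 0) * exp (- (s * of_real v)) :: complex)"
  have \<Phi>_eq: "\<Phi> s y v = of_real (f y) * (indicator {\<l> y..} v *\<^sub>R exp (- (s * of_real v)))" for s y v
    by (auto simp: \<Phi>_def indicator_def)
  have \<Phi>_int: "integrable (M \<Otimes>\<^sub>M lborel) (case_prod (\<Phi> s))" if s: "Re s > 1" for s
  proof (rule P.Fubini_integrable)
    show "case_prod (\<Phi> s) \<in> borel_measurable (M \<Otimes>\<^sub>M lborel)"
      unfolding \<Phi>_def by measurable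
    have "(\<lambda>y. LINT v|lborel. norm (\<Phi> s y v)) = (\<lambda>y. \<bar>f y\<bar> * (exp (- (Re s * \<l> y)) / Re s))"
    proof
      fix y
      have "(LINT v|lborel. norm (\<Phi> s y v)) = (LINT v|lborel. \<bar>f y\<bar> * (indicator {\<l> y..} v * exp (- (Re s * v))))"
        by (intro Bochner_Integration.integral_cong) (auto simp: \<Phi>_eq norm_mult)
      then show "(LINT v|lborel. norm (\<Phi> s y v)) = \<bar>f y\<bar> * (exp (- (Re s * \<l> y)) / Re s)"
        using s by (simp add: exp_tail_integrable_real)
    qed
    moreover have "integrable M (\<lambda>y. \<bar>f y * exp (- (Re s * \<l> y))\<bar> / Re s)"
      using int[OF s] by auto
    ultimately show "integrable M (\<lambda>y. LINT v|lborel. norm (case (y, v) of (y, v) \<Rightarrow> \<Phi> s y v))"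
      by (simp add: abs_mult)
    show "AE y in M. integrable lborel (\<lambda>v. case (y, v) of (y, v) \<Rightarrow> \<Phi> s y v)"
      unfolding case_prod_conv \<Phi>_eq using s
      by (intro AE_I2 integrable_mult_right exp_tail) auto
  qed
  have F_eq: "(LINT y|M. \<Phi> s y v) = of_real (F v) * exp (- (s * of_real v))" for s v
  proof -
    have "(LINT y|M. \<Phi> s y v) = (LINT y|M. of_real (if \<l> y \<le> v then f y else 0)) * exp (- (s * of_real v))"
      unfolding \<Phi>_def by simp
    also have "\<dots> = of_real (F v) * exp (- (s * of_real v))"
      unfolding F_def by (subst integral_complex_of_real) simp
    finally show ?thesis .
  qed
  show "transformable F"
    unfolding transformable_def
  proof (intro conjI allI impI F_meas)
    fix v :: real assume "v < 0"
    then have "F v = (LINT y|M. 0)"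
      unfolding F_def using nonneg by (intro Bochner_Integration.integral_cong) force+
    then show "F v = 0" by simp
  next
    fix \<sigma> :: real assume \<sigma>: "\<sigma> > 1"
    have "integrable lborel (\<lambda>v. LINT y|M. \<Phi> (of_real \<sigma>) y v)"
      by (rule P.integrable_snd) (use \<Phi>_int \<sigma> in auto)
    then have "integrable lborel (\<lambda>v. complex_of_real (F v * exp (- (\<sigma> * v))))"
      unfolding F_eq by (simp flip: exp_of_real)
    then show "integrable lborel (\<lambda>v. F v * exp (- (\<sigma> * v)))"
      by (simp only: complex_of_real_integrable_eq)
  qed
  assume s: "Re s > 1"
  have "laplace F s = (LINT v|lborel. LINT y|M. \<Phi> s y v)"
    unfolding laplace_def F_eq ..
  also have "\<dots> = (LINT y|M. LINT v|lborel. \<Phi> s y v)"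
    by (rule P.Fubini_integral[OF \<Phi>_int[OF s]])
  also have "\<dots> = (LINT y|M. of_real (f y) * exp (- (s * of_real (\<l> y))) / s)"
    unfolding \<Phi>_eq integral_mult_right_zero using s
    by (intro Bochner_Integration.integral_cong refl) (simp add: exp_tail(2))
  finally show "laplace F s = (LINT y|M. of_real (f y) * exp (- (s * of_real (\<l> y)))) / s" by simp
qed

text \<open>Integrating over the whole half-line \<open>w \<le> v\<close> makes this an instance of \<open>laplace_cumulative\<close>; for
  functions that vanish on the negative axis the integral starts at 0.\<close>

definition primitive :: "(real \<Rightarrow> real) \<Rightarrow> real \<Rightarrow> real" where
  "primitive f v = (LINT w|lborel. (if w \<le> v then f w else 0))"

lemma
  assumes "transformable f"
  shows transformable_primitive: "transformable (primitive f)"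
    and laplace_primitive: "Re s > 1 \<Longrightarrow> laplace (primitive f) s = laplace f s / s"
proof -
  have [measurable]: "f \<in> borel_measurable lborel" using transformableD[OF assms] by simp
  have *: "f y \<noteq> 0 \<Longrightarrow> y \<ge> 0" for y using transformableD(2)[OF assms, of y] by linarith
  have eq: "primitive f = (\<lambda>v. LINT w|lborel. (if w \<le> v then f w else 0))"
    by (simp add: primitive_def fun_eq_iff)
  note c = laplace_cumulative[of lborel f "\<lambda>w. w", OF _ _ _ *, folded eq]
  show "transformable (primitive f)"
    by (rule c) (use transformableD(3)[OF assms] in \<open>auto intro: lborel.sigma_finite_measure_axioms\<close>)
  show "Re s > 1 \<Longrightarrow> laplace (primitive f) s = laplace f s / s"
    unfolding laplace_def[of f]
    by (rule c) (use transformableD(3)[OF assms] in \<open>auto intro: lborel.sigma_finite_measure_axioms\<close>)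
qed

lemma transformable_integrable_upto:
  assumes "transformable f"
  shows "integrable lborel (\<lambda>w. if w \<le> v then f w else 0)"
proof (rule Bochner_Integration.integrable_bound)
  have [measurable]: "f \<in> borel_measurable lborel" using transformableD[OF assms] by simp
  show "(\<lambda>w. if w \<le> v then f w else 0) \<in> borel_measurable lborel" by measurable
  show "integrable lborel (\<lambda>w. exp (2 * v) * (f w * exp (- (2 * w))))"
    using transformableD(3)[OF assms, of 2] by simp
  show "AE w in lborel. norm (if w \<le> v then f w else 0) \<le> norm (exp (2 * v) * (f w * exp (- (2 * w))))"
  proof (rule AE_I2)
    fix w :: real
    have "\<bar>f w\<bar> * 1 \<le> \<bar>f w\<bar> * exp (2 * v - 2 * w)" if "w \<le> v"
      using that by (intro mult_left_mono) auto
    then show "norm (if w \<le> v then f w else 0) \<le> norm (exp (2 * v) * (f w * exp (- (2 * w))))"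
      by (auto simp: abs_mult exp_diff exp_minus divide_inverse mult_ac)
  qed
qed

lemma primitive_diff:
  assumes "transformable f" "transformable g"
  shows "primitive (\<lambda>v. f v - g v) v = primitive f v - primitive g v"
  unfolding primitive_def
  by (subst Bochner_Integration.integral_diff[symmetric])
     (auto intro!: transformable_integrable_upto assms Bochner_Integration.integral_cong)

lemma abs_primitive_le:
  assumes f: "transformable f" and \<sigma>: "\<sigma> > 1"
  shows "\<bar>primitive f v\<bar> \<le> (LINT w|lborel. \<bar>f w\<bar> * exp (- (\<sigma> * w))) * exp (\<sigma> * v)"
proof -
  have "\<bar>primitive f v\<bar> \<le> (LINT w|lborel. (\<bar>f w\<bar> * exp (- (\<sigma> * w))) * exp (\<sigma> * v))"
    unfolding primitive_def real_norm_def[symmetric]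
  proof (rule Bochner_Integration.integral_norm_bound_integral)
    show "integrable lborel (\<lambda>w. if w \<le> v then f w else 0)" by (rule transformable_integrable_upto[OF f])
    show "integrable lborel (\<lambda>w. norm (f w) * exp (- (\<sigma> * w)) * exp (\<sigma> * v))"
      using integrable_norm[OF transformableD(3)[OF f \<sigma>]] by (simp add: abs_mult)
    fix w :: real
    show "norm (if w \<le> v then f w else 0) \<le> norm (f w) * exp (- (\<sigma> * w)) * exp (\<sigma> * v)"
    proof (cases "w \<le> v")
      case True
      then have "\<bar>f w\<bar> * 1 \<le> \<bar>f w\<bar> * exp (\<sigma> * v - \<sigma> * w)"
        using \<sigma> by (intro mult_left_mono) auto
      then show ?thesis using True by (simp add: exp_diff exp_minus divide_inverse mult_ac)
    qed simp
  qed
  then show ?thesis by simp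
qed

lemma primitive_neg: "transformable f \<Longrightarrow> v < 0 \<Longrightarrow> primitive f v = 0"
  using transformableD(2)[OF transformable_primitive] .

lemma primitive_increment:
  assumes "transformable f" "h \<ge> 0"
  shows "primitive f (v + h) - primitive f v = (LINT w|lborel. indicator {v<..v + h} w * f w)"
    and "integrable lborel (\<lambda>w. indicator {v<..v + h} w * f w)"
proof -
  have *: "(\<lambda>w. (if w \<le> v + h then f w else 0) - (if w \<le> v then f w else 0)) = (\<lambda>w. indicator {v<..v + h} w * f w)"
    using assms by (auto simp: fun_eq_iff indicator_def)
  note i = transformable_integrable_upto[OF assms(1)]
  show "primitive f (v + h) - primitive f v = (LINT w|lborel. indicator {v<..v + h} w * f w)"
    unfolding primitive_def *[symmetric] by (rule Bochner_Integration.integral_diff[symmetric]) (rule i)+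
  show "integrable lborel (\<lambda>w. indicator {v<..v + h} w * f w)"
    unfolding *[symmetric] by (rule Bochner_Integration.integrable_diff) (rule i)+
qed

lemma primitive_increment_bounds:
  assumes "transformable f" "h \<ge> 0" and m: "\<And>w. v \<le> w \<Longrightarrow> w \<le> v + h \<Longrightarrow> m \<le> f w"
    and M: "\<And>w. v \<le> w \<Longrightarrow> w \<le> v + h \<Longrightarrow> f w \<le> M"
  shows "h * m \<le> primitive f (v + h) - primitive f v" "primitive f (v + h) - primitive f v \<le> h * M"
proof -
  have c: "integrable lborel (\<lambda>w. indicator {v<..v + h} w * c)" 
     "(LINT w|lborel. indicator {v<..v + h} w * c) = h * c" for c :: real
    using assms(2) by simp_all
  show "h * m \<le> primitive f (v + h) - primitive f v"
    unfolding primitive_increment(1)[OF assms(1,2)] c(2)[symmetric]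
    by (rule integral_mono[OF c(1) primitive_increment(2)[OF assms(1,2)]])
       (use m in \<open>auto simp: indicator_def\<close>)
  show "primitive f (v + h) - primitive f v \<le> h * M"
    unfolding primitive_increment(1)[OF assms(1,2)] c(2)[symmetric]
    by (rule integral_mono[OF primitive_increment(2)[OF assms(1,2)] c(1)])
       (use M in \<open>auto simp: indicator_def\<close>)
qed

lemma mono_transformable_nonneg:
  assumes "mono f" "transformable f" shows "f v \<ge> 0"
proof -
  have "f (min v (-1)) \<le> f v" by (rule monoD[OF assms(1)]) simp
  then show ?thesis using transformableD(2)[OF assms(2), of "min v (-1)"] by simp
qed

lemma mono_primitive:
  assumes "transformable f" "\<And>v. f v \<ge> 0" shows "mono (primitive f)"
proof (rule monoI)
  fix x y :: real assume "x \<le> y"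
  then have "0 \<le> (LINT w|lborel. indicator {x<..x + (y - x)} w * f w)"
    using assms(2) by (intro integral_nonneg_AE) auto
  then show "primitive f x \<le> primitive f y"
    using primitive_increment(1)[OF assms(1), of "y - x" x] \<open>x \<le> y\<close> by simp
qed

lemma continuous_primitive:
  assumes f: "transformable f" and m: "mono f"
  shows "continuous_on UNIV (primitive f)"
proof (rule continuous_at_imp_continuous_on, rule ballI)
  fix v :: real
  have L: "\<bar>primitive f u - primitive f v\<bar> \<le> \<bar>u - v\<bar> * f (v + 1)" if "\<bar>u - v\<bar> \<le> 1" for u
  proof -
    define x y where "x = min u v" and "y = max u v"
    have xy: "x \<le> y" "y \<le> v + 1" using that by (auto simp: x_def y_def)
    have "primitive f (x + (y - x)) - primitive f x \<le> (y - x) * f (v + 1)"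
      using xy by (intro primitive_increment_bounds(2)[OF f, where m = 0])
        (auto intro: monoD[OF m] mono_transformable_nonneg[OF m f])
    moreover have "primitive f x \<le> primitive f y"
      by (rule monoD[OF mono_primitive[OF f mono_transformable_nonneg[OF m f]] xy(1)])
    ultimately show ?thesis by (cases "u \<le> v") (auto simp: x_def y_def min_def max_def abs_if algebra_simps)
  qed
  have "(primitive f \<longlongrightarrow> primitive f v) (at v)"
  proof (rule LIM_zero_cancel, rule Lim_null_comparison)
    show "\<forall>\<^sub>F u in at v. norm (primitive f u - primitive f v) \<le> \<bar>u - v\<bar> * f (v + 1)"
      unfolding eventually_at using L by (intro exI[of _ 1]) (auto simp: dist_real_def)
    have "((\<lambda>u. \<bar>u - v\<bar> * f (v + 1)) \<longlongrightarrow> \<bar>v - v\<bar> * f (v + 1)) (at v)" by (intro tendsto_intros)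
    then show "((\<lambda>u. \<bar>u - v\<bar> * f (v + 1)) \<longlongrightarrow> 0) (at v)" by simp
  qed
  then show "isCont (primitive f) v" by (simp add: isCont_def)
qed

section \<open>Bounding a function by its Fourier transform\<close>

lemma std_normal_fourier:
  "(LINT t|lborel. complex_of_real (std_normal_density t) * exp (\<i> * of_real (t * y))) = of_real (exp (- (y\<^sup>2) / 2))"
proof -
  have "complex_of_real (exp (- (y\<^sup>2) / 2)) = char std_normal_distribution y"
    by (simp add: char_std_normal_distribution)
  also have "\<dots> = (LINT t|lborel. std_normal_density t *\<^sub>R exp (\<i> * of_real (y * t)))"
    unfolding char_def by (subst integral_density) auto
  finally show ?thesis by (simp add: scaleR_conv_of_real mult.commute)
qed

lemma std_normal_fourier_scaled:
  assumes "\<delta> > 0"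
  shows "(LINT t|lborel. complex_of_real (std_normal_density (\<delta> * t)) * exp (\<i> * of_real (t * y)))
     = of_real (exp (- ((y / \<delta>)\<^sup>2) / 2) / \<delta>)"
proof -
  have "of_real (exp (- ((y / \<delta>)\<^sup>2) / 2)) = \<bar>\<delta>\<bar> *\<^sub>R (LINT t|lborel. complex_of_real (std_normal_density (0 + \<delta> * t)) * exp (\<i> * of_real ((0 + \<delta> * t) * (y / \<delta>))))"
    unfolding std_normal_fourier[symmetric] using assms by (intro lborel_integral_real_affine) auto
  also have "\<dots> = of_real \<delta> * (LINT t|lborel. complex_of_real (std_normal_density (\<delta> * t)) * exp (\<i> * of_real (t * y)))"
    using assms by (simp add: scaleR_conv_of_real)
  finally show ?thesis using assms by (simp add: field_simps)
qed

lemma std_normal_density_le: "std_normal_density t \<le> 1 / sqrt (2 * pi)"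
  unfolding std_normal_density_def by (simp add: divide_right_mono)

text \<open>The sup-norm half of Fourier inversion. Damp the inversion integral by a Gaussian of width
  \<open>1 / \<delta>\<close>; Fubini turns it into the average of \<open>h\<close> against a Gaussian of width \<open>\<delta>\<close> around \<open>x\<close>,
  which tends to \<open>h x\<close>.\<close>

lemma fourier_sup_bound:
  fixes h g :: "real \<Rightarrow> real"
  assumes cont: "continuous_on UNIV h" and int: "integrable lborel h"
    and bdd: "\<And>v. \<bar>h v\<bar> \<le> B"
    and g: "integrable lborel g" "\<And>t. norm (LINT v|lborel. of_real (h v) * exp (- (\<i> * of_real (t * v)))) \<le> g t"
  shows "2 * pi * \<bar>h x\<bar> \<le> (LINT t|lborel. g t)"
proof -
  have [measurable]: "h \<in> borel_measurable borel" using cont by (simp add: borel_measurable_continuous_onI)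
  define fh where "fh = (\<lambda>t. LINT v|lborel. complex_of_real (h v) * exp (- (\<i> * of_real (t * v))))"
  have fh_meas [measurable]: "fh \<in> borel_measurable borel" unfolding fh_def by measurable
  have fh_int: "integrable lborel fh"
    by (rule Bochner_Integration.integrable_bound[OF g(1)])
       (use order_trans[OF g(2) abs_ge_self] in \<open>auto simp: fh_def\<close>)
  have fhg: "norm (fh t) \<le> g t" for t unfolding fh_def by (rule g(2))
  define I where "I = (\<lambda>\<delta>. LINT t|lborel. fh t * (of_real (std_normal_density (\<delta> * t)) * exp (\<i> * of_real (t * x))))"
  have g0: "g t \<ge> 0" for t using order_trans[OF norm_ge_zero g(2)] .
  have I_le: "norm (I \<delta>) \<le> (LINT t|lborel. g t) / sqrt (2 * pi)" if "\<delta> > 0" for \<delta>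
  proof -
    have pw: "norm (fh t * (of_real (std_normal_density (\<delta> * t)) * exp (\<i> * of_real (t * x)))) \<le> g t * (1 / sqrt (2 * pi))" for t
      unfolding norm_mult using fhg[of t] std_normal_density_le[of "\<delta> * t"] g0
      by (intro mult_mono) (auto simp: norm_mult)
    have bd: "integrable lborel (\<lambda>t. g t * (1 / sqrt (2 * pi)))" using g(1) by simp
    have "norm (I \<delta>) \<le> (LINT t|lborel. g t * (1 / sqrt (2 * pi)))"
      unfolding I_def
    proof (rule Bochner_Integration.integral_norm_bound_integral[OF _ bd pw])
      show "integrable lborel (\<lambda>t. fh t * (of_real (std_normal_density (\<delta> * t)) * exp (\<i> * of_real (t * x))))"
        by (rule Bochner_Integration.integrable_bound[OF bd])
           (use order_trans[OF pw abs_ge_self] in \<open>auto\<close>)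
    qed
    then show ?thesis by simp
  qed
  have I_eq: "I \<delta> = of_real (sqrt (2 * pi) * (LINT w|lborel. h (x + \<delta> * w) * std_normal_density w))"
    if \<delta>: "\<delta> > 0" for \<delta>
  proof -
    define \<Psi> where "\<Psi> = (\<lambda>v t. complex_of_real (h v) * (of_real (std_normal_density (\<delta> * t)) * exp (\<i> * of_real (t * (x - v)))))"
    have nint: "integrable lborel (\<lambda>t. std_normal_density (\<delta> * t))"
      using lborel_integrable_real_affine[of std_normal_density \<delta> 0] \<delta> by simp
    have "integrable (lborel \<Otimes>\<^sub>M lborel) (case_prod \<Psi>)"
    proof (rule lborel_pair.Fubini_integrable)
      show "case_prod \<Psi> \<in> borel_measurable (lborel \<Otimes>\<^sub>M lborel)" unfolding \<Psi>_def by measurable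
      have "(LINT t|lborel. norm (\<Psi> v t)) = \<bar>h v\<bar> * (LINT t|lborel. std_normal_density (\<delta> * t))" for v
        unfolding \<Psi>_def by (simp add: norm_mult)
      then show "integrable lborel (\<lambda>v. LINT t|lborel. norm (case (v, t) of (v, t) \<Rightarrow> \<Psi> v t))"
        using int by simp
      have "integrable lborel (\<Psi> v)" for v
      proof (rule Bochner_Integration.integrable_bound)
        show "integrable lborel (\<lambda>t. \<bar>h v\<bar> * std_normal_density (\<delta> * t))" using nint by simp
      qed (auto simp: \<Psi>_def norm_mult)
      then show "AE v in lborel. integrable lborel (\<lambda>t. case (v, t) of (v, t) \<Rightarrow> \<Psi> v t)" by simp
    qed
    note F = lborel_pair.Fubini_integral[OF this]
    have "I \<delta> = (LINT t|lborel. LINT v|lborel. \<Psi> v t)"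
    proof -
      have "fh t * (of_real (std_normal_density (\<delta> * t)) * exp (\<i> * of_real (t * x))) = (LINT v|lborel. \<Psi> v t)" for t
      proof -
        have "integrable lborel (\<lambda>v. complex_of_real (h v) * exp (- (\<i> * of_real (t * v))))"
          by (rule Bochner_Integration.integrable_bound[OF int]) (auto simp: norm_mult)
        then have "fh t * (of_real (std_normal_density (\<delta> * t)) * exp (\<i> * of_real (t * x)))
          = (LINT v|lborel. (complex_of_real (h v) * exp (- (\<i> * of_real (t * v)))) * (of_real (std_normal_density (\<delta> * t)) * exp (\<i> * of_real (t * x))))"
          unfolding fh_def by simp
        also have "\<dots> = (LINT v|lborel. \<Psi> v t)"
          unfolding \<Psi>_def
          by (intro Bochner_Integration.integral_cong refl)
             (simp add: algebra_simps exp_diff exp_minus divide_inverse)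
        finally show ?thesis .
      qed
      then show ?thesis unfolding I_def by simp
    qed
    also have "\<dots> = (LINT v|lborel. LINT t|lborel. \<Psi> v t)" by (rule F)
    also have "\<dots> = (LINT v|lborel. complex_of_real (h v * (exp (- (((x - v) / \<delta>)\<^sup>2) / 2) / \<delta>)))"
      unfolding \<Psi>_def integral_mult_right_zero std_normal_fourier_scaled[OF \<delta>]
      by (simp only: of_real_mult)
    also have "\<dots> = complex_of_real (LINT v|lborel. h v * (exp (- (((x - v) / \<delta>)\<^sup>2) / 2) / \<delta>))"
      by (rule integral_complex_of_real)
    also have "(LINT v|lborel. h v * (exp (- (((x - v) / \<delta>)\<^sup>2) / 2) / \<delta>))
       = \<bar>\<delta>\<bar> *\<^sub>R (LINT w|lborel. h (x + \<delta> * w) * (exp (- (((x - (x + \<delta> * w)) / \<delta>)\<^sup>2) / 2) / \<delta>))"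
      using \<delta> by (intro lborel_integral_real_affine) auto
    also have "\<dots> = (LINT w|lborel. \<delta> * (h (x + \<delta> * w) * (exp (- (((x - (x + \<delta> * w)) / \<delta>)\<^sup>2) / 2) / \<delta>)))"
      using \<delta> by simp
    also have "\<dots> = (LINT w|lborel. sqrt (2 * pi) * (h (x + \<delta> * w) * std_normal_density w))"
      using \<delta> by (intro Bochner_Integration.integral_cong refl) (simp add: std_normal_density_def)
    finally show ?thesis by simp
  qed
  define \<delta> where "\<delta> = (\<lambda>n. 1 / real (Suc n))"
  have \<delta>: "\<delta> n > 0" for n by (simp add: \<delta>_def)
  have \<delta>_lim: "\<delta> \<longlonglongrightarrow> 0" unfolding \<delta>_def by (rule LIMSEQ_Suc[OF lim_1_over_n])
  have lim: "(\<lambda>n. LINT w|lborel. h (x + \<delta> n * w) * std_normal_density w) \<longlonglongrightarrow> (LINT w|lborel. h x * std_normal_density w)"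
  proof (rule integral_dominated_convergence[where w = "\<lambda>w. B * std_normal_density w"])
    show "AE w in lborel. (\<lambda>n. h (x + \<delta> n * w) * std_normal_density w) \<longlonglongrightarrow> h x * std_normal_density w"
    proof (rule AE_I2)
      fix w
      have "(\<lambda>n. x + \<delta> n * w) \<longlonglongrightarrow> x + 0 * w" by (intro tendsto_intros \<delta>_lim)
      then have "(\<lambda>n. h (x + \<delta> n * w)) \<longlonglongrightarrow> h x"
        using cont by (auto intro: continuous_on_tendsto_compose)
      then show "(\<lambda>n. h (x + \<delta> n * w) * std_normal_density w) \<longlonglongrightarrow> h x * std_normal_density w"
        by (intro tendsto_intros)
    qed
    show "integrable lborel (\<lambda>w. B * std_normal_density w)" by simp
    show "AE w in lborel. norm (h (x + \<delta> n * w) * std_normal_density w) \<le> B * std_normal_density w" for n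
      using bdd by (intro AE_I2) (auto simp: abs_mult intro!: mult_right_mono)
  qed auto
  then have lim: "(\<lambda>n. LINT w|lborel. h (x + \<delta> n * w) * std_normal_density w) \<longlonglongrightarrow> h x" by simp
  have "sqrt (2 * pi) * \<bar>LINT w|lborel. h (x + \<delta> n * w) * std_normal_density w\<bar> \<le> (LINT t|lborel. g t) / sqrt (2 * pi)" for n
  proof -
    have "norm (I (\<delta> n)) = \<bar>sqrt (2 * pi)\<bar> * \<bar>LINT w|lborel. h (x + \<delta> n * w) * std_normal_density w\<bar>"
      by (simp only: I_eq[OF \<delta>] norm_of_real abs_mult)
    then show ?thesis using I_le[OF \<delta>, of n] by simp
  qed
  then have "sqrt (2 * pi) * \<bar>h x\<bar> \<le> (LINT t|lborel. g t) / sqrt (2 * pi)"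
    by (intro LIMSEQ_le_const2[OF tendsto_mult[OF tendsto_const tendsto_rabs[OF lim]]]) auto
  then have "sqrt (2 * pi) * \<bar>h x\<bar> * sqrt (2 * pi) \<le> (LINT t|lborel. g t)"
    by (subst (asm) pos_le_divide_eq) auto
  moreover have "sqrt (2 * pi) * \<bar>h x\<bar> * sqrt (2 * pi) = 2 * pi * \<bar>h x\<bar>"
  proof -
    have "sqrt (2 * pi) * \<bar>h x\<bar> * sqrt (2 * pi) = (sqrt (2 * pi) * sqrt (2 * pi)) * \<bar>h x\<bar>" by (simp only: mult_ac)
    also have "sqrt (2 * pi) * sqrt (2 * pi) = 2 * pi" by (intro real_sqrt_mult_self[THEN trans]) auto
    finally show ?thesis .
  qed
  ultimately show ?thesis by simp
qed

section \<open>Polynomial growth of all derivatives on vertical lines\<close>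

text \<open>The estimates are confined to \<open>1 < Re s \<le> 2\<close>, where \<open>|s|\<close> is comparable to \<open>1 + |Im s|\<close>, so that
  \<open>s\<close> itself has growth 1 and \<open>1 / s\<close> has growth -1.\<close>

definition strip_bound :: "real \<Rightarrow> (complex \<Rightarrow> complex) \<Rightarrow> bool" where
  "strip_bound A f \<longleftrightarrow>
     (\<exists>C. \<forall>s. 1 < Re s \<longrightarrow> Re s \<le> 2 \<longrightarrow> norm (f s) \<le> C * (1 + \<bar>Im s\<bar>) powr A)"

definition poly_growth :: "real \<Rightarrow> (complex \<Rightarrow> complex) \<Rightarrow> bool" where
  "poly_growth A F \<longleftrightarrow> F holomorphic_on half_plane \<and> (\<forall>n. strip_bound A ((deriv ^^ n) F))"

lemma strip_boundI:
  assumes "\<And>s. 1 < Re s \<Longrightarrow> Re s \<le> 2 \<Longrightarrow> norm (f s) \<le> C * (1 + \<bar>Im s\<bar>) powr A"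
  shows "strip_bound A f"
  using assms unfolding strip_bound_def by blast

lemma strip_boundE:
  assumes "strip_bound A f"
  obtains C where "C > 0" "\<And>s. 1 < Re s \<Longrightarrow> Re s \<le> 2 \<Longrightarrow> norm (f s) \<le> C * (1 + \<bar>Im s\<bar>) powr A"
proof -
  obtain C where C: "\<And>s. 1 < Re s \<Longrightarrow> Re s \<le> 2 \<Longrightarrow> norm (f s) \<le> C * (1 + \<bar>Im s\<bar>) powr A"
    using assms unfolding strip_bound_def by blast
  have "norm (f s) \<le> (\<bar>C\<bar> + 1) * (1 + \<bar>Im s\<bar>) powr A" if "1 < Re s" "Re s \<le> 2" for s
    using C[OF that] by (rule order_trans) (intro mult_right_mono, auto)
  then show ?thesis by (intro that[of "\<bar>C\<bar> + 1"]) auto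
qed

lemma strip_bound_mono:
  assumes "strip_bound A f" "A \<le> B" shows "strip_bound B f"
proof -
  obtain C where C: "C > 0" "\<And>s. 1 < Re s \<Longrightarrow> Re s \<le> 2 \<Longrightarrow> norm (f s) \<le> C * (1 + \<bar>Im s\<bar>) powr A"
    using strip_boundE[OF assms(1)] by blast
  show ?thesis
    by (rule strip_boundI[of _ C], rule order_trans[OF C(2)])
       (use C(1) assms(2) in \<open>auto intro!: mult_left_mono powr_mono\<close>)
qed

lemma strip_bound_cong:
  assumes "strip_bound A f" "\<And>s. 1 < Re s \<Longrightarrow> Re s \<le> 2 \<Longrightarrow> norm (g s) \<le> norm (f s)"
  shows "strip_bound A g"
  using assms unfolding strip_bound_def by (meson order_trans)

lemma strip_bound_const: "A \<ge> 0 \<Longrightarrow> strip_bound A (\<lambda>_. c)"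
  by (rule strip_boundI[of _ "norm c"]) (auto intro!: mult_le_cancel_left1[THEN iffD2] ge_one_powr_ge_zero)

lemma strip_bound_add:
  assumes "strip_bound A f" "strip_bound A g" shows "strip_bound A (\<lambda>s. f s + g s)"
proof -
  obtain C D where C: "\<And>s. 1 < Re s \<Longrightarrow> Re s \<le> 2 \<Longrightarrow> norm (f s) \<le> C * (1 + \<bar>Im s\<bar>) powr A"
    and D: "\<And>s. 1 < Re s \<Longrightarrow> Re s \<le> 2 \<Longrightarrow> norm (g s) \<le> D * (1 + \<bar>Im s\<bar>) powr A"
    using strip_boundE[OF assms(1)] strip_boundE[OF assms(2)] by metis
  have "norm (f s + g s) \<le> (C + D) * (1 + \<bar>Im s\<bar>) powr A" if "1 < Re s" "Re s \<le> 2" for s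
    using norm_triangle_ineq[of "f s" "g s"] C[OF that] D[OF that] by (simp add: distrib_right)
  then show ?thesis by (rule strip_boundI)
qed

lemma strip_bound_mult:
  assumes "strip_bound A f" "strip_bound B g" shows "strip_bound (A + B) (\<lambda>s. f s * g s)"
proof -
  obtain C D where C: "C > 0" "\<And>s. 1 < Re s \<Longrightarrow> Re s \<le> 2 \<Longrightarrow> norm (f s) \<le> C * (1 + \<bar>Im s\<bar>) powr A"
    and D: "D > 0" "\<And>s. 1 < Re s \<Longrightarrow> Re s \<le> 2 \<Longrightarrow> norm (g s) \<le> D * (1 + \<bar>Im s\<bar>) powr B"
    using strip_boundE[OF assms(1)] strip_boundE[OF assms(2)] by metis
  have "norm (f s * g s) \<le> (C * D) * (1 + \<bar>Im s\<bar>) powr (A + B)" if "1 < Re s" "Re s \<le> 2" for s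
  proof -
    have "norm (f s * g s) \<le> (C * (1 + \<bar>Im s\<bar>) powr A) * (D * (1 + \<bar>Im s\<bar>) powr B)"
      unfolding norm_mult by (intro mult_mono C(2) D(2) that) (use C(1) in auto)
    then show ?thesis by (simp add: powr_add mult_ac)
  qed
  then show ?thesis by (rule strip_boundI)
qed

lemma strip_bound_cmult: "strip_bound A f \<Longrightarrow> strip_bound A (\<lambda>s. c * f s)"
  using strip_bound_mult[OF strip_bound_const[of 0 c], of A f] by simp

lemma strip_bound_sum:
  assumes "A \<ge> 0" "\<And>i. i \<in> I \<Longrightarrow> strip_bound A (f i)"
  shows "strip_bound A (\<lambda>s. \<Sum>i\<in>I. f i s)"
  using assms(2)
  by (induction I rule: infinite_finite_induct) (auto intro: strip_bound_add strip_bound_const assms(1))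

lemma poly_growthD:
  assumes "poly_growth A F"
  shows "F holomorphic_on half_plane" "strip_bound A ((deriv ^^ n) F)" "strip_bound A F"
  using assms unfolding poly_growth_def by (auto dest: spec[of _ 0])

lemma poly_growth_mono: "poly_growth A F \<Longrightarrow> A \<le> B \<Longrightarrow> poly_growth B F"
  unfolding poly_growth_def using strip_bound_mono by blast

lemma higher_deriv_half_plane_cong:
  assumes "\<And>s. Re s > 1 \<Longrightarrow> F s = G s" "Re s > 1"
  shows "(deriv ^^ n) F s = (deriv ^^ n) G s"
  by (rule higher_deriv_cong_ev[OF _ refl])
     (use eventually_nhds_in_open[OF open_half_plane, of s] assms in \<open>auto elim: eventually_mono\<close>)

lemma poly_growth_cong:
  assumes "poly_growth A F" "\<And>s. Re s > 1 \<Longrightarrow> F s = G s"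
  shows "poly_growth A G"
  unfolding poly_growth_def
proof (intro conjI allI)
  show "G holomorphic_on half_plane"
    by (rule holomorphic_transform[OF poly_growthD(1)[OF assms(1)]]) (use assms(2) in auto)
  show "strip_bound A ((deriv ^^ n) G)" for n
    by (rule strip_bound_cong[OF poly_growthD(2)[OF assms(1)]])
       (use higher_deriv_half_plane_cong[OF assms(2)] in auto)
qed

lemma poly_growth_deriv: "poly_growth A F \<Longrightarrow> poly_growth A (deriv F)"
  unfolding poly_growth_def funpow_swap1
  by (auto intro: holomorphic_deriv[OF _ open_half_plane] simp flip: funpow_Suc_right simp del: funpow.simps)
     (metis comp_apply funpow_Suc_right)

lemma poly_growth_add:
  assumes "poly_growth A F" "poly_growth A G" shows "poly_growth A (\<lambda>s. F s + G s)"
  unfolding poly_growth_def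
proof (intro conjI allI)
  note hol = poly_growthD(1)[OF assms(1)] poly_growthD(1)[OF assms(2)]
  show "(\<lambda>s. F s + G s) holomorphic_on half_plane" by (intro holomorphic_intros hol)
  show "strip_bound A ((deriv ^^ n) (\<lambda>s. F s + G s))" for n
    by (rule strip_bound_cong[OF strip_bound_add[OF poly_growthD(2)[OF assms(1), of n] poly_growthD(2)[OF assms(2), of n]]])
       (simp add: higher_deriv_add[OF hol open_half_plane])
qed

lemma poly_growth_mult:
  assumes "poly_growth A F" "poly_growth B G" shows "poly_growth (A + B) (\<lambda>s. F s * G s)"
  unfolding poly_growth_def
proof (intro conjI allI)
  note hol = poly_growthD(1)[OF assms(1)] poly_growthD(1)[OF assms(2)]
  show "(\<lambda>s. F s * G s) holomorphic_on half_plane" by (intro holomorphic_intros hol)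
  fix n
  have terms: "strip_bound (A + B) (\<lambda>s. of_nat (n choose i) * (deriv ^^ i) F s * (deriv ^^ (n - i)) G s)" for i
    unfolding mult.assoc
    by (intro strip_bound_cmult strip_bound_mult poly_growthD(2) assms)
  have *: "strip_bound (A + B) (\<lambda>s. \<Sum>i\<in>I. of_nat (n choose i) * (deriv ^^ i) F s * (deriv ^^ (n - i)) G s)"
    if "finite I" for I
    using that
  proof (induction I rule: finite_induct)
    case empty show ?case by (rule strip_boundI[of _ 0]) auto
  qed (auto intro!: strip_bound_add terms)
  show "strip_bound (A + B) ((deriv ^^ n) (\<lambda>s. F s * G s))"
    by (rule strip_bound_cong[OF *[of "{0..n}"]])
       (simp_all add: higher_deriv_mult[OF hol open_half_plane])
qed

lemma poly_growth_const: "A \<ge> 0 \<Longrightarrow> poly_growth A (\<lambda>_. c)"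
  unfolding poly_growth_def by (auto intro!: strip_bound_const)

lemma poly_growth_cmult: "poly_growth A F \<Longrightarrow> poly_growth A (\<lambda>s. c * F s)"
  using poly_growth_mult[OF poly_growth_const[of 0 c], of A F] by simp

lemma poly_growth_diff:
  assumes "poly_growth A F" "poly_growth A G" shows "poly_growth A (\<lambda>s. F s - G s)"
  using poly_growth_add[OF assms(1) poly_growth_cmult[OF assms(2), of "-1"]] by simp

lemma poly_growth_ident: "poly_growth 1 (\<lambda>s. s)"
  unfolding poly_growth_def
proof (intro conjI allI)
  fix n
  have "norm s \<le> 2 * (1 + \<bar>Im s\<bar>)" if "1 < Re s" "Re s \<le> 2" for s
  proof -
    have "\<bar>Re s\<bar> \<le> 2" using that by simp
    then show ?thesis using cmod_le[of s] by argo
  qed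
  then have id: "strip_bound 1 (\<lambda>s. s)" by (intro strip_boundI[of _ 2]) (auto simp: powr_one)
  show "strip_bound 1 ((deriv ^^ n) (\<lambda>s. s))"
    by (cases n; cases "n = 1") (auto simp: higher_deriv_ident[abs_def] id intro!: strip_bound_const)
qed (intro holomorphic_intros)

text \<open>Cauchy's estimate on a disc of radius 1/2, which stays away from the origin.\<close>

lemma poly_growth_inverse: "poly_growth (-1) (\<lambda>s. 1 / s)"
  unfolding poly_growth_def
proof (intro conjI allI)
  show "(\<lambda>s. 1 / s) holomorphic_on half_plane" by (intro holomorphic_intros) auto
  fix n
  show "strip_bound (-1) ((deriv ^^ n) (\<lambda>s. 1 / s))"
  proof (rule strip_boundI)
    fix s :: complex assume s: "1 < Re s" "Re s \<le> 2"
    have Re: "Re w \<ge> 1 / 2" and w0: "w \<noteq> 0" and Im: "\<bar>Im w\<bar> \<ge> \<bar>Im s\<bar> - 1 / 2" if "dist s w \<le> 1 / 2" for w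
    proof -
      show R: "Re w \<ge> 1 / 2"
        using abs_Re_le_cmod[of "s - w"] that s by (simp add: dist_norm)
      then show "w \<noteq> 0" by auto
      show "\<bar>Im w\<bar> \<ge> \<bar>Im s\<bar> - 1 / 2"
        using abs_Im_le_cmod[of "s - w"] that by (simp add: dist_norm)
    qed
    have "norm ((deriv ^^ n) (\<lambda>s. 1 / s) s) \<le> fact n * (4 / (1 + \<bar>Im s\<bar>)) / (1 / 2) ^ n"
    proof (rule Cauchy_inequality)
      show "(\<lambda>s. 1 / s) holomorphic_on ball s (1 / 2)" using w0 by (intro holomorphic_intros) force
      show "continuous_on (cball s (1 / 2)) (\<lambda>s. 1 / s)" using w0 by (intro continuous_intros) force
      fix w assume "norm (s - w) = 1 / 2"
      then have d: "dist s w \<le> 1 / 2" by (simp add: dist_norm)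
      have "norm w \<ge> (1 + \<bar>Im s\<bar>) / 4"
        using Re[OF d] Im[OF d] abs_Re_le_cmod[of w] abs_Im_le_cmod[of w] by (cases "\<bar>Im s\<bar> \<le> 1") auto
      then show "norm (1 / w) \<le> 4 / (1 + \<bar>Im s\<bar>)"
        using w0[OF d] by (simp add: norm_divide field_simps)
    qed simp
    also have "\<dots> = (fact n * 4 / (1 / 2) ^ n) * (1 + \<bar>Im s\<bar>) powr (-1)"
      by (simp add: powr_neg_one)
    finally show "norm ((deriv ^^ n) (\<lambda>s. 1 / s) s) \<le> (fact n * 4 / (1 / 2) ^ n) * (1 + \<bar>Im s\<bar>) powr (-1)" .
  qed
qed

lemma poly_growth_inverse_power: "poly_growth (- real k) (\<lambda>s. 1 / s ^ k)"
proof (induction k)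
  case 0 show ?case by (simp add: poly_growth_const)
next
  case (Suc k)
  show ?case using poly_growth_mult[OF poly_growth_inverse Suc] by (simp add: mult.commute)
qed

text \<open>Leibniz' rule expresses \<open>F\<close> differentiated \<open>n + 1\<close> times by lower derivatives of \<open>F\<close> times
  derivatives of \<open>L\<close>. Each step costs an arbitrarily small power only, which is why the exponent
  \<open>B\<close> can be fixed once for all derivatives.\<close>

lemma poly_growth_ode:
  assumes F: "F holomorphic_on half_plane" "strip_bound A F" and A: "A \<ge> 0"
    and L: "\<And>\<epsilon>. \<epsilon> > 0 \<Longrightarrow> poly_growth \<epsilon> L"
    and ode: "\<And>s. Re s > 1 \<Longrightarrow> deriv F s = F s * L s"
    and B: "B > A"
  shows "poly_growth B F"
proof -
  have "\<forall>B>A. strip_bound B ((deriv ^^ n) F)" for n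
  proof (induction n rule: less_induct)
    case (less n)
    show ?case
    proof (cases n)
      case 0 then show ?thesis using F(2) strip_bound_mono by fastforce
    next
      case (Suc m)
      show ?thesis
      proof (intro allI impI)
        fix B assume B: "B > A"
        define \<epsilon> where "\<epsilon> = (B - A) / 2"
        have eps: "\<epsilon> > 0" "A + \<epsilon> > A" "(A + \<epsilon>) + \<epsilon> = B" using B by (auto simp: \<epsilon>_def field_simps)
        note hol = F(1) poly_growthD(1)[OF L[OF eps(1)]]
        have "strip_bound B (\<lambda>s. (deriv ^^ i) F s * (deriv ^^ (m - i)) L s)" if "i \<le> m" for i
          unfolding eps(3)[symmetric]
          by (rule strip_bound_mult) (use less.IH[of i] that Suc eps poly_growthD(2)[OF L] in auto)
        then have "strip_bound B (\<lambda>s. \<Sum>i=0..m. of_nat (m choose i) * ((deriv ^^ i) F s * (deriv ^^ (m - i)) L s))"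
          using A B by (intro strip_bound_sum strip_bound_cmult) auto
        then show "strip_bound B ((deriv ^^ n) F)"
        proof (rule strip_bound_cong)
          fix s assume s: "1 < Re s"
          have "(deriv ^^ n) F s = (deriv ^^ m) (deriv F) s" by (simp only: Suc funpow_Suc_right comp_apply)
          also have "\<dots> = (deriv ^^ m) (\<lambda>s. F s * L s) s"
            by (rule higher_deriv_half_plane_cong[OF ode s])
          also have "\<dots> = (\<Sum>i=0..m. of_nat (m choose i) * ((deriv ^^ i) F s * (deriv ^^ (m - i)) L s))"
            using s by (simp add: higher_deriv_mult[OF hol open_half_plane] mult.assoc)
          finally show "norm ((deriv ^^ n) F s) \<le> norm (\<Sum>i=0..m. of_nat (m choose i) * ((deriv ^^ i) F s * (deriv ^^ (m - i)) L s))"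
            by simp
        qed
      qed
    qed
  qed
  then show ?thesis using F(1) B by (auto simp: poly_growth_def)
qed

text \<open>Solve Leibniz' rule for the top derivative of the quotient \<open>F = W / Z\<close> and use induction.\<close>

lemma poly_growth_divide:
  assumes F: "F holomorphic_on half_plane"
    and Z: "\<And>\<epsilon>. \<epsilon> > 0 \<Longrightarrow> poly_growth \<epsilon> Z" and W: "\<And>\<epsilon>. \<epsilon> > 0 \<Longrightarrow> poly_growth \<epsilon> W"
    and eq: "\<And>s. Re s > 1 \<Longrightarrow> F s * Z s = W s"
    and Z0: "\<And>s. Re s > 1 \<Longrightarrow> Z s \<noteq> 0"
    and inv: "\<And>\<epsilon>. \<epsilon> > 0 \<Longrightarrow> strip_bound \<epsilon> (\<lambda>s. 1 / Z s)"
    and eps: "\<epsilon> > 0"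
  shows "poly_growth \<epsilon> F"
proof -
  have "\<forall>\<epsilon>>0. strip_bound \<epsilon> ((deriv ^^ n) F)" for n
  proof (induction n rule: less_induct)
    case (less n)
    show ?case
    proof (intro allI impI)
      fix \<epsilon> :: real assume eps: "\<epsilon> > 0"
      define \<delta> where "\<delta> = \<epsilon> / 4"
      have d: "\<delta> > 0" "2 * \<delta> > 0" "\<delta> + \<delta> = 2 * \<delta>" "2 * \<delta> + 2 * \<delta> = \<epsilon>" using eps by (auto simp: \<delta>_def)
      note hol = F poly_growthD(1)[OF Z[OF d(1)]]
      let ?S = "\<lambda>s. \<Sum>i<n. of_nat (n choose i) * ((deriv ^^ i) F s * (deriv ^^ (n - i)) Z s)"
      have "strip_bound (\<delta> + \<delta>) (\<lambda>s. (deriv ^^ i) F s * (deriv ^^ (n - i)) Z s)" if "i < n" for i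
        by (rule strip_bound_mult) (use less.IH[of i] that d poly_growthD(2)[OF Z] in auto)
      then have S: "strip_bound (2 * \<delta>) ?S"
        unfolding d(3) using d(2) by (intro strip_bound_sum strip_bound_cmult) auto
      have "strip_bound (2 * \<delta> + 2 * \<delta>) (\<lambda>s. (1 / Z s) * ((deriv ^^ n) W s + (-1) * ?S s))"
        by (intro strip_bound_mult inv strip_bound_add strip_bound_cmult S poly_growthD(2) W d)
      then show "strip_bound \<epsilon> ((deriv ^^ n) F)" unfolding d(4)
      proof (rule strip_bound_cong)
        fix s assume s: "1 < Re s"
        have "(deriv ^^ n) W s = (deriv ^^ n) (\<lambda>s. F s * Z s) s"
          by (rule higher_deriv_half_plane_cong[OF eq[symmetric] s])
        also have "\<dots> = (\<Sum>i=0..n. of_nat (n choose i) * ((deriv ^^ i) F s * (deriv ^^ (n - i)) Z s))"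
          using s by (simp add: higher_deriv_mult[OF hol open_half_plane] mult.assoc)
        also have "{0..n} = insert n {..<n}" by auto
        finally have "(deriv ^^ n) W s = (deriv ^^ n) F s * Z s + ?S s" by simp
        then show "norm ((deriv ^^ n) F s) \<le> norm ((1 / Z s) * ((deriv ^^ n) W s + (-1) * ?S s))"
          using Z0[OF s] by simp
      qed
    qed
  qed
  then show ?thesis using F eps by (auto simp: poly_growth_def)
qed

section \<open>Interpolation between a growth bound and the distance to the line 1\<close>

lemma strip_powr_mono:
  assumes "\<bar>Im w\<bar> \<le> \<bar>Im s\<bar>" "A \<ge> 0"
  shows "(1 + \<bar>Im w\<bar>) powr A \<le> (1 + \<bar>Im s\<bar>) powr A"
  using assms by (intro powr_mono2) auto

lemma Cauchy_near_axis:
  assumes hol: "F holomorphic_on half_plane"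
    and crude: "\<And>s. 1 < Re s \<Longrightarrow> Re s \<le> 3 \<Longrightarrow> norm (F s) \<le> C / (Re s - 1) ^ K"
    and s: "1 < Re s" "Re s \<le> 2"
  shows "norm ((deriv ^^ n) F s) \<le> (fact n * C * 2 ^ (K + n)) / (Re s - 1) ^ (K + n)"
proof -
  define r where "r = (Re s - 1) / 2"
  have r: "r > 0" "Re s - 1 = 2 * r" using s by (auto simp: r_def)
  have Re: "Re w \<ge> 1 + r \<and> Re w \<le> 3" if "norm (s - w) \<le> r" for w
    using abs_Re_le_cmod[of "s - w"] that r s by (auto simp: abs_if split: if_splits)
  have "C / (3 - 1) ^ K \<ge> 0" using order_trans[OF norm_ge_zero crude[of 3]] by simp
  then have "0 * (3 - 1) ^ K \<le> C" by (subst (asm) pos_le_divide_eq) auto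
  then have C: "C \<ge> 0" by simp
  have "norm ((deriv ^^ n) F s) \<le> fact n * (C / r ^ K) / r ^ n"
  proof (rule Cauchy_inequality)
    have sub: "cball s r \<subseteq> half_plane" using Re r by (force simp: dist_norm)
    show "F holomorphic_on ball s r" using holomorphic_on_subset[OF hol] sub ball_subset_cball by blast
    show "continuous_on (cball s r) F"
      using holomorphic_on_imp_continuous_on[OF holomorphic_on_subset[OF hol sub]] .
    fix w assume "norm (s - w) = r"
    then have w: "Re w \<ge> 1 + r" "Re w \<le> 3" using Re by auto
    have "norm (F w) \<le> C / (Re w - 1) ^ K" using crude[of w] w r by auto
    also have "\<dots> \<le> C / r ^ K"
      using w r C by (intro divide_left_mono power_mono mult_pos_pos) auto
    finally show "norm (F w) \<le> C / r ^ K" .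
  qed (use r in auto)
  also have "\<dots> = (fact n * C * 2 ^ (K + n)) / (Re s - 1) ^ (K + n)"
    using r(1) unfolding r(2) by (simp add: power_mult_distrib power_add field_simps)
  finally show ?thesis .
qed

text \<open>Far from the line \<open>Re s = 1\<close> Cauchy's estimate is good, since it involves only the distance to
  that line. Close to it expand around \<open>w = 1 + \<eta> + i t\<close> with \<open>\<eta> = T ^ (- \<delta>)\<close>: the \<open>i\<close>-th Taylor
  term is \<open>O(\<eta> ^ (- K - n))\<close> for every \<open>i\<close>, and the remainder \<open>O(\<eta> ^ (m + 1) T ^ A)\<close> is bounded
  once the order \<open>m\<close> of the expansion exceeds \<open>A / \<delta>\<close>.\<close>

lemma interpolation:
  assumes F: "poly_growth A F"
    and crude: "\<And>s. 1 < Re s \<Longrightarrow> Re s \<le> 3 \<Longrightarrow> norm (F s) \<le> C / (Re s - 1) ^ K"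
    and eps: "\<epsilon> > 0"
  shows "poly_growth \<epsilon> F"
  unfolding poly_growth_def
proof (intro conjI allI)
  note hol = poly_growthD(1)[OF F]
  show "F holomorphic_on half_plane" by (rule hol)
  fix n
  define D where "D = (\<lambda>i. fact i * C * 2 ^ (K + i) :: real)"
  have D: "norm ((deriv ^^ i) F s) \<le> D i / (Re s - 1) ^ (K + i)" if "1 < Re s" "Re s \<le> 2" for i s
    using Cauchy_near_axis[OF hol crude that, of i] by (simp add: D_def)
  have D0: "D i \<ge> 0" for i
    using order_trans[OF norm_ge_zero D[of 2 i]] by simp
  define \<delta> where "\<delta> = \<epsilon> / real (K + n + 1)"
  have \<delta>: "\<delta> > 0" using eps by (simp add: \<delta>_def)
  have dKn: "\<delta> * real (K + n) \<le> \<epsilon>"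
    using eps by (simp add: \<delta>_def field_simps)
  obtain m :: nat where m: "real m \<ge> A / \<delta>" using real_arch_simple by blast
  then have m: "A \<le> \<delta> * real (m + 1)" using \<delta> by (simp add: field_simps)
  obtain E where E: "E > 0" "\<And>s. 1 < Re s \<Longrightarrow> Re s \<le> 2 \<Longrightarrow>
      norm ((deriv ^^ (n + (m + 1))) F s) \<le> E * (1 + \<bar>Im s\<bar>) powr A"
    using strip_boundE[OF poly_growthD(2)[OF F]] by metis
  show "strip_bound \<epsilon> ((deriv ^^ n) F)"
  proof (rule strip_boundI)
    fix s :: complex assume s: "1 < Re s" "Re s \<le> 2"
    define T where "T = 1 + \<bar>Im s\<bar>"
    have T: "T \<ge> 1" by (simp add: T_def)
    define \<eta> where "\<eta> = T powr (- \<delta>)"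
    have \<eta>: "\<eta> > 0" "\<eta> \<le> 1"
      using T \<delta> powr_mono[of "- \<delta>" 0 T] by (auto simp: \<eta>_def)
    have \<eta>_inv: "1 / \<eta> ^ j = T powr (\<delta> * real j)" for j
    proof -
      have "\<eta> ^ j = \<eta> powr real j" using \<eta> by (simp add: powr_realpow)
      also have "\<dots> = T powr (- (\<delta> * real j))" by (simp add: \<eta>_def powr_powr)
      finally show ?thesis by (simp add: powr_minus divide_inverse)
    qed
    have \<eta>_bd: "1 / \<eta> ^ (K + n) \<le> T powr \<epsilon>"
      unfolding \<eta>_inv using T dKn by (intro powr_mono) auto
    have sumD: "(\<Sum>i\<le>m. D (n + i)) \<ge> D n"
      using D0 member_le_sum[of 0 "{..m}" "\<lambda>i. D (n + i)"] by simp
    show "norm ((deriv ^^ n) F s) \<le> ((\<Sum>i\<le>m. D (n + i)) + E) * (1 + \<bar>Im s\<bar>) powr \<epsilon>"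
    proof (cases "Re s - 1 \<ge> \<eta>")
      case True
      have "norm ((deriv ^^ n) F s) \<le> D n / (Re s - 1) ^ (K + n)" by (rule D[OF s])
      also have "\<dots> \<le> D n / \<eta> ^ (K + n)"
        using True \<eta> D0 s by (intro divide_left_mono power_mono mult_pos_pos) auto
      also have "\<dots> = D n * (1 / \<eta> ^ (K + n))" by simp
      also have "\<dots> \<le> ((\<Sum>i\<le>m. D (n + i)) + E) * T powr \<epsilon>"
        using \<eta>_bd sumD D0[of n] E(1) \<eta> by (intro mult_mono) auto
      finally show ?thesis by (simp add: T_def)
    next
      case False
      define w where "w = Complex (1 + \<eta>) (Im s)"
      have seg: "1 < Re u \<and> Re u \<le> 2 \<and> Im u = Im s" if u: "u \<in> closed_segment s w" for u
      proof -
        obtain \<theta> where \<theta>: "0 \<le> \<theta>" "\<theta> \<le> 1" "u = (1 - \<theta>) *\<^sub>R s + \<theta> *\<^sub>R w"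
          using u unfolding in_segment(1) by (elim exE conjE)
        have "Re u = (1 - \<theta>) * Re s + \<theta> * (1 + \<eta>)" "Im u = Im s"
          unfolding \<theta>(3) by (simp_all add: w_def) (simp add: algebra_simps)
        moreover have "(1 - \<theta>) * Re s + \<theta> * (1 + \<eta>) \<le> 1 + \<eta>"
          using \<theta> False by (intro convex_bound_le) auto
        moreover have "(1 - \<theta>) * Re s + \<theta> * (1 + \<eta>) \<ge> Re s"
          using mult_left_mono[of "Re s" "1 + \<eta>" \<theta>] \<theta> False by (simp add: algebra_simps)
        ultimately show ?thesis using s \<eta> by auto
      qed
      have sw: "norm (s - w) \<le> \<eta>"
        using False s by (simp add: w_def cmod_def)
      have "norm ((deriv ^^ (n + 0)) F s - (\<Sum>i\<le>m. (deriv ^^ (n + i)) F w * (s - w) ^ i / fact i))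
          \<le> (E * T powr A) * norm (s - w) ^ Suc m / fact m"
      proof (rule complex_Taylor[where S = "closed_segment s w" and f = "\<lambda>i. (deriv ^^ (n + i)) F"])
        fix i u assume "u \<in> closed_segment s w"
        then have "u \<in> half_plane" using seg by auto
        then have "((deriv ^^ (n + i)) F has_field_derivative (deriv ^^ Suc (n + i)) F u) (at u)"
          using has_field_derivative_higher_deriv[OF hol open_half_plane] by blast
        then show "((deriv ^^ (n + i)) F has_field_derivative (deriv ^^ (n + Suc i)) F u) (at u within closed_segment s w)"
          by (simp add: has_field_derivative_at_within)
      next
        fix u assume "u \<in> closed_segment s w"
        then show "norm ((deriv ^^ (n + Suc m)) F u) \<le> E * T powr A"
          using E(2)[of u] seg[of u] by (simp add: T_def)
      qed auto
      also have "\<dots> \<le> (E * T powr A) * \<eta> ^ Suc m / 1"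
        using E(1) sw \<eta> by (intro frac_le mult_left_mono power_mono mult_nonneg_nonneg) auto
      also have "\<dots> \<le> E * 1"
      proof -
        have "T powr A \<le> T powr (\<delta> * real (m + 1))" using T m by (intro powr_mono) auto
        also have "\<dots> = 1 / \<eta> ^ Suc m" using \<eta>_inv[of "m + 1"] by simp
        finally have "T powr A * \<eta> ^ Suc m \<le> 1" using \<eta> by (simp add: field_simps)
        then have "E * (T powr A * \<eta> ^ Suc m) \<le> E * 1" using E(1) by (intro mult_left_mono) auto
        then show ?thesis by (simp add: mult_ac)
      qed
      finally have rem: "norm ((deriv ^^ n) F s - (\<Sum>i\<le>m. (deriv ^^ (n + i)) F w * (s - w) ^ i / fact i)) \<le> E * 1"
        by simp
      have "norm (\<Sum>i\<le>m. (deriv ^^ (n + i)) F w * (s - w) ^ i / fact i) \<le> (\<Sum>i\<le>m. D (n + i) * (1 / \<eta> ^ (K + n)))"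
      proof (rule order_trans[OF norm_sum sum_mono])
        fix i
        have "norm ((deriv ^^ (n + i)) F w * (s - w) ^ i / fact i)
          = norm ((deriv ^^ (n + i)) F w) * norm (s - w) ^ i / fact i"
          by (simp add: norm_mult norm_divide norm_power)
        also have "\<dots> \<le> norm ((deriv ^^ (n + i)) F w) * norm (s - w) ^ i / 1"
          by (intro divide_left_mono) auto
        also have "\<dots> \<le> (D (n + i) / \<eta> ^ (K + (n + i))) * \<eta> ^ i"
          using D[of w "n + i"] sw \<eta> D0[of "n + i"] unfolding div_by_1
          by (intro mult_mono power_mono) (auto simp: w_def)
        also have "\<dots> = D (n + i) * (1 / \<eta> ^ (K + n))"
          using \<eta> by (simp add: power_add field_simps)
        finally show "norm ((deriv ^^ (n + i)) F w * (s - w) ^ i / fact i) \<le> D (n + i) * (1 / \<eta> ^ (K + n))" .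
      qed
      also have "\<dots> \<le> (\<Sum>i\<le>m. D (n + i) * T powr \<epsilon>)"
        by (intro sum_mono mult_left_mono \<eta>_bd D0)
      also have "\<dots> = (\<Sum>i\<le>m. D (n + i)) * T powr \<epsilon>" by (simp add: sum_distrib_right)
      finally have main: "norm (\<Sum>i\<le>m. (deriv ^^ (n + i)) F w * (s - w) ^ i / fact i) \<le> (\<Sum>i\<le>m. D (n + i)) * T powr \<epsilon>" .
      have "E * 1 \<le> E * T powr \<epsilon>" using E(1) T eps by (intro mult_left_mono ge_one_powr_ge_zero) auto
      then have "norm ((deriv ^^ n) F s) \<le> (\<Sum>i\<le>m. D (n + i)) * T powr \<epsilon> + E * T powr \<epsilon>"
        using rem main norm_triangle_sub[of "(deriv ^^ n) F s" "\<Sum>i\<le>m. (deriv ^^ (n + i)) F w * (s - w) ^ i / fact i"] by linarith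
      then show ?thesis by (simp add: T_def distrib_right)
    qed
  qed
qed

section \<open>Removing the pole\<close>

lemma difference_quotient_higher_deriv:
  fixes a :: complex
  assumes Z: "Z holomorphic_on half_plane" and s: "Re s > 1"
  defines "Q \<equiv> \<lambda>s. (Z s - a) / (s - 1)"
  shows "(s - 1) * (deriv ^^ Suc n) Q s + of_nat (Suc n) * (deriv ^^ n) Q s = (deriv ^^ Suc n) Z s"
proof -
  have Q: "Q holomorphic_on half_plane" unfolding Q_def by (intro holomorphic_intros Z) auto
  have dQ: "((deriv ^^ n) Q has_field_derivative (deriv ^^ Suc n) Q s) (at s)" if "Re s > 1" for n s
    using has_field_derivative_higher_deriv[OF Q open_half_plane] that by simp
  have dZ: "((deriv ^^ n) Z has_field_derivative (deriv ^^ Suc n) Z s) (at s)" if "Re s > 1" for n s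
    using has_field_derivative_higher_deriv[OF Z open_half_plane] that by simp
  show ?thesis
    using s
  proof (induction n arbitrary: s)
    case 0
    have "((\<lambda>s. (s - 1) * Q s + a) has_field_derivative ((s - 1) * (deriv ^^ Suc 0) Q s + Q s)) (at s)"
      using dQ[OF 0, of 0] by (auto intro!: derivative_eq_intros)
    moreover have "((\<lambda>s. (s - 1) * Q s + a) has_field_derivative (deriv ^^ Suc 0) Z s) (at s)"
      by (rule has_field_derivative_transform_within_open[OF dZ[OF 0, of 0, unfolded funpow_0] open_half_plane])
         (use 0 in \<open>auto simp: Q_def\<close>)
    ultimately show ?case by (simp add: DERIV_unique)
  next
    case (Suc n)
    have "((\<lambda>s. (s - 1) * (deriv ^^ Suc n) Q s + of_nat (Suc n) * (deriv ^^ n) Q s) has_field_derivative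
        ((s - 1) * (deriv ^^ Suc (Suc n)) Q s + (deriv ^^ Suc n) Q s + of_nat (Suc n) * (deriv ^^ Suc n) Q s)) (at s)"
      by (rule derivative_eq_intros dQ[OF Suc.prems] refl | simp)+
    moreover have "((\<lambda>s. (s - 1) * (deriv ^^ Suc n) Q s + of_nat (Suc n) * (deriv ^^ n) Q s) has_field_derivative
        (deriv ^^ Suc (Suc n)) Z s) (at s)"
      by (rule has_field_derivative_transform_within_open[OF dZ[OF Suc.prems] open_half_plane])
         (use Suc in auto)
    ultimately have "(s - 1) * (deriv ^^ Suc (Suc n)) Q s + (deriv ^^ Suc n) Q s + of_nat (Suc n) * (deriv ^^ Suc n) Q s
       = (deriv ^^ Suc (Suc n)) Z s"
      by (rule DERIV_unique)
    then show ?case by (simp add: algebra_simps)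
  qed
qed

text \<open>The point 1 lies on the boundary, so a bound for \<open>Q = (Z - a) / (s - 1)\<close> near 1 is not a matter
  of removing a singularity. Instead, \<open>g(w) = (w - 1) ^ (n + 1)\<close> times the \<open>n\<close>-th derivative of
  \<open>Q\<close> has the derivative \<open>(w - 1) ^ n\<close> times the derivative of order \<open>n + 1\<close> of \<open>Z\<close>. Integrating
  from 1 to \<open>s\<close> along a segment, on which \<open>|Im w| \<le> |Im s|\<close>, bounds it by \<open>|s - 1| ^ (n + 1)\<close>
  times the growth of \<open>Z\<close>.\<close>

lemma poly_growth_difference_quotient:
  assumes Z: "poly_growth A Z" and A: "A \<ge> 0"
    and lim: "\<And>s. 1 < Re s \<Longrightarrow> Re s \<le> 2 \<Longrightarrow> ((\<lambda>\<theta>. Z (1 + of_real \<theta> * (s - 1))) \<longlongrightarrow> a) (at_right 0)"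
  shows "poly_growth A (\<lambda>s. (Z s - a) / (s - 1))"
proof -
  define Q where "Q = (\<lambda>s. (Z s - a) / (s - 1))"
  note holZ = poly_growthD(1)[OF Z]
  have Q: "Q holomorphic_on half_plane" unfolding Q_def by (intro holomorphic_intros holZ) auto
  note id = difference_quotient_higher_deriv[OF holZ, where a = a, folded Q_def]
  have "strip_bound A ((deriv ^^ n) Q)" for n
  proof (induction n rule: less_induct)
    case (less n)
    define g where "g = (\<lambda>w. (w - 1) ^ Suc n * (deriv ^^ n) Q w)"
    have dg: "(g has_field_derivative (w - 1) ^ n * (deriv ^^ Suc n) Z w) (at w)" if "Re w > 1" for w
    proof -
      have dQ: "((deriv ^^ n) Q has_field_derivative (deriv ^^ Suc n) Q w) (at w)"
        using has_field_derivative_higher_deriv[OF Q open_half_plane] that by simp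
      have "(g has_field_derivative (w - 1) ^ Suc n * (deriv ^^ Suc n) Q w + of_nat (Suc n) * (w - 1) ^ n * (deriv ^^ n) Q w) (at w)"
        unfolding g_def by (rule derivative_eq_intros dQ refl | simp add: mult_ac)+
      also have "(w - 1) ^ Suc n * (deriv ^^ Suc n) Q w + of_nat (Suc n) * (w - 1) ^ n * (deriv ^^ n) Q w
         = (w - 1) ^ n * ((w - 1) * (deriv ^^ Suc n) Q w + of_nat (Suc n) * (deriv ^^ n) Q w)"
        by (simp add: algebra_simps)
      finally show ?thesis unfolding id[OF that] .
    qed
    obtain E where E: "E > 0" "\<And>s. 1 < Re s \<Longrightarrow> Re s \<le> 2 \<Longrightarrow> norm ((deriv ^^ Suc n) Z s) \<le> E * (1 + \<bar>Im s\<bar>) powr A"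
      using strip_boundE[OF poly_growthD(2)[OF Z]] by metis
    show "strip_bound A ((deriv ^^ n) Q)"
    proof (rule strip_boundI)
      fix s :: complex assume s: "1 < Re s" "Re s \<le> 2"
      define p where "p = (\<lambda>\<theta>::real. 1 + of_real \<theta> * (s - 1))"
      have p: "1 < Re (p \<theta>)" "Re (p \<theta>) \<le> 2" "\<bar>Im (p \<theta>)\<bar> \<le> \<bar>Im s\<bar>" "norm (p \<theta> - 1) = \<theta> * norm (s - 1)"
        if "0 < \<theta>" "\<theta> \<le> 1" for \<theta>
        using that s mult_mono[of \<theta> 1 "Re s - 1" 1] mult_left_le_one_le[of "\<bar>Im s\<bar>" \<theta>]
        by (auto simp: p_def norm_mult abs_mult)
      define B where "B = norm (s - 1) ^ n * (E * (1 + \<bar>Im s\<bar>) powr A)"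
      have step: "norm (g s - g (p \<theta>)) \<le> B * norm (s - 1)" if th: "0 < \<theta>" "\<theta> < 1" for \<theta>
      proof -
        have seg: "\<exists>\<tau>. 0 < \<tau> \<and> \<tau> \<le> 1 \<and> u = p \<tau>" if u: "u \<in> closed_segment (p \<theta>) s" for u
        proof -
          obtain x where x: "0 \<le> x" "x \<le> 1" "u = (1 - x) *\<^sub>R p \<theta> + x *\<^sub>R s"
            using u unfolding in_segment(1) by (elim exE conjE)
          have "u = p (\<theta> + x * (1 - \<theta>))" unfolding x(3) p_def scaleR_conv_of_real by (simp add: algebra_simps)
          moreover have "\<theta> + x * (1 - \<theta>) > 0" using x th by (intro add_pos_nonneg mult_nonneg_nonneg) auto
          moreover {
            have "x * (1 - \<theta>) \<le> 1 - \<theta>" by (rule mult_left_le_one_le) (use x th in auto)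
            then have "\<theta> + x * (1 - \<theta>) \<le> 1" by argo
          }
          ultimately show ?thesis by blast
        qed
        have "norm (g s - g (p \<theta>)) \<le> B * norm (s - p \<theta>)"
        proof (rule field_differentiable_bound[of "closed_segment (p \<theta>) s"])
          fix u assume "u \<in> closed_segment (p \<theta>) s"
          then obtain \<tau> where \<tau>: "0 < \<tau>" "\<tau> \<le> 1" "u = p \<tau>" using seg by blast
          note pu = p[OF \<tau>(1,2), folded \<tau>(3)]
          show "(g has_field_derivative (u - 1) ^ n * (deriv ^^ Suc n) Z u) (at u within closed_segment (p \<theta>) s)"
            using dg[OF pu(1)] by (rule has_field_derivative_at_within)
          have "norm (u - 1) ^ n \<le> norm (s - 1) ^ n"
            unfolding pu(4) using \<tau> by (intro power_mono mult_left_le_one_le) auto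
          moreover have "norm ((deriv ^^ Suc n) Z u) \<le> E * (1 + \<bar>Im s\<bar>) powr A"
            using E(2)[OF pu(1,2)] mult_left_mono[OF strip_powr_mono[OF pu(3) A], of E] E(1) by linarith
          ultimately show "norm ((u - 1) ^ n * (deriv ^^ Suc n) Z u) \<le> B"
            unfolding norm_mult norm_power B_def by (intro mult_mono) auto
        qed auto
        also have "\<dots> \<le> B * norm (s - 1)"
        proof -
          have "s - p \<theta> = of_real (1 - \<theta>) * (s - 1)" by (simp add: p_def algebra_simps)
          then have "norm (s - p \<theta>) \<le> norm (s - 1)"
            using th by (simp only: norm_mult norm_of_real) (auto intro: mult_left_le_one_le)
          then show ?thesis using E(1) by (intro mult_left_mono) (auto simp: B_def)
        qed
        finally show ?thesis .
      qed
      have g0: "((\<lambda>\<theta>. g (p \<theta>)) \<longlongrightarrow> 0) (at_right 0)"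
      proof (cases n)
        case 0
        have "((\<lambda>\<theta>. Z (p \<theta>) - a) \<longlongrightarrow> a - a) (at_right 0)"
          unfolding p_def by (intro tendsto_diff lim s tendsto_const)
        moreover have "\<forall>\<^sub>F \<theta> in at_right 0. Z (p \<theta>) - a = g (p \<theta>)"
          unfolding eventually_at_right_field
        proof (intro exI[of _ 1] conjI allI impI)
          fix \<theta> :: real assume "0 < \<theta>" "\<theta> < 1"
          then have "p \<theta> \<noteq> 1" using p(1)[of \<theta>] by auto
          then show "Z (p \<theta>) - a = g (p \<theta>)" by (simp add: g_def 0 Q_def)
        qed simp
        ultimately show ?thesis by (simp add: filterlim_cong)
      next
        case (Suc m)
        obtain C D where C: "C > 0" "\<And>s. 1 < Re s \<Longrightarrow> Re s \<le> 2 \<Longrightarrow> norm ((deriv ^^ n) Z s) \<le> C * (1 + \<bar>Im s\<bar>) powr A"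
          and D: "D > 0" "\<And>s. 1 < Re s \<Longrightarrow> Re s \<le> 2 \<Longrightarrow> norm ((deriv ^^ m) Q s) \<le> D * (1 + \<bar>Im s\<bar>) powr A"
          using strip_boundE[OF poly_growthD(2)[OF Z]] strip_boundE[OF less.IH[of m]] Suc lessI by metis
        define M where "M = (C + real n * D) * (1 + \<bar>Im s\<bar>) powr A"
        have "norm (g (p \<theta>)) \<le> \<theta> * (norm (s - 1) ^ n * M)" if th: "0 < \<theta>" "\<theta> < 1" for \<theta>
        proof -
          have th': "\<theta> \<le> 1" using th by simp
          note pu = p[OF th(1) th']
          have "g (p \<theta>) = (p \<theta> - 1) ^ n * ((p \<theta> - 1) * (deriv ^^ Suc m) Q (p \<theta>))"
            by (simp add: g_def Suc mult_ac)
          also have "(p \<theta> - 1) * (deriv ^^ Suc m) Q (p \<theta>) = (deriv ^^ n) Z (p \<theta>) - of_nat n * (deriv ^^ m) Q (p \<theta>)"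
            using id[OF pu(1), of m] Suc by (simp add: algebra_simps)
          finally have eq: "norm (g (p \<theta>)) = (\<theta> * norm (s - 1)) ^ n * norm ((deriv ^^ n) Z (p \<theta>) - of_nat n * (deriv ^^ m) Q (p \<theta>))"
            by (simp add: norm_mult norm_power pu(4))
          have "norm ((deriv ^^ n) Z (p \<theta>) - of_nat n * (deriv ^^ m) Q (p \<theta>))
              \<le> norm ((deriv ^^ n) Z (p \<theta>)) + real n * norm ((deriv ^^ m) Q (p \<theta>))"
            by (rule order_trans[OF norm_triangle_ineq4]) (simp add: norm_mult)
          also have "\<dots> \<le> C * (1 + \<bar>Im (p \<theta>)\<bar>) powr A + real n * (D * (1 + \<bar>Im (p \<theta>)\<bar>) powr A)"
            by (intro add_mono mult_left_mono C(2) D(2) pu) auto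
          also have "\<dots> = (C + real n * D) * (1 + \<bar>Im (p \<theta>)\<bar>) powr A" by (simp add: algebra_simps)
          also have "\<dots> \<le> M"
            unfolding M_def using C(1) D(1) by (intro mult_left_mono strip_powr_mono pu A) auto
          finally have 1: "norm ((deriv ^^ n) Z (p \<theta>) - of_nat n * (deriv ^^ m) Q (p \<theta>)) \<le> M" .
          have "\<theta> ^ n \<le> \<theta>" using power_decreasing[of 1 n \<theta>] th Suc by simp
          then have 2: "(\<theta> * norm (s - 1)) ^ n \<le> \<theta> * norm (s - 1) ^ n"
            by (simp add: power_mult_distrib mult_right_mono)
          show ?thesis unfolding eq using mult_mono[OF 2 1] th by (simp add: mult_ac)
        qed
        then have ev: "\<forall>\<^sub>F \<theta> in at_right 0. norm (g (p \<theta>)) \<le> \<theta> * (norm (s - 1) ^ n * M)"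
          unfolding eventually_at_right_field by (intro exI[of _ 1]) auto
        show ?thesis
          by (rule Lim_null_comparison[OF ev]) (auto intro!: tendsto_mult_left_zero)
      qed
      have "norm (g s - 0) \<le> B * norm (s - 1)"
      proof (rule tendsto_upperbound[OF tendsto_norm[OF tendsto_diff[OF tendsto_const g0]]])
        show "\<forall>\<^sub>F \<theta> in at_right 0. norm (g s - g (p \<theta>)) \<le> B * norm (s - 1)"
          unfolding eventually_at_right_field using step by (intro exI[of _ 1]) auto
      qed simp
      then have "norm (s - 1) ^ Suc n * norm ((deriv ^^ n) Q s) \<le> norm (s - 1) ^ Suc n * (E * (1 + \<bar>Im s\<bar>) powr A)"
        by (simp add: g_def B_def norm_mult norm_power mult_ac)
      moreover have "norm (s - 1) > 0" using s by auto
      ultimately show "norm ((deriv ^^ n) Q s) \<le> E * (1 + \<bar>Im s\<bar>) powr A"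
        by (subst (asm) mult_le_cancel_left_pos) auto
    qed
  qed
  then show ?thesis using Q unfolding poly_growth_def Q_def by simp
qed

section \<open>The Tauberian theorem\<close>

text \<open>In the variable \<open>x = exp v\<close> this is the error term \<open>O(x / log ^ M x)\<close> for all \<open>M\<close>. The
  denominator \<open>1 + v\<close> in place of \<open>v\<close> makes the bound meaningful down to \<open>v = 0\<close>.\<close>

definition log_small :: "(real \<Rightarrow> real) \<Rightarrow> bool" where
  "log_small g \<longleftrightarrow> (\<forall>M::nat. \<exists>C. \<forall>v\<ge>0. \<bar>g v\<bar> \<le> C * exp v / (1 + v) ^ M)"

lemma log_smallE:
  assumes "log_small g"
  obtains C where "C > 0" "\<And>v. v \<ge> 0 \<Longrightarrow> \<bar>g v\<bar> \<le> C * exp v / (1 + v) ^ M"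
proof -
  obtain C where C: "\<And>v. v \<ge> 0 \<Longrightarrow> \<bar>g v\<bar> \<le> C * exp v / (1 + v) ^ M"
    using assms unfolding log_small_def by blast
  have "\<bar>g v\<bar> \<le> (\<bar>C\<bar> + 1) * exp v / (1 + v) ^ M" if "v \<ge> 0" for v
    by (rule order_trans[OF C[OF that]]) (use that in \<open>auto intro!: divide_right_mono mult_right_mono\<close>)
  then show ?thesis by (intro that[of "\<bar>C\<bar> + 1"]) auto
qed

lemma log_small_if_weighted:
  assumes "\<And>M. \<exists>C. \<forall>v\<ge>0. v ^ M * \<bar>g v\<bar> \<le> C * exp v"
  shows "log_small g"
  unfolding log_small_def
proof (rule allI)
  fix M :: nat
  obtain C0 where C0: "\<And>v. v \<ge> 0 \<Longrightarrow> v ^ 0 * \<bar>g v\<bar> \<le> C0 * exp v" using assms[of 0] by blast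
  obtain C1 where C1: "\<And>v. v \<ge> 0 \<Longrightarrow> v ^ M * \<bar>g v\<bar> \<le> C1 * exp v" using assms[of M] by blast
  have "\<bar>g v\<bar> \<le> 2 ^ M * (C0 + C1) * exp v / (1 + v) ^ M" if v: "v \<ge> 0" for v
  proof -
    have "(1 + v) ^ M \<le> (2 * max 1 v) ^ M" using v by (intro power_mono) auto
    also have "\<dots> = 2 ^ M * (max 1 v) ^ M" by (simp add: power_mult_distrib)
    also have "\<dots> \<le> 2 ^ M * (1 + v ^ M)" using v by (intro mult_left_mono) (auto simp: max_def)
    finally have "(1 + v) ^ M * \<bar>g v\<bar> \<le> 2 ^ M * (1 + v ^ M) * \<bar>g v\<bar>" by (intro mult_right_mono) auto
    also have "\<dots> = 2 ^ M * (v ^ 0 * \<bar>g v\<bar> + v ^ M * \<bar>g v\<bar>)" by (simp add: algebra_simps)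
    also have "\<dots> \<le> 2 ^ M * (C0 * exp v + C1 * exp v)" by (intro mult_left_mono add_mono C0 C1 v) auto
    finally show ?thesis using v by (simp add: field_simps)
  qed
  then show "\<exists>C. \<forall>v\<ge>0. \<bar>g v\<bar> \<le> C * exp v / (1 + v) ^ M" by blast
qed

text \<open>The hypothesis \<open>0 \<le> b v \<le> c exp v\<close> reproduces itself under primitives, so the Lipschitz bound
  holds for all iterated primitives with the same constant.\<close>

lemma primitive_exp_bounds:
  assumes b: "transformable b" and nonneg: "\<And>v. b v \<ge> 0" and le: "\<And>v. b v \<le> c * exp v"
  shows "primitive b v \<ge> 0" "primitive b v \<le> c * exp v"
    "h \<ge> 0 \<Longrightarrow> primitive b (v + h) - primitive b v \<le> h * (c * exp (v + h))"
proof -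
  have c: "c \<ge> 0" using order_trans[OF nonneg[of 0] le[of 0]] by simp
  show "primitive b v \<ge> 0"
    by (rule mono_transformable_nonneg[OF mono_primitive[OF b nonneg] transformable_primitive[OF b]])
  show "primitive b v \<le> c * exp v"
  proof (cases "v < 0")
    case True then show ?thesis using primitive_neg[OF b] c by simp
  next
    case False
    have "continuous_on {0..v} (\<lambda>w. c * exp w)" by (intro continuous_intros)
    then have int: "integrable lborel (\<lambda>w. indicator {0..v} w *\<^sub>R (c * exp w))"
      by (rule borel_integrable_compact[OF compact_Icc])
    have "primitive b v \<le> (LINT w|lborel. indicator {0..v} w *\<^sub>R (c * exp w))"
      unfolding primitive_def
      by (rule integral_mono[OF transformable_integrable_upto[OF b] int])
         (use le transformableD(2)[OF b] in \<open>auto simp: indicator_def not_le\<close>)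
    also have "\<dots> = c * exp v - c * exp 0"
      using False by (intro integral_FTC_atLeastAtMost)
        (auto intro!: continuous_intros derivative_eq_intros simp flip: has_real_derivative_iff_has_vector_derivative)
    also have "\<dots> \<le> c * exp v" using c by simp
    finally show ?thesis .
  qed
  assume h: "h \<ge> 0"
  show "primitive b (v + h) - primitive b v \<le> h * (c * exp (v + h))"
  proof (rule primitive_increment_bounds(2)[OF b h nonneg])
    fix w assume "w \<le> v + h"
    then have "c * exp w \<le> c * exp (v + h)" using c by (intro mult_left_mono) auto
    then show "b w \<le> c * exp (v + h)" using le[of w] by linarith
  qed
qed

text \<open>By monotonicity, \<open>h f(v)\<close> lies between the increments of the primitive of \<open>f\<close> over the intervals
  of length \<open>h\<close> on either side of \<open>v\<close>. Replacing that primitive by the one of \<open>g\<close> costs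
  \<open>O(exp v / (1 + v) ^ (2 M))\<close>, and the Lipschitz bound on \<open>g\<close> costs \<open>O(h\<^sup>2 exp v)\<close>. The choice
  \<open>h = (1 + v) ^ (- M)\<close> balances the two.\<close>

lemma desmooth:
  assumes f: "transformable f" "mono f"
    and g: "transformable g" "mono g"
    and lip: "\<And>v h. h \<ge> 0 \<Longrightarrow> g (v + h) - g v \<le> h * (c * exp (v + h))"
    and E: "log_small (\<lambda>v. primitive f v - primitive g v)"
  shows "log_small (\<lambda>v. f v - g v)"
  unfolding log_small_def
proof (rule allI)
  fix M :: nat
  define E where "E = (\<lambda>v. primitive f v - primitive g v)"
  obtain C where C: "C > 0" "\<And>v. v \<ge> 0 \<Longrightarrow> \<bar>E v\<bar> \<le> C * exp v / (1 + v) ^ (2 * M)"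
    using log_smallE[OF E] unfolding E_def by metis
  have "g (0 + 1) - g 0 \<le> 1 * (c * exp (0 + 1))" by (rule lip) simp
  moreover have "g 0 \<le> g (0 + 1)" by (rule monoD[OF g(2)]) simp
  ultimately have "0 \<le> c * exp 1" by simp
  then have c: "c \<ge> 0" by (simp add: zero_le_mult_iff)
  have f0: "f v \<ge> 0" and g0: "g v \<ge> 0" for v
    using mono_transformable_nonneg[OF f(2,1)] mono_transformable_nonneg[OF g(2,1)] by auto
  define K where "K = (c + 2 * C) * exp 1 + (c + C * (1 + 4 ^ M)) + (f 1 + g 1) * 2 ^ M"
  have K: "(c + 2 * C) * exp 1 \<le> K" "c + C * (1 + 4 ^ M) \<le> K" "(f 1 + g 1) * 2 ^ M \<le> K"
    using c C(1) f0[of 1] g0[of 1] by (auto simp: K_def)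
  have K0: "K \<ge> 0" using K(3) f0[of 1] g0[of 1] by (meson add_nonneg_nonneg mult_nonneg_nonneg order_trans zero_le_numeral zero_le_power)
  have "\<bar>f v - g v\<bar> \<le> K * exp v / (1 + v) ^ M" if v: "v \<ge> 0" for v
  proof -
    define h where "h = 1 / (1 + v) ^ M"
    have h: "h > 0" "h \<le> 1" using v by (auto simp: h_def)
    have h2: "1 / (1 + v) ^ (2 * M) = h * h" by (simp add: h_def mult_2 power_add)
    have E1: "\<bar>E v\<bar> \<le> C * exp v * (h * h)"
      using C(2)[OF v] unfolding h2[symmetric] by simp
    have up: "f v - g v \<le> (c + 2 * C) * exp 1 * exp v * h"
    proof -
      have "\<bar>E (v + h)\<bar> \<le> C * exp (v + h) / (1 + (v + h)) ^ (2 * M)" using v h by (intro C(2)) auto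
      also have "\<dots> \<le> C * exp (v + 1) / (1 + v) ^ (2 * M)"
        using C(1) v h by (intro frac_le mult_left_mono power_mono) auto
      also have "\<dots> = C * exp (v + 1) * (h * h)" unfolding h2[symmetric] by simp
      finally have E2: "\<bar>E (v + h)\<bar> \<le> C * exp (v + 1) * (h * h)" .
      have "C * exp v * (h * h) \<le> C * exp (v + 1) * (h * h)"
        using C(1) h by (intro mult_right_mono mult_left_mono) auto
      then have E1': "\<bar>E v\<bar> \<le> C * exp (v + 1) * (h * h)" using E1 by linarith
      have "h * f v \<le> primitive f (v + h) - primitive f v"
        by (rule primitive_increment_bounds(1)[OF f(1), where M = "f (v + h)"])
           (use h in \<open>auto intro: monoD[OF f(2)]\<close>)
      moreover have "primitive g (v + h) - primitive g v \<le> h * g (v + h)"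
        by (rule primitive_increment_bounds(2)[OF g(1), where m = "g v"])
           (use h in \<open>auto intro: monoD[OF g(2)]\<close>)
      moreover have "h * g (v + h) \<le> h * (g v + h * (c * exp (v + 1)))"
      proof (rule mult_left_mono)
        have "h * (c * exp (v + h)) \<le> h * (c * exp (v + 1))" using h c by (intro mult_left_mono) auto
        then show "g (v + h) \<le> g v + h * (c * exp (v + 1))" using lip[of h v] h by linarith
      qed (use h in auto)
      ultimately have "h * f v \<le> h * (g v + h * (c * exp (v + 1))) + 2 * (C * exp (v + 1) * (h * h))"
        using E1' E2 unfolding E_def by linarith
      also have "\<dots> = h * (g v + (c + 2 * C) * exp 1 * exp v * h)" by (simp add: algebra_simps exp_add)
      finally have "f v \<le> g v + (c + 2 * C) * exp 1 * exp v * h" using h by simp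
      then show ?thesis by simp
    qed
    have up': "f v - g v \<le> K * exp v * h"
      by (rule order_trans[OF up]) (intro mult_right_mono K, use h in auto)
    have low': "g v - f v \<le> K * exp v * h"
    proof (cases "v \<ge> 1")
      case True
      have vh: "v - h \<ge> 0" "1 + (v - h) \<ge> (1 + v) / 2" using True h by auto
      have "\<bar>E (v - h)\<bar> \<le> C * exp (v - h) / (1 + (v - h)) ^ (2 * M)" by (rule C(2)[OF vh(1)])
      also have "\<dots> \<le> C * exp v / ((1 + v) / 2) ^ (2 * M)"
        using C(1) v h vh by (intro frac_le mult_left_mono power_mono) auto
      also have "\<dots> = C * exp v * (4 ^ M * (1 / (1 + v) ^ (2 * M)))" by (simp add: power_divide power_mult)
      finally have E2: "\<bar>E (v - h)\<bar> \<le> C * exp v * (4 ^ M * (h * h))" unfolding h2 .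
      have "primitive f (v - h + h) - primitive f (v - h) \<le> h * f v"
        by (rule primitive_increment_bounds(2)[OF f(1), where m = "f (v - h)"])
           (use h in \<open>auto intro: monoD[OF f(2)]\<close>)
      moreover have "h * g (v - h) \<le> primitive g (v - h + h) - primitive g (v - h)"
        by (rule primitive_increment_bounds(1)[OF g(1), where M = "g v"])
           (use h in \<open>auto intro: monoD[OF g(2)]\<close>)
      moreover have "h * (g v - h * (c * exp v)) \<le> h * g (v - h)"
        using lip[of h "v - h"] h by (intro mult_left_mono) auto
      ultimately have "h * (g v - h * (c * exp v)) \<le> h * f v + C * exp v * (h * h) + C * exp v * (4 ^ M * (h * h))"
        using E1 E2 unfolding E_def by simp
      also have "\<dots> = h * (f v + C * (1 + 4 ^ M) * exp v * h)" by (simp add: algebra_simps)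
      finally have "g v - h * (c * exp v) \<le> f v + C * (1 + 4 ^ M) * exp v * h" using h by simp
      then have "g v - f v \<le> (c + C * (1 + 4 ^ M)) * exp v * h" by (simp add: algebra_simps)
      also have "\<dots> \<le> K * exp v * h" using h by (intro mult_right_mono K) auto
      finally show ?thesis .
    next
      case False
      have "g v - f v \<le> f 1 + g 1"
        using f0[of v] f0[of 1] monoD[OF g(2), of v 1] False by linarith
      also have "\<dots> \<le> (f 1 + g 1) * (2 ^ M * h)"
      proof -
        have "(1 + v) ^ M \<le> 2 ^ M" using False v by (intro power_mono) auto
        then have "2 ^ M * h \<ge> 1" using v by (simp add: h_def)
        then show ?thesis using mult_left_mono[of 1 "2 ^ M * h" "f 1 + g 1"] f0[of 1] g0[of 1] by simp
      qed
      also have "\<dots> = (f 1 + g 1) * 2 ^ M * 1 * h" by simp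
      also have "\<dots> \<le> K * exp v * h"
        using h v K K0 by (intro mult_right_mono mult_mono) auto
      finally show ?thesis .
    qed
    show ?thesis using up' low' by (simp add: h_def abs_le_iff)
  qed
  then show "\<exists>C. \<forall>v\<ge>0. \<bar>f v - g v\<bar> \<le> C * exp v / (1 + v) ^ M" by blast
qed

lemma integrable_inverse_square: "integrable lborel (\<lambda>t::real. 1 / (1 + t\<^sup>2))"
  using integrable_inverse_1_plus_square
  by (simp add: set_integrable_def einterval_def inverse_eq_divide)

lemma powr_minus_two_le:
  fixes t :: real shows "(1 + \<bar>t\<bar>) powr (-2) \<le> 1 / (1 + t\<^sup>2)"
proof -
  have "(1 + \<bar>t\<bar>)\<^sup>2 = 1 + 2 * \<bar>t\<bar> + t\<^sup>2" by (simp add: power2_sum)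
  then have "1 + t\<^sup>2 \<le> (1 + \<bar>t\<bar>)\<^sup>2" by simp
  moreover have "(1 + \<bar>t\<bar>) powr (-2) = 1 / (1 + \<bar>t\<bar>)\<^sup>2"
    by (simp add: powr_minus powr_numeral divide_inverse)
  ultimately show ?thesis by (simp add: frac_le add_pos_nonneg)
qed

text \<open>The Fourier transform of \<open>v ^ M \<gamma>(v) exp (- \<sigma> v)\<close> is, up to sign, the \<open>M\<close>-th derivative of the
  transform of \<open>\<gamma>\<close> on the line \<open>Re s = \<sigma>\<close>. Its integral is bounded independently of \<open>\<sigma>\<close>, so \<open>\<sigma>\<close>
  may tend to 1.\<close>

lemma smooth_transform_bound:
  fixes \<gamma> :: "real \<Rightarrow> real"
  assumes ok: "transformable \<gamma>" and cont: "continuous_on UNIV \<gamma>"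
    and exp_bd: "\<And>\<sigma>. \<sigma> > 1 \<Longrightarrow> \<exists>C. \<forall>v. \<bar>\<gamma> v\<bar> \<le> C * exp (\<sigma> * v)"
    and growth: "poly_growth (-2) (laplace \<gamma>)"
  shows "log_small \<gamma>"
proof (rule log_small_if_weighted)
  fix M :: nat
  obtain C where C: "C > 0" "\<And>s. 1 < Re s \<Longrightarrow> Re s \<le> 2 \<Longrightarrow> norm ((deriv ^^ M) (laplace \<gamma>) s) \<le> C * (1 + \<bar>Im s\<bar>) powr (-2)"
    using strip_boundE[OF poly_growthD(2)[OF growth]] by metis
  define B where "B = (LINT t|lborel. C * (1 / (1 + t\<^sup>2)))"
  have bd: "2 * pi * (v ^ M * \<bar>\<gamma> v\<bar>) \<le> B * exp (\<sigma> * v)" if v: "v \<ge> 0" and \<sigma>: "1 < \<sigma>" "\<sigma> \<le> 2" for v \<sigma>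
  proof -
    define h where "h = (\<lambda>v. v ^ M * \<gamma> v * exp (- (\<sigma> * v)))"
    define \<delta> where "\<delta> = (\<sigma> - 1) / 2"
    have \<delta>: "\<delta> > 0" "\<sigma> - \<delta> > 1" using \<sigma> by (auto simp: \<delta>_def field_simps)
    obtain K where K: "\<And>v. \<bar>\<gamma> v\<bar> \<le> K * exp ((\<sigma> - \<delta>) * v)" using exp_bd[OF \<delta>(2)] by blast
    have h_bdd: "\<bar>h v\<bar> \<le> fact M / \<delta> ^ M * K" for v
    proof (cases "v < 0")
      case True
      then have "h v = 0" using transformableD(2)[OF ok] by (simp add: h_def)
      moreover have "K \<ge> 0" using order_trans[OF abs_ge_zero K[of 0]] by simp
      ultimately show ?thesis using \<delta> by simp
    next
      case False
      have "\<bar>h v\<bar> = v ^ M * \<bar>\<gamma> v\<bar> * exp (- (\<sigma> * v))" using False by (simp add: h_def abs_mult)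
      also have "\<dots> \<le> (fact M / \<delta> ^ M * exp (\<delta> * v)) * (K * exp ((\<sigma> - \<delta>) * v)) * exp (- (\<sigma> * v))"
        using False \<delta> by (intro mult_right_mono mult_mono power_le_exp K) auto
      also have "\<dots> = fact M / \<delta> ^ M * K * (exp (\<delta> * v) * exp ((\<sigma> - \<delta>) * v) * exp (- (\<sigma> * v)))" by (simp add: mult_ac)
      also have "exp (\<delta> * v) * exp ((\<sigma> - \<delta>) * v) * exp (- (\<sigma> * v)) = 1"
        unfolding exp_add[symmetric] by (simp add: algebra_simps)
      finally show ?thesis by simp
    qed
    have "2 * pi * \<bar>h v\<bar> \<le> B"
      unfolding B_def
    proof (rule fourier_sup_bound[OF _ _ h_bdd])
      show "continuous_on UNIV h" unfolding h_def by (intro continuous_intros cont)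
      show "integrable lborel h" unfolding h_def using transformableD(3)[OF transformable_power[OF ok] \<sigma>(1)] .
      show "integrable lborel (\<lambda>t::real. C * (1 / (1 + t\<^sup>2)))"
        by (intro integrable_mult_right integrable_inverse_square)
      fix t :: real
      define s where "s = Complex \<sigma> t"
      have "(LINT v|lborel. of_real (h v) * exp (- (\<i> * of_real (t * v)))) = laplace (\<lambda>v. v ^ M * \<gamma> v) s"
        unfolding laplace_def
      proof (intro Bochner_Integration.integral_cong refl)
        fix v :: real
        have "- (s * of_real v) = of_real (- (\<sigma> * v)) + - (\<i> * of_real (t * v))"
          by (simp add: s_def complex_eq_iff)
        then have "exp (- (s * of_real v)) = of_real (exp (- (\<sigma> * v))) * exp (- (\<i> * of_real (t * v)))"
          by (simp only: exp_add exp_of_real)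
        then show "of_real (h v) * exp (- (\<i> * of_real (t * v))) = of_real (v ^ M * \<gamma> v) * exp (- (s * of_real v))"
          by (simp add: h_def)
      qed
      also have "norm \<dots> = norm ((deriv ^^ M) (laplace \<gamma>) s)"
      proof -
        have "(\<lambda>v. (- v) ^ M * \<gamma> v) = (\<lambda>v. (- 1) ^ M * (v ^ M * \<gamma> v))"
          by (rule ext, subst power_minus, rule mult.assoc)
        then show ?thesis
          using higher_deriv_laplace[OF ok, of s M] \<sigma> by (simp add: s_def laplace_cmult norm_mult norm_power)
      qed
      also have "\<dots> \<le> C * (1 + \<bar>t\<bar>) powr (-2)" using C(2)[of s] \<sigma> by (simp add: s_def)
      also have "\<dots> \<le> C * (1 / (1 + t\<^sup>2))" using C(1) by (intro mult_left_mono powr_minus_two_le) auto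
      finally show "norm (LINT v|lborel. of_real (h v) * exp (- (\<i> * of_real (t * v)))) \<le> C * (1 / (1 + t\<^sup>2))" .
    qed
    moreover have "v ^ M * \<bar>\<gamma> v\<bar> = \<bar>h v\<bar> * exp (\<sigma> * v)" using v by (simp add: h_def abs_mult exp_minus)
    ultimately show ?thesis by (simp add: mult_right_mono flip: mult.assoc)
  qed
  have "v ^ M * \<bar>\<gamma> v\<bar> \<le> B / (2 * pi) * exp v" if v: "v \<ge> 0" for v
  proof -
    have "((\<lambda>\<sigma>. B * exp (\<sigma> * v)) \<longlongrightarrow> B * exp (1 * v)) (at_right 1)" by (intro tendsto_intros)
    moreover have "\<forall>\<^sub>F \<sigma> in at_right (1::real). 2 * pi * (v ^ M * \<bar>\<gamma> v\<bar>) \<le> B * exp (\<sigma> * v)"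
      unfolding eventually_at_right_field using bd[OF v] by (intro exI[of _ 2]) auto
    ultimately have "2 * pi * (v ^ M * \<bar>\<gamma> v\<bar>) \<le> B * exp (1 * v)"
      by (intro tendsto_lowerbound[where F = "at_right (1::real)"]) auto
    then show ?thesis by (simp add: field_simps)
  qed
  then show "\<exists>C. \<forall>v\<ge>0. v ^ M * \<bar>\<gamma> v\<bar> \<le> C * exp v" by blast
qed

lemma iterated_primitive:
  assumes "transformable f"
  shows "transformable ((primitive ^^ n) f)"
    and "Re s > 1 \<Longrightarrow> laplace ((primitive ^^ n) f) s = laplace f s / s ^ n"
    and "mono f \<Longrightarrow> mono ((primitive ^^ n) f)"
proof -
  show ok: "transformable ((primitive ^^ n) f)" for n
    by (induction n) (auto intro: assms transformable_primitive)
  show "Re s > 1 \<Longrightarrow> laplace ((primitive ^^ n) f) s = laplace f s / s ^ n"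
    by (induction n) (auto simp: laplace_primitive[OF ok])
  show "mono f \<Longrightarrow> mono ((primitive ^^ n) f)"
    by (induction n) (auto intro!: mono_primitive[OF ok] mono_transformable_nonneg[OF _ ok])
qed

text \<open>Take more primitives than the growth exponent requires, apply \<open>smooth_transform_bound\<close> to the
  difference, and remove the primitives again with \<open>desmooth\<close>. The last primitive also supplies
  the continuity needed for the Fourier bound.\<close>

theorem tauberian:
  assumes \<alpha>: "transformable \<alpha>" "mono \<alpha>"
    and b: "transformable b" "\<And>v. b v \<ge> 0" "\<And>v. b v \<le> c * exp v"
    and D: "poly_growth A (\<lambda>s. s * (laplace \<alpha> s - laplace (primitive b) s))"
  shows "log_small (\<lambda>v. \<alpha> v - primitive b v)"
proof -
  define \<beta> where "\<beta> = primitive b"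
  have \<beta>: "transformable \<beta>" "mono \<beta>"
    unfolding \<beta>_def using transformable_primitive[OF b(1)] mono_primitive[OF b(1,2)] by auto
  have it_b: "transformable ((primitive ^^ n) b) \<and> (\<forall>v. 0 \<le> (primitive ^^ n) b v) \<and> (\<forall>v. (primitive ^^ n) b v \<le> c * exp v)" for n
  proof (induction n)
    case 0 then show ?case using b by auto
  next
    case (Suc n)
    then show ?case
      using primitive_exp_bounds(1,2)[of "(primitive ^^ n) b" c] transformable_primitive[of "(primitive ^^ n) b"] by auto
  qed
  have it_\<beta>: "(primitive ^^ n) \<beta> = primitive ((primitive ^^ n) b)" for n
    unfolding \<beta>_def by (simp add: funpow_swap1)
  have descend: "log_small (\<lambda>v. (primitive ^^ n) \<alpha> v - (primitive ^^ n) \<beta> v) \<Longrightarrow> log_small (\<lambda>v. \<alpha> v - \<beta> v)" for n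
  proof (induction n)
    case (Suc n)
    have "log_small (\<lambda>v. (primitive ^^ n) \<alpha> v - (primitive ^^ n) \<beta> v)"
    proof (rule desmooth)
      show "(primitive ^^ n) \<beta> (v + h) - (primitive ^^ n) \<beta> v \<le> h * (c * exp (v + h))" if "h \<ge> 0" for v h
        unfolding it_\<beta> using it_b[of n] that by (intro primitive_exp_bounds(3)) auto
    qed (use Suc.prems iterated_primitive[OF \<alpha>(1)] iterated_primitive[OF \<beta>(1)] \<alpha> \<beta> in auto)
    then show ?case by (rule Suc.IH)
  qed simp
  \<comment> \<open>with \<open>k + 1\<close> primitives and the factor \<open>s\<close> in \<open>D\<close>, the exponent becomes \<open>A - (k + 2) \<le> -2\<close>\<close>
  obtain k :: nat where k: "real k \<ge> A + 1" using real_arch_simple by blast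
  define \<gamma>0 where "\<gamma>0 = (\<lambda>v. (primitive ^^ k) \<alpha> v - (primitive ^^ k) \<beta> v)"
  define \<gamma> where "\<gamma> = (\<lambda>v. (primitive ^^ Suc k) \<alpha> v - (primitive ^^ Suc k) \<beta> v)"
  note it = iterated_primitive[OF \<alpha>(1)] iterated_primitive[OF \<beta>(1)]
  have \<gamma>0: "transformable \<gamma>0" unfolding \<gamma>0_def by (intro transformable_diff it)
  have \<gamma>: "transformable \<gamma>" unfolding \<gamma>_def by (intro transformable_diff it)
  have \<gamma>_eq: "\<gamma> v = primitive \<gamma>0 v" for v
    unfolding \<gamma>_def \<gamma>0_def by (simp add: primitive_diff it)
  have "log_small \<gamma>"
  proof (rule smooth_transform_bound[OF \<gamma>])
    show "continuous_on UNIV \<gamma>"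
      unfolding \<gamma>_def funpow.simps comp_apply
      by (intro continuous_on_diff continuous_primitive it \<alpha> \<beta>)
    show "\<exists>C. \<forall>v. \<bar>\<gamma> v\<bar> \<le> C * exp (\<sigma> * v)" if "\<sigma> > 1" for \<sigma>
      unfolding \<gamma>_eq using abs_primitive_le[OF \<gamma>0 that] by blast
    have "poly_growth (A + - real (Suc (Suc k))) (\<lambda>s. s * (laplace \<alpha> s - laplace \<beta> s) * (1 / s ^ Suc (Suc k)))"
      using D unfolding \<beta>_def by (intro poly_growth_mult poly_growth_inverse_power)
    then have "poly_growth (-2) (\<lambda>s. s * (laplace \<alpha> s - laplace \<beta> s) * (1 / s ^ Suc (Suc k)))"
      by (rule poly_growth_mono) (use k in auto)
    then show "poly_growth (-2) (laplace \<gamma>)"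
    proof (rule poly_growth_cong)
      fix s :: complex assume s: "Re s > 1"
      then have "s \<noteq> 0" by auto
      then show "s * (laplace \<alpha> s - laplace \<beta> s) * (1 / s ^ Suc (Suc k)) = laplace \<gamma> s"
        unfolding \<gamma>_def by (subst laplace_diff[OF it(1) it(4) s], simp only: it(2)[OF s] it(5)[OF s]) (simp add: field_simps)
    qed
  qed
  then show ?thesis using descend[of "Suc k"] unfolding \<gamma>_def \<beta>_def by blast
qed

section \<open>The Abelian theorem\<close>

text \<open>At \<open>Re s = 1\<close> the factor \<open>exp (- s v)\<close> cancels the exponential growth of \<open>\<gamma>\<close>, and the exponent
  \<open>n + 2\<close> of the logarithmic saving leaves an integrable function.\<close>

lemma log_small_integrand_bound:
  assumes ok: "transformable \<gamma>" and log_small: "log_small \<gamma>"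
  obtains C where "C > 0" "\<And>s v. Re s \<ge> 1 \<Longrightarrow>
      norm (of_real ((- v) ^ n * \<gamma> v) * exp (- (s * of_real v))) \<le> C * (1 / (1 + v\<^sup>2))"
proof -
  obtain C where C: "C > 0" "\<And>v. v \<ge> 0 \<Longrightarrow> \<bar>\<gamma> v\<bar> \<le> C * exp v / (1 + v) ^ (n + 2)"
    using log_smallE[OF log_small] by metis
  have "norm (of_real ((- v) ^ n * \<gamma> v) * exp (- (s * of_real v))) \<le> C * (1 / (1 + v\<^sup>2))"
    if s: "Re s \<ge> 1" for s v
  proof (cases "v < 0")
    case True then show ?thesis using transformableD(2)[OF ok] C(1) by (simp add: add_pos_nonneg)
  next
    case False
    have "norm (of_real ((- v) ^ n * \<gamma> v) * exp (- (s * of_real v))) = \<bar>(- v) ^ n * \<gamma> v\<bar> * exp (- (Re s * v))"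
      by (rule norm_laplace_integrand)
    also have "\<dots> \<le> (v ^ n * (C * exp v / (1 + v) ^ (n + 2))) * exp (- v)"
    proof (rule mult_mono)
      show "\<bar>(- v) ^ n * \<gamma> v\<bar> \<le> v ^ n * (C * exp v / (1 + v) ^ (n + 2))"
        unfolding abs_mult power_abs abs_minus_cancel using False by (intro mult_mono C(2)) auto
      show "exp (- (Re s * v)) \<le> exp (- v)" using False s mult_right_mono[of 1 "Re s" v] by simp
    qed (use False C in auto)
    also have "\<dots> = C * ((v ^ n / (1 + v) ^ n) * (1 / (1 + v)\<^sup>2))"
      by (simp add: exp_minus power_add power2_eq_square field_simps)
    also have "\<dots> \<le> C * (1 * (1 / (1 + v\<^sup>2)))"
    proof (intro mult_left_mono mult_mono)
      show "v ^ n / (1 + v) ^ n \<le> 1" using False by (auto intro!: power_mono)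
      show "1 / (1 + v)\<^sup>2 \<le> 1 / (1 + v\<^sup>2)"
        using False by (intro divide_left_mono) (auto simp: power2_eq_square algebra_simps add_pos_nonneg)
    qed (use False C in auto)
    finally show ?thesis by simp
  qed
  then show ?thesis by (rule that[OF C(1)])
qed

lemma abelian_bound:
  assumes ok: "transformable \<gamma>" and log_small: "log_small \<gamma>"
  obtains C where "\<And>s. Re s \<ge> 1 \<Longrightarrow> norm (laplace (\<lambda>v. (- v) ^ n * \<gamma> v) s) \<le> C"
proof -
  obtain C where C: "C > 0" "\<And>s v. Re s \<ge> 1 \<Longrightarrow>
      norm (of_real ((- v) ^ n * \<gamma> v) * exp (- (s * of_real v))) \<le> C * (1 / (1 + v\<^sup>2))"
    using log_small_integrand_bound[OF assms] by metis
  have bd: "integrable lborel (\<lambda>v::real. C * (1 / (1 + v\<^sup>2)))"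
    by (intro integrable_mult_right integrable_inverse_square)
  have [measurable]: "\<gamma> \<in> borel_measurable borel" using transformableD[OF ok] by simp
  have "norm (laplace (\<lambda>v. (- v) ^ n * \<gamma> v) s) \<le> (LINT v|lborel. C * (1 / (1 + v\<^sup>2)))" if s: "Re s \<ge> 1" for s
    unfolding laplace_def
  proof (rule Bochner_Integration.integral_norm_bound_integral[OF _ bd C(2)[OF s]])
    show "integrable lborel (\<lambda>v. of_real ((- v) ^ n * \<gamma> v) * exp (- (s * of_real v)))"
    proof (rule Bochner_Integration.integrable_bound[OF bd])
      show "AE v in lborel. norm (of_real ((- v) ^ n * \<gamma> v) * exp (- (s * of_real v))) \<le> norm (C * (1 / (1 + v\<^sup>2)))"
        unfolding real_norm_def by (intro AE_I2 order_trans[OF C(2)[OF s] abs_ge_self])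
    qed measurable
  qed
  then show ?thesis by (rule that)
qed

lemma laplace_continuous_closed:
  assumes ok: "transformable \<gamma>" and log_small: "log_small \<gamma>"
  shows "continuous_on {s. Re s \<ge> 1} (laplace (\<lambda>v. (- v) ^ n * \<gamma> v))"
  unfolding continuous_on_sequentially
proof (intro allI ballI impI)
  fix x :: "nat \<Rightarrow> complex" and s
  assume s: "s \<in> {s. Re s \<ge> 1}" and x: "(\<forall>k. x k \<in> {s. Re s \<ge> 1}) \<and> x \<longlonglongrightarrow> s"
  obtain C where C: "C > 0" "\<And>s v. Re s \<ge> 1 \<Longrightarrow>
      norm (of_real ((- v) ^ n * \<gamma> v) * exp (- (s * of_real v))) \<le> C * (1 / (1 + v\<^sup>2))"
    using log_small_integrand_bound[OF assms] by metis
  have [measurable]: "\<gamma> \<in> borel_measurable borel" using transformableD[OF ok] by simp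
  show "(laplace (\<lambda>v. (- v) ^ n * \<gamma> v) \<circ> x) \<longlonglongrightarrow> laplace (\<lambda>v. (- v) ^ n * \<gamma> v) s"
    unfolding laplace_def comp_def
  proof (rule integral_dominated_convergence[where w = "\<lambda>v. C * (1 / (1 + v\<^sup>2))"])
    show "integrable lborel (\<lambda>v::real. C * (1 / (1 + v\<^sup>2)))"
      by (intro integrable_mult_right integrable_inverse_square)
    show "AE v in lborel. (\<lambda>k. of_real ((- v) ^ n * \<gamma> v) * exp (- (x k * of_real v)))
        \<longlonglongrightarrow> of_real ((- v) ^ n * \<gamma> v) * exp (- (s * of_real v))"
      using x by (intro AE_I2 tendsto_intros) auto
    show "AE v in lborel. norm (of_real ((- v) ^ n * \<gamma> v) * exp (- (x k * of_real v))) \<le> C * (1 / (1 + v\<^sup>2))" for k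
      using x by (intro AE_I2 C(2)) auto
  qed measurable
qed

lemma abelian_growth:
  assumes ok: "transformable \<gamma>" and log_small: "log_small \<gamma>"
  shows "poly_growth 0 (laplace \<gamma>)"
  unfolding poly_growth_def
proof (intro conjI allI laplace_holomorphic ok)
  fix n
  obtain C where C: "\<And>s. Re s \<ge> 1 \<Longrightarrow> norm (laplace (\<lambda>v. (- v) ^ n * \<gamma> v) s) \<le> C"
    using abelian_bound[OF assms] by metis
  show "strip_bound 0 ((deriv ^^ n) (laplace \<gamma>))"
    by (rule strip_boundI[of _ C]) (use C in \<open>simp add: higher_deriv_laplace[OF ok]\<close>)
qed

section \<open>Error terms in the logarithmic variable\<close>

text \<open>An error \<open>O(ln x)\<close> is harmless, so the comparison functions may be normalised in the way that
  makes their transforms simplest.\<close>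

lemma log_small_perturb:
  assumes "log_small f" and K: "\<And>v. v \<ge> 0 \<Longrightarrow> \<bar>g v - f v\<bar> \<le> K * (1 + v)"
  shows "log_small g"
  unfolding log_small_def
proof (rule allI)
  fix M
  obtain C where C: "C > 0" "\<And>v. v \<ge> 0 \<Longrightarrow> \<bar>f v\<bar> \<le> C * exp v / (1 + v) ^ M"
    using log_smallE[OF assms(1)] by metis
  have K0: "K \<ge> 0" using order_trans[OF abs_ge_zero K[of 0]] by simp
  have "\<bar>g v\<bar> \<le> (C + K * fact (Suc M) * exp 1) * exp v / (1 + v) ^ M" if v: "v \<ge> 0" for v
  proof -
    have "(1 + v) ^ Suc M \<le> fact (Suc M) * exp (1 + v)"
      using power_le_exp[of "1 + v" 1 "Suc M"] v by simp
    then have "K * (1 + v) ^ Suc M \<le> K * (fact (Suc M) * exp (1 + v))" using K0 by (rule mult_left_mono)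
    then have "K * (1 + v) \<le> (K * fact (Suc M) * exp 1) * exp v / (1 + v) ^ M"
      using v by (simp add: exp_add pos_le_divide_eq mult_ac)
    then have "\<bar>g v\<bar> \<le> C * exp v / (1 + v) ^ M + (K * fact (Suc M) * exp 1) * exp v / (1 + v) ^ M"
      using K[OF v] C(2)[OF v] by linarith
    then show ?thesis by (simp add: add_divide_distrib distrib_right)
  qed
  then show "\<exists>C. \<forall>v\<ge>0. \<bar>g v\<bar> \<le> C * exp v / (1 + v) ^ M" by blast
qed

lemma bigo_iff_log_small:
  assumes bdd: "\<And>X. \<exists>K. \<forall>x. 1 \<le> x \<longrightarrow> x \<le> X \<longrightarrow> \<bar>f x\<bar> \<le> K"
  shows "(\<forall>n::nat. f \<in> O[at_top](\<lambda>x. x / ln x ^ n)) \<longleftrightarrow> log_small (\<lambda>v. f (exp v))"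
proof (intro iffI allI)
  fix n :: nat assume "log_small (\<lambda>v. f (exp v))"
  then obtain C where C: "C > 0" "\<And>v. v \<ge> 0 \<Longrightarrow> \<bar>f (exp v)\<bar> \<le> C * exp v / (1 + v) ^ n"
    using log_smallE by metis
  show "f \<in> O[at_top](\<lambda>x. x / ln x ^ n)"
  proof (rule bigoI[of _ C], rule eventually_at_top_linorderI[of 2])
    fix x :: real assume x: "x \<ge> 2"
    have "\<bar>f x\<bar> \<le> C * x / (1 + ln x) ^ n" using C(2)[of "ln x"] x by simp
    also have "\<dots> \<le> C * x / ln x ^ n"
      using x C(1) by (intro divide_left_mono power_mono mult_pos_pos zero_less_power add_pos_nonneg) auto
    finally show "norm (f x) \<le> C * norm (x / ln x ^ n)" using x by (simp add: abs_mult)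
  qed
next
  assume O: "\<forall>n::nat. f \<in> O[at_top](\<lambda>x. x / ln x ^ n)"
  show "log_small (\<lambda>v. f (exp v))"
    unfolding log_small_def
  proof (rule allI)
    fix M :: nat
    obtain c where c: "c > 0" "\<forall>\<^sub>F x in at_top. norm (f x) \<le> c * norm (x / ln x ^ M)"
      using O landau_o.bigE by blast
    obtain X0 where X0: "\<And>x. x \<ge> X0 \<Longrightarrow> norm (f x) \<le> c * norm (x / ln x ^ M)"
      using c(2) unfolding eventually_at_top_linorder by blast
    \<comment> \<open>beyond \<open>exp 1\<close> the weights \<open>v ^ M\<close> and \<open>(1 + v) ^ M\<close> are comparable\<close>
    define X where "X = max X0 (exp 1)"
    obtain K where K: "\<And>x. 1 \<le> x \<Longrightarrow> x \<le> X \<Longrightarrow> \<bar>f x\<bar> \<le> K" using bdd by blast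
    have X1: "X \<ge> exp 1" "X > 0" "ln X \<ge> 1"
    proof -
      show "X \<ge> exp 1" by (simp add: X_def)
      then show "X > 0" using exp_gt_zero[of "1::real"] by linarith
      then show "ln X \<ge> 1" using \<open>X \<ge> exp 1\<close> by (simp add: ln_ge_iff)
    qed
    have K0: "K \<ge> 0" using order_trans[OF abs_ge_zero K[of 1]] X1 one_le_exp_iff[of "1::real"] by linarith
    have "\<bar>f (exp v)\<bar> \<le> (c * 2 ^ M + K * (1 + ln X) ^ M) * exp v / (1 + v) ^ M" if v: "v \<ge> 0" for v
    proof (cases "exp v \<ge> X")
      case True
      have v1: "v \<ge> 1" using order_trans[OF X1(1) True] by simp
      have "\<bar>f (exp v)\<bar> \<le> c * (exp v / v ^ M)"
        using X0[of "exp v"] True v by (simp add: X_def)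
      also have "\<dots> = c * 2 ^ M * exp v / (2 * v) ^ M" by (simp add: power_mult_distrib)
      also have "\<dots> \<le> c * 2 ^ M * exp v / (1 + v) ^ M"
        using v1 c(1) by (intro divide_left_mono power_mono) auto
      also have "\<dots> \<le> (c * 2 ^ M + K * (1 + ln X) ^ M) * exp v / (1 + v) ^ M"
        using K0 X1 v by (intro divide_right_mono mult_right_mono) auto
      finally show ?thesis .
    next
      case False
      then have vX: "v \<le> ln X" using X1 by (simp add: ln_ge_iff)
      have "\<bar>f (exp v)\<bar> \<le> K * 1" using K[of "exp v"] False v by simp
      also have "\<dots> \<le> K * ((1 + ln X) ^ M / (1 + v) ^ M)"
      proof (rule mult_left_mono)
        have "(1 + v) ^ M \<le> (1 + ln X) ^ M" using v vX by (intro power_mono) auto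
        then show "1 \<le> (1 + ln X) ^ M / (1 + v) ^ M" using v by simp
      qed (rule K0)
      also have "\<dots> = K * (1 + ln X) ^ M * 1 / (1 + v) ^ M" by simp
      also have "\<dots> \<le> (c * 2 ^ M + K * (1 + ln X) ^ M) * exp v / (1 + v) ^ M"
        using K0 X1 v c(1) by (intro divide_right_mono mult_mono) auto
      finally show ?thesis .
    qed
    then show "\<exists>C. \<forall>v\<ge>0. \<bar>f (exp v)\<bar> \<le> C * exp v / (1 + v) ^ M" by blast
  qed
qed

section \<open>The two comparison functions\<close>

definition exp_density :: "real \<Rightarrow> real \<Rightarrow> real" where
  "exp_density a v = (if v < 0 then 0 else a * exp v)"

lemma
  assumes a: "a \<ge> 0"
  shows transformable_exp_density: "transformable (exp_density a)"
    and laplace_exp_density: "Re s > 1 \<Longrightarrow> laplace (exp_density a) s = of_real a / (s - 1)"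
    and primitive_exp_density: "v \<ge> 0 \<Longrightarrow> primitive (exp_density a) v = a * exp v - a"
proof -
  have eq: "exp_density a v = a * (indicator {0..} v * exp v)" for v
    by (simp add: exp_density_def indicator_def)
  show ok: "transformable (exp_density a)"
    unfolding transformable_def
  proof (intro conjI allI impI)
    show "exp_density a \<in> borel_measurable borel" unfolding eq[abs_def] by measurable
    fix \<sigma> :: real assume "\<sigma> > 1"
    then have "integrable lborel (\<lambda>v. a * (indicator {0..} v * exp (- ((\<sigma> - 1) * v))))"
      by (intro integrable_mult_right exp_tail_integrable_real) auto
    moreover have "exp_density a v * exp (- (\<sigma> * v)) = a * (indicator {0..} v * exp (- ((\<sigma> - 1) * v)))" for v
      unfolding eq by (simp add: algebra_simps exp_diff exp_minus divide_inverse)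
    ultimately show "integrable lborel (\<lambda>v. exp_density a v * exp (- (\<sigma> * v)))" by simp
  qed (simp add: exp_density_def)
  show "laplace (exp_density a) s = of_real a / (s - 1)" if s: "Re s > 1" for s
  proof -
    have "laplace (exp_density a) s = (LINT v|lborel. of_real a * (indicator {0..} v *\<^sub>R exp (- ((s - 1) * of_real v))))"
      unfolding laplace_def
      by (intro Bochner_Integration.integral_cong refl)
         (simp add: exp_density_def indicator_def algebra_simps exp_diff exp_minus divide_inverse exp_of_real)
    also have "\<dots> = of_real a * (exp (- ((s - 1) * of_real 0)) / (s - 1))"
      unfolding integral_mult_right_zero using s by (subst exp_tail(2)) auto
    finally show ?thesis by simp
  qed
  show "primitive (exp_density a) v = a * exp v - a" if v: "v \<ge> 0" for v
  proof -
    have "primitive (exp_density a) v = (LINT w|lborel. indicator {0..v} w *\<^sub>R (a * exp w))"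
      unfolding primitive_def by (intro Bochner_Integration.integral_cong) (auto simp: exp_density_def)
    also have "\<dots> = a * exp v - a * exp 0"
      using v by (intro integral_FTC_atLeastAtMost)
        (auto intro!: continuous_intros derivative_eq_intros simp flip: has_real_derivative_iff_has_vector_derivative)
    finally show ?thesis by simp
  qed
qed

text \<open>The density of \<open>Li (exp v)\<close> would be \<open>exp v / v\<close>, which is not integrable at 0. Subtracting
  \<open>1 / v\<close> repairs this and turns the transform into \<open>log (s / (s - 1))\<close>.\<close>

definition li_density :: "real \<Rightarrow> real" where
  "li_density w = (if w > 0 then (exp w - 1) / w else 0)"

lemma li_density_bounds: "li_density w \<ge> 0" "li_density w \<le> 1 * exp w"
proof -
  show "li_density w \<ge> 0" by (simp add: li_density_def)
  have "exp w - 1 \<le> w * exp w"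
    using mult_left_mono[OF exp_ge_add_one_self[of "- w"], of "exp w"] by (simp add: exp_minus algebra_simps)
  then show "li_density w \<le> 1 * exp w" by (auto simp: li_density_def field_simps)
qed

lemma transformable_li_density: "transformable li_density"
proof (rule transformable_bound[OF transformable_exp_density[of 1]])
  show "li_density \<in> borel_measurable borel" unfolding li_density_def by measurable
  show "\<exists>C. \<forall>v\<ge>0. \<bar>li_density v\<bar> \<le> C * exp (\<delta> * v) * \<bar>exp_density 1 v\<bar>" if "\<delta> > 0" for \<delta>
  proof (intro exI[of _ 1] allI impI)
    fix v :: real assume v: "v \<ge> 0"
    have "1 * exp v \<le> exp (\<delta> * v) * exp v" using v that by (intro mult_right_mono) auto
    then have "li_density v \<le> exp (\<delta> * v) * exp v" using li_density_bounds(2)[of v] by linarith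
    then show "\<bar>li_density v\<bar> \<le> 1 * exp (\<delta> * v) * \<bar>exp_density 1 v\<bar>"
      using li_density_bounds(1)[of v] v by (simp add: exp_density_def)
  qed
qed (auto simp: li_density_def)

lemma laplace_li_density_deriv:
  assumes "Re s > 1"
  shows "(laplace li_density has_field_derivative 1 / s - 1 / (s - 1)) (at s)"
proof -
  define one where "one = (\<lambda>v::real. if v < 0 then 0 else 1 :: real)"
  have one_ok: "transformable one"
  proof (rule transformable_bound[OF transformable_exp_density[of 1]])
    show "one \<in> borel_measurable borel" unfolding one_def by measurable
    show "\<exists>C. \<forall>v\<ge>0. \<bar>one v\<bar> \<le> C * exp (\<delta> * v) * \<bar>exp_density 1 v\<bar>" if "\<delta> > 0" for \<delta>
      by (intro exI[of _ 1]) (use that in \<open>auto simp: one_def exp_density_def simp flip: exp_add\<close>)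
  qed (auto simp: one_def)
  have "laplace one s = (LINT v|lborel. (indicator {0..} v *\<^sub>R exp (- (s * of_real v))))"
    unfolding laplace_def by (intro Bochner_Integration.integral_cong refl) (simp add: one_def indicator_def)
  also have "\<dots> = 1 / s" using assms by (subst exp_tail(2)) auto
  finally have one: "laplace one s = 1 / s" .
  have "laplace (\<lambda>v. v * li_density v) s = laplace (\<lambda>v. exp_density 1 v - one v) s"
    unfolding laplace_def
    by (intro Bochner_Integration.integral_cong refl) (auto simp: one_def exp_density_def li_density_def)
  also have "\<dots> = 1 / (s - 1) - 1 / s"
    using laplace_diff[OF transformable_exp_density[of 1] one_ok assms] laplace_exp_density[of 1 s] one assms by simp
  finally show ?thesis
    using laplace_has_field_derivative[OF transformable_li_density assms] by simp
qed

lemma laplace_real: "laplace f (of_real \<sigma>) = of_real (LINT v|lborel. f v * exp (- (\<sigma> * v)))"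
  unfolding laplace_def by (simp flip: exp_of_real integral_complex_of_real)

text \<open>The logarithmic derivatives agree by \<open>laplace_li_density_deriv\<close>, so the two functions are
  proportional. Both sides are positive at \<open>s = 2\<close>.\<close>

lemma exp_laplace_li_density:
  obtains \<kappa> :: real where "\<kappa> > 0" "\<And>s. Re s > 1 \<Longrightarrow> exp (laplace li_density s) = of_real \<kappa> * s / (s - 1)"
proof -
  define \<Phi> where "\<Phi> = (\<lambda>s. exp (laplace li_density s) * (s - 1) / s)"
  have "\<exists>c. \<forall>s\<in>half_plane. \<Phi> s = c"
  proof (rule has_field_derivative_zero_constant)
    show "convex half_plane" by (rule convex_halfspace_Re_gt)
    fix s assume "s \<in> half_plane"
    then have s: "Re s > 1" "s \<noteq> 0" "s - 1 \<noteq> 0" by auto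
    have "(\<Phi> has_field_derivative 0) (at s)"
      unfolding \<Phi>_def using s
      by (auto intro!: derivative_eq_intros laplace_li_density_deriv) (simp add: field_simps)
    then show "(\<Phi> has_field_derivative 0) (at s within half_plane)" by (rule has_field_derivative_at_within)
  qed
  then obtain c where c: "\<And>s. Re s > 1 \<Longrightarrow> \<Phi> s = c" by auto
  define \<kappa> where "\<kappa> = exp (LINT v|lborel. li_density v * exp (- (2 * v))) / 2"
  have "c = of_real \<kappa>"
    using c[of 2] laplace_real[of li_density 2] by (simp add: \<Phi>_def \<kappa>_def exp_of_real)
  then have "exp (laplace li_density s) = of_real \<kappa> * s / (s - 1)" if "Re s > 1" for s
  proof -
    have "s \<noteq> 0" "s - 1 \<noteq> 0" using that by auto
    then have "exp (laplace li_density s) = \<Phi> s * s / (s - 1)" by (simp add: \<Phi>_def)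
    then show ?thesis using c[OF that] \<open>c = of_real \<kappa>\<close> by simp
  qed
  then show ?thesis by (intro that[of \<kappa>]) (auto simp: \<kappa>_def)
qed

text \<open>The function \<open>Li (exp w) - ln w\<close> is an antiderivative of \<open>li_density\<close> for \<open>w > 0\<close>.\<close>

lemma Li_exp_eq:
  assumes v: "v \<ge> ln 2"
  shows "Li (exp v) = primitive li_density v - primitive li_density (ln 2) + ln v - ln (ln 2)"
proof -
  have l2: "ln 2 > (0::real)" by simp
  have pos: "w > 0" if "w \<ge> ln 2" for w :: real using l2 that by linarith
  have ev: "exp v \<ge> 2" using v by (simp add: ln_le_cancel_iff[symmetric, of 2])
  define F where "F = (\<lambda>w. Li (exp w) - ln w)"
  have Li': "(Li has_real_derivative 1 / ln x) (at x within {2..exp v})" if "x \<in> {2..exp v}" for x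
    unfolding Li_def[abs_def] using that
    by (intro integral_has_real_derivative) (auto intro!: continuous_intros)
  have F: "(F has_real_derivative (exp w - 1) / w) (at w within {ln 2..v})" if w: "w \<in> {ln 2..v}" for w
  proof -
    have w0: "w > 0" using w l2 by (meson atLeastAtMost_iff less_le_trans)
    have img: "exp ` {ln 2..v} \<subseteq> {2..exp v}"
      by (auto simp: ln_le_cancel_iff[symmetric, of 2])
    have "(Li has_real_derivative 1 / ln (exp w)) (at (exp w) within exp ` {ln 2..v})"
      by (rule DERIV_subset[OF Li' img]) (use img w in blast)
    then have "((Li \<circ> exp) has_real_derivative 1 / ln (exp w) * exp w) (at w within {ln 2..v})"
      by (rule DERIV_image_chain) (auto intro!: derivative_eq_intros)
    moreover have "(ln has_real_derivative 1 / w) (at w within {ln 2..v})"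
      using w0 by (auto intro!: derivative_eq_intros)
    ultimately have "(F has_real_derivative 1 / ln (exp w) * exp w - 1 / w) (at w within {ln 2..v})"
      unfolding F_def comp_def by (rule DERIV_diff)
    then show ?thesis by (simp add: diff_divide_distrib)
  qed
  have "primitive li_density (ln 2 + (v - ln 2)) - primitive li_density (ln 2)
      = (LINT w|lborel. indicator {ln 2<..ln 2 + (v - ln 2)} w * li_density w)"
    using v by (intro primitive_increment transformable_li_density) auto
  also have "\<dots> = (LINT w|lborel. indicator {ln 2..v} w *\<^sub>R ((exp w - 1) / w))"
  proof (rule integral_cong_AE)
    show "AE w in lborel. indicator {ln 2<..ln 2 + (v - ln 2)} w * li_density w = indicator {ln 2..v} w *\<^sub>R ((exp w - 1) / w)"
      using AE_lborel_singleton[of "ln 2 :: real"]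
      by eventually_elim (auto simp: indicator_def li_density_def pos)
    have [measurable]: "li_density \<in> borel_measurable borel" using transformableD[OF transformable_li_density] by simp
    show "(\<lambda>w. indicator {ln 2<..ln 2 + (v - ln 2)} w * li_density w) \<in> borel_measurable lborel" by measurable
  qed measurable
  also have "\<dots> = F v - F (ln 2)"
    using v F by (intro integral_FTC_atLeastAtMost)
      (auto dest: pos intro!: continuous_intros simp flip: has_real_derivative_iff_has_vector_derivative)
  also have "F (ln 2) = - ln (ln 2)" by (simp add: F_def Li_def)
  finally show ?thesis by (simp add: F_def)
qed

lemma Li_primitive_close:
  "\<exists>K. \<forall>v\<ge>0. \<bar>Li (exp v) - primitive li_density v\<bar> \<le> K * (1 + v)"
proof (intro exI allI impI)
  fix v :: real assume v: "v \<ge> 0"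
  define K where "K = primitive li_density (ln 2) + 2 * \<bar>ln (ln 2)\<bar> + 2"
  note bd = primitive_exp_bounds[OF transformable_li_density li_density_bounds]
  have K: "K \<ge> primitive li_density (ln 2) + 2 * \<bar>ln (ln 2)\<bar> + 1" "K \<ge> 2" using bd(1)[of "ln 2"] by (auto simp: K_def)
  show "\<bar>Li (exp v) - primitive li_density v\<bar> \<le> K * (1 + v)"
  proof (cases "v \<ge> ln 2")
    case True
    have l2: "ln 2 > (0::real)" by simp
    then have v0: "v > 0" using True by linarith
    have "ln v \<le> v" using ln_le_minus_one[OF v0] by linarith
    moreover have "ln v \<ge> ln (ln 2)" using True l2 v0 by (intro ln_mono) auto
    ultimately have "\<bar>ln v\<bar> \<le> \<bar>ln (ln 2)\<bar> + v" using v by linarith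
    then have "\<bar>Li (exp v) - primitive li_density v\<bar> \<le> (primitive li_density (ln 2) + \<bar>ln (ln 2)\<bar>) + (v + \<bar>ln (ln 2)\<bar>)"
      using Li_exp_eq[OF True] bd(1)[of "ln 2"] by linarith
    also have "\<dots> \<le> K * 1 + K * v"
      using K v mult_right_mono[of 1 K v] by linarith
    finally show ?thesis by (simp add: distrib_left)
  next
    case False
    then have "exp v < 2" by (simp add: not_le) (metis exp_less_cancel_iff exp_ln zero_less_numeral)
    then have "Li (exp v) = 0" by (simp add: Li_def)
    then have "\<bar>Li (exp v) - primitive li_density v\<bar> \<le> exp v" using bd(1,2)[of v] by simp
    also have "\<dots> \<le> K * 1" using \<open>exp v < 2\<close> K by simp
    also have "\<dots> \<le> K * (1 + v)" using K v by (intro mult_left_mono) auto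
    finally show ?thesis .
  qed
qed

section \<open>The zeta function of a number system\<close>

text \<open>The atom of \<open>F\<close> at 1 is counted here because \<open>F\<close> vanishes to the left of 1: the mass of \<open>{1..b}\<close>
  is that of \<open>{0<..b}\<close>.\<close>

lemma emeasure_upto:
  assumes F: "mono F" "\<And>x. continuous (at_right x) F" "\<And>x. x < 1 \<Longrightarrow> F x = 0" and b: "b \<ge> 1"
  shows "emeasure (interval_measure F) ({1..} \<inter> {..b}) = ennreal (F b)"
proof -
  have Ioc: "emeasure (interval_measure F) {a<..c} = ennreal (F c - F a)" if "a \<le> c" for a c
    by (rule emeasure_interval_measure_Ioc[OF that]) (use F(1,2) in \<open>auto dest: monoD\<close>)
  have null: "{0<..<1} \<in> null_sets (interval_measure F)"
  proof (rule null_sets_subset)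
    show "(\<Union>n. {0<..1 - 1 / real (Suc n)}) \<in> null_sets (interval_measure F)"
    proof (rule null_sets_UN)
      show "{0<..1 - 1 / real (Suc n)} \<in> null_sets (interval_measure F)" for n
        using Ioc[of 0 "1 - 1 / real (Suc n)"] F(3) by (auto simp: null_sets_def)
    qed
    show "{0<..<1} \<subseteq> (\<Union>n. {0<..1 - 1 / real (Suc n)})"
    proof
      fix x :: real assume x: "x \<in> {0<..<1}"
      obtain n where "1 / real (Suc n) < 1 - x"
        using x nat_approx_posE[of "1 - x"] by auto
      then show "x \<in> (\<Union>n. {0<..1 - 1 / real (Suc n)})" using x by (intro UN_I[of n]) auto
    qed
  qed auto
  have "emeasure (interval_measure F) ({1..} \<inter> {..b}) = emeasure (interval_measure F) (({1..} \<inter> {..b}) \<union> {0<..<1})"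
    by (rule emeasure_Un_null_set[OF _ null, symmetric]) auto
  also have "({1..} \<inter> {..b}) \<union> {0<..<1} = {0<..b}" using b by auto
  finally show ?thesis using Ioc[of 0 b] b F(3)[of 0] by simp
qed

lemma powr_minus_eq_exp: "x > 0 \<Longrightarrow> complex_of_real x powr (- s) = exp (- (s * of_real (ln x)))"
  by (simp add: powr_def Ln_of_real)

lemma stieltjes_laplace:
  assumes M: "sigma_finite_measure (interval_measure F)"
    and S: "S \<in> sets borel" "S \<subseteq> {1..}"
    and F: "\<And>b. b \<ge> 1 \<Longrightarrow> emeasure (interval_measure F) (S \<inter> {..b}) = ennreal (F b)"
      "\<And>b. F b \<ge> 0" "\<And>b. b < 1 \<Longrightarrow> F b = 0"
    and int: "\<And>s. Re s > 1 \<Longrightarrow> set_integrable (interval_measure F) S (\<lambda>x. complex_of_real x powr (- s))"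
  shows "transformable (\<lambda>v. F (exp v))"
    and "Re s > 1 \<Longrightarrow> (LINT x:S|interval_measure F. complex_of_real x powr (- s)) = s * laplace (\<lambda>v. F (exp v)) s"
    and "\<sigma> > 1 \<Longrightarrow> integrable (interval_measure F) (\<lambda>y. indicator S y * exp (- (\<sigma> * ln y)))"
    and "Re s > 1 \<Longrightarrow> (LINT x:S|interval_measure F. complex_of_real x powr (- s))
        = (LINT y|interval_measure F. of_real (indicator S y) * exp (- (s * of_real (ln y))))"
proof -
  have [measurable]: "S \<in> sets borel" by (rule S)
  have pos: "y > 0" if "y \<in> S" for y using S(2) that by force
  show int': "integrable (interval_measure F) (\<lambda>y. indicator S y * exp (- (\<sigma> * ln y)))" if "\<sigma> > 1" for \<sigma>
  proof -
    have "integrable (interval_measure F) (\<lambda>y. norm (indicator S y *\<^sub>R (complex_of_real y powr (- of_real \<sigma>))))"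
      using int[of "of_real \<sigma>"] that unfolding set_integrable_def by (intro integrable_norm) auto
    then show ?thesis
      by (rule Bochner_Integration.integrable_cong[THEN iffD1, rotated -1])
         (auto simp: indicator_def powr_minus_eq_exp pos)
  qed
  show trans: "(LINT x:S|interval_measure F. complex_of_real x powr (- s))
        = (LINT y|interval_measure F. of_real (indicator S y) * exp (- (s * of_real (ln y))))" if "Re s > 1" for s
    unfolding set_lebesgue_integral_def
    by (intro Bochner_Integration.integral_cong refl) (auto simp: indicator_def powr_minus_eq_exp pos)
  have nonneg: "ln y \<ge> 0" if "indicator S y \<noteq> (0::real)" for y
    using S(2) that by (auto simp: indicator_def split: if_splits)
  have cum: "(LINT y|interval_measure F. (if ln y \<le> v then indicator S y else 0)) = F (exp v)" for v
  proof (cases "v < 0")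
    case True
    then have "(if ln y \<le> v then indicator S y else 0) = (0::real)" for y
      using nonneg[of y] by (cases "indicator S y = (0::real)") auto
    then show ?thesis using True F(3)[of "exp v"] by simp
  next
    case False
    have "(if ln y \<le> v then indicator S y else 0) = (indicator (S \<inter> {..exp v}) y :: real)" for y
      using pos[of y] by (auto simp: indicator_def ln_le_cancel_iff ln_ge_iff not_le)
         (metis exp_le_cancel_iff exp_ln leD)+
    then have "(LINT y|interval_measure F. (if ln y \<le> v then indicator S y else 0)) = measure (interval_measure F) (S \<inter> {..exp v})"
      by simp
    also have "\<dots> = F (exp v)" using F(1)[of "exp v"] F(2) False by (simp add: measure_def)
    finally show ?thesis .
  qed
  note c = laplace_cumulative[OF M, of "indicator S" ln, unfolded cum]
  show "transformable (\<lambda>v. F (exp v))"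
    by (rule c) (use nonneg int' in auto)
  show "(LINT x:S|interval_measure F. complex_of_real x powr (- s)) = s * laplace (\<lambda>v. F (exp v)) s" if s: "Re s > 1"
  proof -
    have "laplace (\<lambda>v. F (exp v)) s = (LINT y|interval_measure F. of_real (indicator S y) * exp (- (s * of_real (ln y)))) / s"
      by (rule c) (use nonneg int' s in auto)
    then show ?thesis using trans[OF s] s by auto
  qed
qed

locale beurling_system =
  fixes N P :: "real \<Rightarrow> real"
  assumes gns: "generalized_number_system N P"
begin

definition log_zeta :: "complex \<Rightarrow> complex" where
  "log_zeta s = (LINT x:{1<..}|interval_measure P. complex_of_real x powr (- s))"

abbreviation "N_exp \<equiv> \<lambda>v. N (exp v)"
abbreviation "P_exp \<equiv> \<lambda>v. P (exp v)"

lemma N_props: "mono N" "\<And>x. continuous (at_right x) N" "\<And>x. x < 1 \<Longrightarrow> N x = 0"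
  and P_props: "mono P" "\<And>x. continuous (at_right x) P" "\<And>x. x < 1 \<Longrightarrow> P x = 0" "P 1 = 0"
  and N_int: "Re s > 1 \<Longrightarrow> set_integrable (interval_measure N) {1..} (\<lambda>x. complex_of_real x powr (- s))"
  and P_int: "Re s > 1 \<Longrightarrow> set_integrable (interval_measure P) {1<..} (\<lambda>x. complex_of_real x powr (- s))"
  and zeta_eq_exp: "Re s > 1 \<Longrightarrow> beurling_zeta N s = exp (log_zeta s)"
  using gns unfolding generalized_number_system_def log_zeta_def by auto

lemma nonneg_of_mono:
  assumes "mono F" "\<And>x. x < 1 \<Longrightarrow> F x = (0::real)" shows "F (b::real) \<ge> 0"
  using monoD[OF assms(1), of "min b 0" b] assms(2)[of "min b 0"] by simp

lemma
  shows transformable_N: "transformable N_exp"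
    and zeta_eq_laplace: "Re s > 1 \<Longrightarrow> beurling_zeta N s = s * laplace N_exp s"
proof -
  have sf: "sigma_finite_measure (interval_measure N)"
    by (rule sigma_finite_interval_measure) (use N_props in \<open>auto dest: monoD\<close>)
  note st = stieltjes_laplace[OF sf _ _ emeasure_upto[OF N_props] nonneg_of_mono[OF N_props(1,3)] N_props(3) N_int]
  show "transformable N_exp" by (rule st) auto
  show "Re s > 1 \<Longrightarrow> beurling_zeta N s = s * laplace N_exp s"
    unfolding beurling_zeta_def by (rule st) auto
qed

lemma
  shows transformable_P: "transformable P_exp"
    and log_zeta_eq_laplace: "Re s > 1 \<Longrightarrow> log_zeta s = s * laplace P_exp s"
    and P_exp_int: "\<sigma> > 1 \<Longrightarrow> integrable (interval_measure P) (\<lambda>y. indicator {1<..} y * exp (- (\<sigma> * ln y)))"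
    and log_zeta_eq: "Re s > 1 \<Longrightarrow> log_zeta s
        = (LINT y|interval_measure P. of_real (indicator {1<..} y) * exp (- (s * of_real (ln y))))"
proof -
  have sf: "sigma_finite_measure (interval_measure P)"
    by (rule sigma_finite_interval_measure) (use P_props in \<open>auto dest: monoD\<close>)
  have em: "emeasure (interval_measure P) ({1<..} \<inter> {..b}) = ennreal (P b)" if "b \<ge> 1" for b
  proof -
    have "{1<..} \<inter> {..b} = {1<..b}" by auto
    then show ?thesis
      using emeasure_interval_measure_Ioc[OF that, of P] P_props by (auto dest: monoD)
  qed
  note st = stieltjes_laplace[OF sf _ _ em nonneg_of_mono[OF P_props(1,3)] P_props(3) P_int]
  show "transformable P_exp" by (rule st) auto
  show "Re s > 1 \<Longrightarrow> log_zeta s = s * laplace P_exp s"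
    unfolding log_zeta_def by (rule st) auto
  show "\<sigma> > 1 \<Longrightarrow> integrable (interval_measure P) (\<lambda>y. indicator {1<..} y * exp (- (\<sigma> * ln y)))"
    by (rule st) auto
  show "Re s > 1 \<Longrightarrow> log_zeta s
        = (LINT y|interval_measure P. of_real (indicator {1<..} y) * exp (- (s * of_real (ln y))))"
    unfolding log_zeta_def by (rule st) auto
qed

lemma mono_N_exp: "mono N_exp" and mono_P_exp: "mono P_exp"
  by (auto intro!: monoI monoD[OF N_props(1)] monoD[OF P_props(1)])

lemma Re_log_zeta:
  assumes "Re s > 1"
  shows "Re (log_zeta s) = (LINT y|interval_measure P. indicator {1<..} y * exp (- (Re s * ln y)) * cos (Im s * ln y))"
    and "integrable (interval_measure P) (\<lambda>y. indicator {1<..} y * exp (- (Re s * ln y)) * cos (Im s * ln y))"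
proof -
  have int: "integrable (interval_measure P) (\<lambda>y. of_real (indicator {1<..} y) * exp (- (s * of_real (ln y))))"
    by (rule Bochner_Integration.integrable_bound[OF P_exp_int[OF assms]]) (auto simp: norm_mult)
  have eq: "Re (of_real (indicator {1<..} y) * exp (- (s * of_real (ln y))))
      = indicator {1<..} y * exp (- (Re s * ln y)) * cos (Im s * ln y)" for y
    by (simp add: Re_exp indicator_def)
  show "Re (log_zeta s) = (LINT y|interval_measure P. indicator {1<..} y * exp (- (Re s * ln y)) * cos (Im s * ln y))"
    unfolding log_zeta_eq[OF assms] integral_Re[OF int, symmetric] eq ..
  show "integrable (interval_measure P) (\<lambda>y. indicator {1<..} y * exp (- (Re s * ln y)) * cos (Im s * ln y))"
    using integrable_Re[OF int] unfolding eq .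
qed

lemma norm_log_zeta_le:
  assumes "Re s > 1" shows "norm (log_zeta s) \<le> Re (log_zeta (of_real (Re s)))"
proof -
  have "norm (log_zeta s) \<le> (LINT y|interval_measure P. norm (of_real (indicator {1<..} y) * exp (- (s * of_real (ln y)))))"
    unfolding log_zeta_eq[OF assms] by (rule integral_norm_bound)
  also have "\<dots> = Re (log_zeta (of_real (Re s)))"
    using assms by (subst Re_log_zeta) (auto simp: norm_mult intro!: Bochner_Integration.integral_cong)
  finally show ?thesis .
qed

lemma log_zeta_real_antimono:
  assumes "1 < \<sigma>" "\<sigma> \<le> \<tau>" shows "Re (log_zeta (of_real \<tau>)) \<le> Re (log_zeta (of_real \<sigma>))"
proof -
  have "(LINT y|interval_measure P. indicator {1<..} y * exp (- (\<tau> * ln y)))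
      \<le> (LINT y|interval_measure P. indicator {1<..} y * exp (- (\<sigma> * ln y)))"
    by (rule integral_mono[OF P_exp_int P_exp_int])
       (use assms in \<open>auto simp: indicator_def intro!: mult_right_mono\<close>)
  then show ?thesis using assms by (simp add: Re_log_zeta)
qed

lemma norm_zeta_le:
  assumes "1 < \<sigma>" "\<sigma> \<le> Re s" shows "norm (beurling_zeta N s) \<le> norm (beurling_zeta N (of_real \<sigma>))"
proof -
  have "Re (log_zeta s) \<le> norm (log_zeta s)" by (rule complex_Re_le_cmod)
  also have "\<dots> \<le> Re (log_zeta (of_real (Re s)))" using assms by (intro norm_log_zeta_le) auto
  also have "\<dots> \<le> Re (log_zeta (of_real \<sigma>))" using assms by (intro log_zeta_real_antimono)
  finally show ?thesis using assms by (simp add: zeta_eq_exp)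
qed

text \<open>The lower bound comes from \<open>|log zeta(s)| \<le> log zeta(Re s)\<close>.\<close>

lemma norm_zeta_ge:
  assumes "1 < \<sigma>" "\<sigma> \<le> Re s" shows "norm (beurling_zeta N s) * norm (beurling_zeta N (of_real \<sigma>)) \<ge> 1"
proof -
  have "- Re (log_zeta s) \<le> norm (log_zeta s)" using abs_Re_le_cmod[of "log_zeta s"] by linarith
  also have "\<dots> \<le> Re (log_zeta (of_real (Re s)))" using assms by (intro norm_log_zeta_le) auto
  also have "\<dots> \<le> Re (log_zeta (of_real \<sigma>))" using assms by (intro log_zeta_real_antimono)
  finally show ?thesis using assms by (simp add: zeta_eq_exp flip: exp_add)
qed

text \<open>Nonnegativity of \<open>3 + 4 cos x + cos 2x = 2 (1 + cos x)\<^sup>2\<close>, integrated against \<open>P\<close> with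
  \<open>x = t ln y\<close>.\<close>

lemma zeta_3_4_1:
  assumes "\<sigma> > 1"
  shows "norm (beurling_zeta N (of_real \<sigma>)) ^ 3 * norm (beurling_zeta N (Complex \<sigma> t)) ^ 4
     * norm (beurling_zeta N (Complex \<sigma> (2 * t))) \<ge> 1"
proof -
  note L = Re_log_zeta[of "of_real \<sigma>"] Re_log_zeta[of "Complex \<sigma> t"] Re_log_zeta[of "Complex \<sigma> (2 * t)"]
  have "3 * Re (log_zeta (of_real \<sigma>)) + 4 * Re (log_zeta (Complex \<sigma> t)) + Re (log_zeta (Complex \<sigma> (2 * t)))
     = (LINT y|interval_measure P. 3 * (indicator {1<..} y * exp (- (\<sigma> * ln y)) * cos (0 * ln y))
        + 4 * (indicator {1<..} y * exp (- (\<sigma> * ln y)) * cos (t * ln y))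
        + indicator {1<..} y * exp (- (\<sigma> * ln y)) * cos (2 * t * ln y))"
    using L assms by simp
  also have "\<dots> \<ge> 0"
  proof (rule integral_nonneg_AE, rule AE_I2)
    fix y
    have "cos (2 * (t * ln y)) = 2 * (cos (t * ln y))\<^sup>2 - 1" by (rule cos_double_cos)
    then have "3 + 4 * cos (t * ln y) + cos (2 * t * ln y) = 2 * (1 + cos (t * ln y))\<^sup>2"
      by (simp add: power2_eq_square algebra_simps)
    then have "0 \<le> indicator {1<..} y * exp (- (\<sigma> * ln y)) * (3 + 4 * cos (t * ln y) + cos (2 * t * ln y))"
      by simp
    then show "0 \<le> 3 * (indicator {1<..} y * exp (- (\<sigma> * ln y)) * cos (0 * ln y))
        + 4 * (indicator {1<..} y * exp (- (\<sigma> * ln y)) * cos (t * ln y))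
        + indicator {1<..} y * exp (- (\<sigma> * ln y)) * cos (2 * t * ln y)"
      by (simp add: algebra_simps)
  qed
  finally have "0 \<le> 3 * Re (log_zeta (of_real \<sigma>)) + 4 * Re (log_zeta (Complex \<sigma> t)) + Re (log_zeta (Complex \<sigma> (2 * t)))" .
  then have "1 \<le> exp (3 * Re (log_zeta (of_real \<sigma>)) + 4 * Re (log_zeta (Complex \<sigma> t)) + Re (log_zeta (Complex \<sigma> (2 * t))))"
    by simp
  also have "\<dots> = norm (beurling_zeta N (of_real \<sigma>)) ^ 3 * norm (beurling_zeta N (Complex \<sigma> t)) ^ 4
     * norm (beurling_zeta N (Complex \<sigma> (2 * t)))"
    using assms by (simp add: zeta_eq_exp exp_add flip: exp_of_nat_mult)
  finally show ?thesis .
qed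

lemma zeta_holomorphic: "beurling_zeta N holomorphic_on half_plane"
proof (rule holomorphic_transform)
  show "(\<lambda>s. s * laplace N_exp s) holomorphic_on half_plane"
    by (intro holomorphic_intros laplace_holomorphic transformable_N)
qed (simp add: zeta_eq_laplace)

lemma zeta_minus_pole_holomorphic: "zeta_minus_pole N a holomorphic_on half_plane"
  unfolding zeta_minus_pole_def[abs_def] by (intro holomorphic_intros zeta_holomorphic) auto

lemma zeta_minus_pole_eq:
  assumes "a \<ge> 0" "Re s > 1"
  shows "zeta_minus_pole N a s = s * (laplace N_exp s - laplace (primitive (exp_density a)) s)"
proof -
  have "s \<noteq> 0" using assms by auto
  then show ?thesis
    using assms by (simp add: zeta_minus_pole_def zeta_eq_laplace laplace_primitive transformable_exp_density
        laplace_exp_density right_diff_distrib)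
qed

lemma N_asymp_iff_log_small:
  assumes a: "a \<ge> 0"
  shows "(\<forall>n::nat. (\<lambda>x. N x - a * x) \<in> O[at_top](\<lambda>x. x / ln x ^ n))
     \<longleftrightarrow> log_small (\<lambda>v. N_exp v - primitive (exp_density a) v)"
proof -
  have "(\<forall>n::nat. (\<lambda>x. N x - a * x) \<in> O[at_top](\<lambda>x. x / ln x ^ n)) \<longleftrightarrow> log_small (\<lambda>v. N (exp v) - a * exp v)"
  proof (rule bigo_iff_log_small)
    fix X
    have "\<bar>N x - a * x\<bar> \<le> N X + a * X" if "1 \<le> x" "x \<le> X" for x
    proof -
      have "a * x \<le> a * X" "a * x \<ge> 0" using a that by (auto intro: mult_left_mono)
      then show ?thesis using monoD[OF N_props(1) that(2)] nonneg_of_mono[OF N_props(1,3), of x] by auto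
    qed
    then show "\<exists>K. \<forall>x. 1 \<le> x \<longrightarrow> x \<le> X \<longrightarrow> \<bar>N x - a * x\<bar> \<le> K" by blast
  qed
  also have "\<dots> \<longleftrightarrow> log_small (\<lambda>v. N_exp v - primitive (exp_density a) v)"
  proof (intro iffI; elim log_small_perturb)
    fix v :: real assume v: "v \<ge> 0"
    have "a * 1 \<le> a * (1 + v)" using a v by (intro mult_left_mono) auto
    then show "\<bar>N_exp v - primitive (exp_density a) v - (N (exp v) - a * exp v)\<bar> \<le> a * (1 + v)"
      "\<bar>N (exp v) - a * exp v - (N_exp v - primitive (exp_density a) v)\<bar> \<le> a * (1 + v)"
      using a v by (auto simp: primitive_exp_density)
  qed
  finally show ?thesis .
qed

lemma P_asymp_iff_log_small:
  "(\<forall>n::nat. (\<lambda>x. P x - Li x) \<in> O[at_top](\<lambda>x. x / ln x ^ n))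
     \<longleftrightarrow> log_small (\<lambda>v. P_exp v - primitive li_density v)"
proof -
  obtain K where K: "\<And>v. v \<ge> 0 \<Longrightarrow> \<bar>Li (exp v) - primitive li_density v\<bar> \<le> K * (1 + v)"
    using Li_primitive_close by blast
  have K0: "K \<ge> 0" using order_trans[OF abs_ge_zero K[of 0]] by simp
  have "(\<forall>n::nat. (\<lambda>x. P x - Li x) \<in> O[at_top](\<lambda>x. x / ln x ^ n)) \<longleftrightarrow> log_small (\<lambda>v. P (exp v) - Li (exp v))"
  proof (rule bigo_iff_log_small)
    fix X
    have "\<bar>P x - Li x\<bar> \<le> P X + (X + K * (1 + ln X))" if x: "1 \<le> x" "x \<le> X" for x
    proof -
      have "\<bar>Li x\<bar> \<le> x + K * (1 + ln x)"
        using K[of "ln x"] x primitive_exp_bounds(1,2)[OF transformable_li_density li_density_bounds, of "ln x"] by simp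
      also have "\<dots> \<le> X + K * (1 + ln X)"
        using x K0 by (intro add_mono mult_left_mono) auto
      finally show ?thesis using monoD[OF P_props(1) x(2)] nonneg_of_mono[OF P_props(1,3), of x] by auto
    qed
    then show "\<exists>K. \<forall>x. 1 \<le> x \<longrightarrow> x \<le> X \<longrightarrow> \<bar>P x - Li x\<bar> \<le> K" by blast
  qed
  also have "\<dots> \<longleftrightarrow> log_small (\<lambda>v. P_exp v - primitive li_density v)"
  proof (intro iffI; elim log_small_perturb)
    fix v :: real assume v: "v \<ge> 0"
    show "\<bar>P_exp v - primitive li_density v - (P (exp v) - Li (exp v))\<bar> \<le> K * (1 + v)"
      "\<bar>P (exp v) - Li (exp v) - (P_exp v - primitive li_density v)\<bar> \<le> K * (1 + v)"
      using K[OF v] by (auto simp: abs_minus_commute)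
  qed
  finally show ?thesis .
qed

end

section \<open>The integers and the growth of zeta\<close>

text \<open>The crude bound degenerates at the two corners of a rectangle that touches the line \<open>Re s = 1\<close>.
  The weight \<open>(u\<^sup>2 + 1) ^ m\<close> with \<open>u = s - 1 - i t0\<close> vanishes at these corners to the right order
  and is at least 1 on the horizontal line through the centre, so the maximum modulus principle
  for \<open>f\<close> times this weight bounds \<open>f\<close> on that line.\<close>

lemma strip_bound_from_boundary:
  fixes f :: "complex \<Rightarrow> complex"
  assumes cont: "continuous_on {s. Re s \<ge> 1} f" and hol: "f holomorphic_on half_plane"
    and A: "A \<ge> 0" and boundary: "\<And>t. norm (f (Complex 1 t)) \<le> B * (1 + \<bar>t\<bar>) powr A"
    and crude: "\<And>s. 1 < Re s \<Longrightarrow> Re s \<le> 2 \<Longrightarrow> norm (f s) \<le> C / (Re s - 1) ^ m"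
  shows "strip_bound A f"
proof (rule strip_boundI)
  fix s0 :: complex assume s0: "1 < Re s0" "Re s0 \<le> 2"
  define t0 where "t0 = Im s0"
  define T where "T = 1 + \<bar>t0\<bar>"
  have T: "T \<ge> 1" by (simp add: T_def)
  have B0: "B \<ge> 0" using order_trans[OF norm_ge_zero boundary[of 0]] by simp
  have C0: "C \<ge> 0" using order_trans[OF norm_ge_zero crude[of 2]] by simp
  define u where "u = (\<lambda>s. s - Complex 1 t0)"
  define g where "g = (\<lambda>s. f s * ((u s)\<^sup>2 + 1) ^ m)"
  define S where "S = cbox (Complex 1 (t0 - 1)) (Complex 2 (t0 + 1))"
  have S: "s \<in> S \<longleftrightarrow> 1 \<le> Re s \<and> Re s \<le> 2 \<and> t0 - 1 \<le> Im s \<and> Im s \<le> t0 + 1" for s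
    by (auto simp: S_def in_cbox_complex_iff)
  have intS: "s \<in> interior S \<longleftrightarrow> 1 < Re s \<and> Re s < 2 \<and> t0 - 1 < Im s \<and> Im s < t0 + 1" for s
    by (auto simp: S_def in_box_complex_iff)
  define K where "K = (C + B * 2 powr A) * 3 ^ m * T powr A"
  have TA: "T powr A \<ge> 1" using T A by (intro ge_one_powr_ge_zero) auto
  have u_le: "norm (u s) \<le> 2" and u_ge: "Re (u s) \<ge> 0" "\<bar>Im (u s)\<bar> \<le> 1" if "s \<in> S" for s
  proof -
    show 1: "Re (u s) \<ge> 0" "\<bar>Im (u s)\<bar> \<le> 1" using that by (auto simp: S u_def)
    have "\<bar>Re (u s)\<bar> \<le> 1" using that by (auto simp: S u_def)
    then show "norm (u s) \<le> 2" using cmod_le[of "u s"] 1 by linarith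
  qed
  have w_le: "norm ((u s)\<^sup>2 + 1) \<le> 3" if "s \<in> S" for s
  proof -
    have "\<bar>Re (u s)\<bar> \<le> 1" "\<bar>Im (u s)\<bar> \<le> 1" using that by (auto simp: S u_def)
    then have "(Re (u s))\<^sup>2 \<le> 1" "(Im (u s))\<^sup>2 \<le> 1" by (auto simp: abs_square_le_1)
    then have "(norm (u s))\<^sup>2 \<le> 2" by (simp add: cmod_power2)
    then show ?thesis using norm_triangle_ineq[of "(u s)\<^sup>2" 1] by (simp add: norm_power)
  qed
  have "norm (g s0) \<le> K"
  proof (rule maximum_modulus_frontier[of g S])
    show "g holomorphic_on interior S"
      unfolding g_def u_def
      by (intro holomorphic_intros holomorphic_on_subset[OF hol]) (auto simp: intS)
    have "closure S = S" by (simp add: S_def)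
    then show "continuous_on (closure S) g"
      unfolding g_def u_def
      by (intro continuous_intros continuous_on_subset[OF cont]) (auto simp: S)
    show "bounded S" by (simp add: S_def)
    show "s0 \<in> S" using s0 by (simp add: S t0_def)
    fix s assume "s \<in> frontier S"
    then have s: "s \<in> S" "s \<notin> interior S" using \<open>closure S = S\<close> by (auto simp: frontier_def)
    have w: "norm ((u s)\<^sup>2 + 1) ^ m \<le> 3 ^ m" using w_le[OF s(1)] by (intro power_mono) auto
    have ng: "norm (g s) = norm (f s) * norm ((u s)\<^sup>2 + 1) ^ m" by (simp add: g_def norm_mult norm_power)
    have "Re s = 1 \<or> Re s = 2 \<or> (1 < Re s \<and> Re s \<le> 2 \<and> \<bar>Im (u s)\<bar> = 1)"
      using s unfolding S intS by (auto simp: u_def)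
    then consider "Re s = 1" | "Re s = 2" | "1 < Re s" "Re s \<le> 2" "\<bar>Im (u s)\<bar> = 1"
      by blast
    then show "norm (g s) \<le> K"
    proof cases
      case 1
      have "norm (f s) \<le> B * (1 + \<bar>Im s\<bar>) powr A" using boundary[of "Im s"] complex_surj[of s] 1 by simp
      also have "\<dots> \<le> B * (2 * T) powr A"
        using s(1) B0 A by (intro mult_left_mono powr_mono2) (auto simp: S T_def)
      also have "\<dots> = B * 2 powr A * T powr A" using T by (simp add: powr_mult)
      also have "\<dots> \<le> (C + B * 2 powr A) * T powr A" using C0 by (intro mult_right_mono) auto
      finally have "norm (g s) \<le> ((C + B * 2 powr A) * T powr A) * 3 ^ m"
        unfolding ng using w C0 B0 by (intro mult_mono) auto
      then show ?thesis by (simp add: K_def mult_ac)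
    next
      case 2
      have "norm (f s) \<le> C * 1" using crude[of s] 2 by simp
      also have "\<dots> \<le> (C + B * 2 powr A) * T powr A" using C0 B0 TA by (intro mult_mono) auto
      finally have "norm (g s) \<le> ((C + B * 2 powr A) * T powr A) * 3 ^ m"
        unfolding ng using w C0 B0 by (intro mult_mono) auto
      then show ?thesis by (simp add: K_def mult_ac)
    next
      case 3
      have R: "Re (u s) = Re s - 1" by (simp add: u_def)
      \<comment> \<open>on a horizontal edge one of the factors \<open>u - i\<close>, \<open>u + i\<close> has norm \<open>Re s - 1\<close>, which cancels the crude bound\<close>
      have "(u s)\<^sup>2 + 1 = (u s - \<i>) * (u s + \<i>)" by (simp add: algebra_simps power2_eq_square)
      then have "norm ((u s)\<^sup>2 + 1) = norm (u s - \<i>) * norm (u s + \<i>)" by (simp add: norm_mult)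
      also have "\<dots> \<le> (Re s - 1) * 3"
      proof -
        have le3: "norm (u s - \<i>) \<le> 3" "norm (u s + \<i>) \<le> 3"
          using norm_triangle_ineq4[of "u s" \<i>] norm_triangle_ineq[of "u s" \<i>] u_le[OF s(1)] by auto
        consider "Im (u s) = 1" | "Im (u s) = -1" using 3(3) by linarith
        then show ?thesis
        proof cases
          case 1
          then have "u s - \<i> = of_real (Re s - 1)" using R by (simp add: complex_eq_iff)
          then have "norm (u s - \<i>) = \<bar>Re s - 1\<bar>" by (simp only: norm_of_real)
          then show ?thesis using le3 3 by (intro mult_mono) auto
        next
          case 2
          then have "u s + \<i> = of_real (Re s - 1)" using R by (simp add: complex_eq_iff)
          then have "norm (u s + \<i>) = \<bar>Re s - 1\<bar>" by (simp only: norm_of_real)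
          then show ?thesis using le3 3 mult_mono[of "norm (u s - \<i>)" 3 "norm (u s + \<i>)" "Re s - 1"]
            by (simp add: mult_ac)
        qed
      qed
      finally have "norm ((u s)\<^sup>2 + 1) ^ m \<le> ((Re s - 1) * 3) ^ m" by (intro power_mono) auto
      then have "norm (g s) \<le> (C / (Re s - 1) ^ m) * ((Re s - 1) * 3) ^ m"
        unfolding ng using crude[OF 3(1,2)] C0 3 by (intro mult_mono) auto
      also have "\<dots> = C * 3 ^ m * 1" unfolding power_mult_distrib using 3 by simp
      also have "\<dots> \<le> (C + B * 2 powr A) * 3 ^ m * T powr A"
        using C0 B0 TA by (intro mult_mono) auto
      finally show ?thesis by (simp add: K_def)
    qed
  qed
  moreover have "norm (f s0) \<le> norm (g s0)"
  proof -
    have "u s0 = of_real (Re s0 - 1)" by (simp add: u_def t0_def complex_eq_iff)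
    then have "(u s0)\<^sup>2 + 1 = of_real ((Re s0 - 1)\<^sup>2 + 1)" by simp
    then have "norm ((u s0)\<^sup>2 + 1) = \<bar>(Re s0 - 1)\<^sup>2 + 1\<bar>" by (simp only: norm_of_real)
    then have "norm ((u s0)\<^sup>2 + 1) ^ m \<ge> 1" by (intro one_le_power) auto
    then show ?thesis using mult_left_mono[of 1 _ "norm (f s0)"] by (simp add: g_def norm_mult norm_power)
  qed
  ultimately have "norm (f s0) \<le> K" by simp
  then show "norm (f s0) \<le> ((C + B * 2 powr A) * 3 ^ m) * (1 + \<bar>Im s0\<bar>) powr A"
    by (simp add: K_def T_def t0_def)
qed

context beurling_system
begin

lemma transformable_N_error: "a \<ge> 0 \<Longrightarrow> transformable (\<lambda>v. N_exp v - primitive (exp_density a) v)"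
  by (intro transformable_diff transformable_N transformable_primitive transformable_exp_density)

lemma zeta_minus_pole_eq_laplace:
  assumes "a \<ge> 0" "Re s > 1"
  shows "zeta_minus_pole N a s = s * laplace (\<lambda>v. N_exp v - primitive (exp_density a) v) s"
  using assms by (simp add: zeta_minus_pole_eq laplace_diff transformable_N transformable_primitive transformable_exp_density)

lemma growth_if_N_log_small:
  assumes a: "a \<ge> 0" and r: "log_small (\<lambda>v. N_exp v - primitive (exp_density a) v)"
  shows "poly_growth 1 (zeta_minus_pole N a)"
proof (rule poly_growth_cong)
  show "poly_growth 1 (\<lambda>s. s * laplace (\<lambda>v. N_exp v - primitive (exp_density a) v) s)"
    using poly_growth_mult[OF poly_growth_ident abelian_growth[OF transformable_N_error[OF a] r]] by simp
qed (simp add: zeta_minus_pole_eq_laplace a)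

lemma N_log_small_if_growth:
  assumes a: "a \<ge> 0" and G: "poly_growth A (zeta_minus_pole N a)"
  shows "log_small (\<lambda>v. N_exp v - primitive (exp_density a) v)"
proof (rule tauberian[OF transformable_N mono_N_exp transformable_exp_density[OF a]])
  show "0 \<le> exp_density a v" "exp_density a v \<le> a * exp v" for v using a by (auto simp: exp_density_def)
  show "poly_growth A (\<lambda>s. s * (laplace N_exp s - laplace (primitive (exp_density a)) s))"
    by (rule poly_growth_cong[OF G]) (simp add: zeta_minus_pole_eq a)
qed

text \<open>On the real axis \<open>zeta(\<sigma>) = a / (\<sigma> - 1) + O(1)\<close>, and \<open>|zeta(s)| \<le> zeta(Re s)\<close>.\<close>

lemma zeta_crude:
  assumes a: "a \<ge> 0" and B: "\<And>\<sigma>. 1 < \<sigma> \<Longrightarrow> \<sigma> \<le> 2 \<Longrightarrow> norm (zeta_minus_pole N a (of_real \<sigma>)) \<le> B"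
  obtains C where "C > 0"
    "\<And>s. 1 < Re s \<Longrightarrow> Re s \<le> 3 \<Longrightarrow> norm (beurling_zeta N s) \<le> C / (Re s - 1)"
    "\<And>s. 1 < Re s \<Longrightarrow> Re s \<le> 3 \<Longrightarrow> norm (zeta_minus_pole N a s) \<le> C / (Re s - 1) ^ 1"
proof -
  define D where "D = a + B + 2 * norm (beurling_zeta N 2)"
  have B0: "B \<ge> 0" using order_trans[OF norm_ge_zero B[of 2]] by simp
  have z: "norm (beurling_zeta N s) \<le> D / (Re s - 1)" if s: "1 < Re s" "Re s \<le> 3" for s
  proof (cases "Re s \<le> 2")
    case True
    have "norm (beurling_zeta N s) \<le> norm (beurling_zeta N (of_real (Re s)))"
      using s by (intro norm_zeta_le) auto
    also have "beurling_zeta N (of_real (Re s)) = zeta_minus_pole N a (of_real (Re s)) + of_real a / (of_real (Re s) - 1)"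
      by (simp add: zeta_minus_pole_def)
    also have "norm \<dots> \<le> B + a / (Re s - 1)"
    proof (rule order_trans[OF norm_triangle_ineq add_mono[OF B]])
      have "of_real a / (of_real (Re s) - 1) = complex_of_real (a / (Re s - 1))" by simp
      then show "norm (of_real a / (of_real (Re s) - 1) :: complex) \<le> a / (Re s - 1)"
        using s a by (simp only: norm_of_real) auto
    qed (use s True in auto)
    also have "\<dots> \<le> B / (Re s - 1) + a / (Re s - 1)"
      using s True B0 divide_left_mono[of "Re s - 1" 1 B] by simp
    also have "\<dots> = (a + B) / (Re s - 1)" by (simp add: add_divide_distrib)
    also have "\<dots> \<le> D / (Re s - 1)" using s by (intro divide_right_mono) (auto simp: D_def)
    finally show ?thesis .
  next
    case False
    have "norm (beurling_zeta N s) \<le> norm (beurling_zeta N (of_real 2))"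
      using False by (intro norm_zeta_le) auto
    also have "\<dots> = (2 * norm (beurling_zeta N 2)) / 2" by simp
    also have "\<dots> \<le> D / (Re s - 1)" using s False a B0 by (intro frac_le) (auto simp: D_def)
    finally show ?thesis .
  qed
  have D0: "D \<ge> 0" using a B0 by (simp add: D_def)
  show ?thesis
  proof (rule that[of "D + a + 1"])
    show "norm (beurling_zeta N s) \<le> (D + a + 1) / (Re s - 1)" if s: "1 < Re s" "Re s \<le> 3" for s
      by (rule order_trans[OF z[OF s]]) (use s a in \<open>auto intro!: divide_right_mono\<close>)
    show "norm (zeta_minus_pole N a s) \<le> (D + a + 1) / (Re s - 1) ^ 1" if s: "1 < Re s" "Re s \<le> 3" for s
    proof -
      have "norm (zeta_minus_pole N a s) \<le> norm (beurling_zeta N s) + norm (of_real a / (s - 1))"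
        unfolding zeta_minus_pole_def by (rule norm_triangle_ineq4)
      also have "norm (of_real a / (s - 1)) = a / norm (s - 1)" using a by (simp add: norm_divide)
      also have "\<dots> \<le> a / (Re s - 1)"
        using s a complex_Re_le_cmod[of "s - 1"] by (intro divide_left_mono mult_pos_pos) auto
      finally have "norm (zeta_minus_pole N a s) \<le> D / (Re s - 1) + a / (Re s - 1)" using z[OF s] by linarith
      also have "\<dots> = (D + a) / (Re s - 1)" by (simp add: add_divide_distrib)
      also have "\<dots> \<le> (D + a + 1) / (Re s - 1)" using s by (intro divide_right_mono) auto
      finally show ?thesis by simp
    qed
  qed (use D0 a in auto)
qed

lemma zeta_crude_if_growth:
  assumes a: "a \<ge> 0" and G: "poly_growth A (zeta_minus_pole N a)"
  obtains C where "C > 0"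
    "\<And>s. 1 < Re s \<Longrightarrow> Re s \<le> 3 \<Longrightarrow> norm (beurling_zeta N s) \<le> C / (Re s - 1)"
    "\<And>s. 1 < Re s \<Longrightarrow> Re s \<le> 3 \<Longrightarrow> norm (zeta_minus_pole N a s) \<le> C / (Re s - 1) ^ 1"
proof -
  obtain B where B: "B > 0" "\<And>s. 1 < Re s \<Longrightarrow> Re s \<le> 2 \<Longrightarrow> norm (zeta_minus_pole N a s) \<le> B * (1 + \<bar>Im s\<bar>) powr A"
    using strip_boundE[OF poly_growthD(3)[OF G]] by metis
  have "norm (zeta_minus_pole N a (of_real \<sigma>)) \<le> B" if "1 < \<sigma>" "\<sigma> \<le> 2" for \<sigma>
    using B(2)[of "of_real \<sigma>"] that by simp
  from zeta_crude[OF a this] show ?thesis using that by blast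
qed

lemma growth_all_eps:
  assumes a: "a \<ge> 0" and G: "poly_growth A (zeta_minus_pole N a)" and eps: "\<epsilon> > 0"
  shows "poly_growth \<epsilon> (zeta_minus_pole N a)"
proof -
  obtain C where "\<And>s. 1 < Re s \<Longrightarrow> Re s \<le> 3 \<Longrightarrow> norm (zeta_minus_pole N a s) \<le> C / (Re s - 1) ^ 1"
    using zeta_crude_if_growth[OF a G] by blast
  from interpolation[OF G this eps] show ?thesis .
qed

text \<open>The derivatives of \<open>s * laplace \<gamma> s\<close> are explicit integrals that still converge for \<open>Re s = 1\<close>.
  The factor \<open>s\<close> gives the exponent 1.\<close>

lemma smooth_extension_if_N_log_small:
  assumes a: "a \<ge> 0" and r: "log_small (\<lambda>v. N_exp v - primitive (exp_density a) v)"
  shows "\<exists>H. smooth_extension (zeta_minus_pole N a) H \<and>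
     (\<exists>\<epsilon>>0. \<forall>n::nat. (\<lambda>t::real. H n (Complex 1 t)) \<in> O[at_infinity](\<lambda>t. of_real (\<bar>t\<bar> powr \<epsilon>)))"
proof -
  define \<gamma> where "\<gamma> = (\<lambda>v. N_exp v - primitive (exp_density a) v)"
  define K where "K = (\<lambda>n. laplace (\<lambda>v. (- v) ^ n * \<gamma> v))"
  define H where "H = (\<lambda>n s. s * K n s + of_nat n * K (n - 1) s)"
  have ok: "transformable \<gamma>" unfolding \<gamma>_def by (rule transformable_N_error[OF a])
  have G: "poly_growth 1 (zeta_minus_pole N a)" by (rule growth_if_N_log_small[OF a r])
  have Kd: "K n s = (deriv ^^ n) (laplace \<gamma>) s" if "Re s > 1" for n s
    unfolding K_def using higher_deriv_laplace[OF ok that] by simp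
  have Hd: "H n s = (deriv ^^ n) (\<lambda>s. s * laplace \<gamma> s) s" if "Re s > 1" for n s
    using that
  proof (induction n arbitrary: s)
    case 0 then show ?case by (simp add: H_def Kd)
  next
    case (Suc n)
    have dK: "(K n has_field_derivative K (Suc n) s) (at s)" for n
    proof (rule has_field_derivative_transform_within_open[OF _ open_half_plane])
      show "((deriv ^^ n) (laplace \<gamma>) has_field_derivative K (Suc n) s) (at s)"
        using has_field_derivative_higher_deriv[OF laplace_holomorphic[OF ok] open_half_plane] Suc.prems
        by (simp add: Kd)
    qed (use Suc.prems Kd in auto)
    have d0: "((\<lambda>s. of_nat n * K (n - 1) s) has_field_derivative of_nat n * K n s) (at s)"
    proof (cases n)
      case (Suc m) then show ?thesis using DERIV_cmult[OF dK[of m]] by simp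
    qed simp
    have "(H n has_field_derivative (s * K (Suc n) s + K n s + of_nat n * K n s)) (at s)"
      unfolding H_def by (rule derivative_eq_intros dK d0 refl | simp)+
    moreover have "s * K (Suc n) s + K n s + of_nat n * K n s = H (Suc n) s" by (simp add: H_def algebra_simps)
    ultimately have "(H n has_field_derivative H (Suc n) s) (at s)" by simp
    then have "((deriv ^^ n) (\<lambda>s. s * laplace \<gamma> s) has_field_derivative H (Suc n) s) (at s)"
      by (rule has_field_derivative_transform_within_open[OF _ open_half_plane]) (use Suc in auto)
    then show ?case by (simp add: DERIV_imp_deriv)
  qed
  have ext: "smooth_extension (zeta_minus_pole N a) H"
    unfolding smooth_extension_def
  proof (intro conjI allI impI)
    show "zeta_minus_pole N a holomorphic_on {s. 1 < Re s}" by (rule zeta_minus_pole_holomorphic)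
    show "continuous_on {s. 1 \<le> Re s} (H n)" for n
      unfolding H_def K_def
      by (intro continuous_intros laplace_continuous_closed ok r[folded \<gamma>_def])
    show "H n s = (deriv ^^ n) (zeta_minus_pole N a) s" if "1 < Re s" for n s
      unfolding Hd[OF that]
      by (rule higher_deriv_half_plane_cong[OF _ that]) (simp add: zeta_minus_pole_eq_laplace a \<gamma>_def)
  qed
  have "(\<lambda>t::real. H n (Complex 1 t)) \<in> O[at_infinity](\<lambda>t. of_real (\<bar>t\<bar> powr 1))" for n
  proof -
    obtain C1 C2 where C1: "\<And>s. Re s \<ge> 1 \<Longrightarrow> norm (K n s) \<le> C1" and C2: "\<And>s. Re s \<ge> 1 \<Longrightarrow> norm (K (n - 1) s) \<le> C2"
      using abelian_bound[OF ok r[folded \<gamma>_def], of n] abelian_bound[OF ok r[folded \<gamma>_def], of "n - 1"] unfolding K_def by metis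
    have C0: "C1 \<ge> 0" "C2 \<ge> 0" using order_trans[OF norm_ge_zero C1[of 1]] order_trans[OF norm_ge_zero C2[of 1]] by auto
    show ?thesis
    proof (rule bigoI[of _ "2 * C1 + real n * C2"])
      show "\<forall>\<^sub>F t in at_infinity. norm (H n (Complex 1 t)) \<le> (2 * C1 + real n * C2) * norm (of_real (\<bar>t\<bar> powr 1) :: complex)"
        unfolding eventually_at_infinity
      proof (intro exI[of _ 1] allI impI)
        fix t :: real assume t: "norm t \<ge> 1"
        have "norm (H n (Complex 1 t)) \<le> norm (Complex 1 t) * norm (K n (Complex 1 t)) + real n * norm (K (n - 1) (Complex 1 t))"
          unfolding H_def by (rule order_trans[OF norm_triangle_ineq]) (simp add: norm_mult)
        also have "\<dots> \<le> (2 * \<bar>t\<bar>) * C1 + real n * C2 * \<bar>t\<bar>"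
        proof (rule add_mono)
          have "norm (Complex 1 t) \<le> 2 * \<bar>t\<bar>" using cmod_le[of "Complex 1 t"] t by simp
          then show "norm (Complex 1 t) * norm (K n (Complex 1 t)) \<le> 2 * \<bar>t\<bar> * C1"
            using C1[of "Complex 1 t"] by (intro mult_mono) auto
          have "real n * norm (K (n - 1) (Complex 1 t)) \<le> real n * C2 * 1"
            using C2[of "Complex 1 t"] by (simp add: mult_left_mono)
          also have "\<dots> \<le> real n * C2 * \<bar>t\<bar>" using t C0 by (intro mult_left_mono) auto
          finally show "real n * norm (K (n - 1) (Complex 1 t)) \<le> real n * C2 * \<bar>t\<bar>" .
        qed
        also have "\<dots> = (2 * C1 + real n * C2) * norm (of_real (\<bar>t\<bar> powr 1) :: complex)"
          using t by (simp add: powr_one algebra_simps)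
        finally show "norm (H n (Complex 1 t)) \<le> (2 * C1 + real n * C2) * norm (of_real (\<bar>t\<bar> powr 1) :: complex)" .
      qed
    qed
  qed
  then have "\<exists>\<epsilon>>0. \<forall>n::nat. (\<lambda>t::real. H n (Complex 1 t)) \<in> O[at_infinity](\<lambda>t. of_real (\<bar>t\<bar> powr \<epsilon>))"
    by (intro exI[of _ 1]) auto
  then show ?thesis using ext by blast
qed

text \<open>Cauchy's estimate supplies the crude bound \<open>O((\<sigma> - 1) ^ (- n - 1))\<close> for the \<open>n\<close>-th derivative,
  to which \<open>strip_bound_from_boundary\<close> adds the information on the line \<open>Re s = 1\<close>.\<close>

lemma growth_if_smooth_extension:
  assumes a: "a \<ge> 0" and H: "smooth_extension (zeta_minus_pole N a) H" and eps: "\<epsilon> > 0"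
    and O: "\<And>n. (\<lambda>t::real. H n (Complex 1 t)) \<in> O[at_infinity](\<lambda>t. of_real (\<bar>t\<bar> powr \<epsilon>))"
  shows "poly_growth \<epsilon> (zeta_minus_pole N a)"
  unfolding poly_growth_def
proof (intro conjI allI zeta_minus_pole_holomorphic)
  fix n
  have Hc: "continuous_on {s. Re s \<ge> 1} (H k)" and Hd: "Re s > 1 \<Longrightarrow> H k s = (deriv ^^ k) (zeta_minus_pole N a) s" for k s
    using H unfolding smooth_extension_def by auto
  obtain B0 where B0: "\<And>\<sigma>. 1 < \<sigma> \<Longrightarrow> \<sigma> \<le> 2 \<Longrightarrow> norm (zeta_minus_pole N a (of_real \<sigma>)) \<le> B0"
  proof -
    have "compact ((\<lambda>\<sigma>. H 0 (of_real \<sigma>)) ` {1..2})"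
      by (intro compact_continuous_image compact_Icc continuous_on_compose2[OF Hc] continuous_intros) auto
    then obtain B where B: "\<forall>\<sigma>\<in>{1..2}. norm (H 0 (of_real \<sigma>)) \<le> B"
      by (auto dest!: compact_imp_bounded simp: bounded_iff)
    have "norm (zeta_minus_pole N a (of_real \<sigma>)) \<le> B" if "1 < \<sigma>" "\<sigma> \<le> 2" for \<sigma>
      using bspec[OF B, of \<sigma>] Hd[of "of_real \<sigma>" 0] that by simp
    then show ?thesis by (rule that)
  qed
  obtain C where C: "\<And>s. 1 < Re s \<Longrightarrow> Re s \<le> 3 \<Longrightarrow> norm (zeta_minus_pole N a s) \<le> C / (Re s - 1) ^ 1"
    using zeta_crude[OF a B0] by metis
  obtain B where B: "\<And>t. norm (H n (Complex 1 t)) \<le> B * (1 + \<bar>t\<bar>) powr \<epsilon>"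
  proof -
    obtain c where c: "c > 0" "\<forall>\<^sub>F t in at_infinity. norm (H n (Complex 1 t)) \<le> c * norm (of_real (\<bar>t\<bar> powr \<epsilon>) :: complex)"
      using O landau_o.bigE by blast
    obtain b where b: "\<And>t. norm t \<ge> b \<Longrightarrow> norm (H n (Complex 1 t)) \<le> c * norm (of_real (\<bar>t\<bar> powr \<epsilon>) :: complex)"
      using c(2) unfolding eventually_at_infinity by blast
    have "continuous_on {-\<bar>b\<bar>..\<bar>b\<bar>} (\<lambda>t. Complex 1 t)" unfolding Complex_eq by (intro continuous_intros)
    then have "compact ((\<lambda>t. H n (Complex 1 t)) ` {-\<bar>b\<bar>..\<bar>b\<bar>})"
      by (intro compact_continuous_image compact_Icc continuous_on_compose2[OF Hc]) auto
    then obtain B where B: "\<forall>t\<in>{-\<bar>b\<bar>..\<bar>b\<bar>}. norm (H n (Complex 1 t)) \<le> B"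
      by (auto dest!: compact_imp_bounded simp: bounded_iff)
    have Bpos: "B \<ge> 0" using order_trans[OF norm_ge_zero bspec[OF B, of 0]] by simp
    have "norm (H n (Complex 1 t)) \<le> (c + B) * (1 + \<bar>t\<bar>) powr \<epsilon>" for t
    proof (cases "\<bar>t\<bar> \<le> \<bar>b\<bar>")
      case True
      have "norm (H n (Complex 1 t)) \<le> B * 1" using bspec[OF B, of t] True by (simp add: abs_le_iff)
      also have "\<dots> \<le> (c + B) * (1 + \<bar>t\<bar>) powr \<epsilon>"
        using Bpos c(1) eps by (intro mult_mono ge_one_powr_ge_zero) auto
      finally show ?thesis .
    next
      case False
      then have "norm (H n (Complex 1 t)) \<le> c * \<bar>t\<bar> powr \<epsilon>" using b[of t] by simp
      also have "\<dots> \<le> (c + B) * (1 + \<bar>t\<bar>) powr \<epsilon>"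
        using Bpos c(1) eps by (intro mult_mono powr_mono2) auto
      finally show ?thesis .
    qed
    then show ?thesis by (rule that)
  qed
  have "strip_bound \<epsilon> (H n)"
  proof (rule strip_bound_from_boundary[OF Hc _ _ B])
    show "H n holomorphic_on half_plane"
      by (rule holomorphic_transform[OF holomorphic_higher_deriv[OF zeta_minus_pole_holomorphic open_half_plane, of n]])
         (use Hd in auto)
    show "norm (H n s) \<le> (fact n * C * 2 ^ (1 + n)) / (Re s - 1) ^ (1 + n)" if "1 < Re s" "Re s \<le> 2" for s
      using Cauchy_near_axis[OF zeta_minus_pole_holomorphic C that, of n] Hd that by auto
  qed (use eps in auto)
  then show "strip_bound \<epsilon> ((deriv ^^ n) (zeta_minus_pole N a))"
    by (rule strip_bound_cong) (use Hd in auto)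
qed

text \<open>To the right of the strip everything is bounded, again by Cauchy's estimate.\<close>

lemma global_growth_if_growth:
  assumes a: "a \<ge> 0" and G: "poly_growth \<epsilon> (zeta_minus_pole N a)" and eps: "\<epsilon> > 0"
  shows "\<exists>C. \<forall>\<sigma>>1. \<forall>t. norm ((deriv ^^ n) (zeta_minus_pole N a) (Complex \<sigma> t)) \<le> C * (1 + \<bar>t\<bar>) powr \<epsilon>"
proof -
  obtain C where C: "C > 0" "\<And>s. 1 < Re s \<Longrightarrow> Re s \<le> 2 \<Longrightarrow>
      norm ((deriv ^^ n) (zeta_minus_pole N a) s) \<le> C * (1 + \<bar>Im s\<bar>) powr \<epsilon>"
    using strip_boundE[OF poly_growthD(2)[OF G]] by metis
  define B where "B = norm (beurling_zeta N (of_real (3 / 2))) + 2 * a"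
  have far: "norm ((deriv ^^ n) (zeta_minus_pole N a) s) \<le> fact n * B / (1 / 2) ^ n" if s: "Re s > 2" for s
  proof (rule Cauchy_inequality)
    have Re: "Re w \<ge> 3 / 2" if "dist s w \<le> 1 / 2" for w
      using abs_Re_le_cmod[of "s - w"] that s by (simp add: dist_norm)
    then have sub: "cball s (1 / 2) \<subseteq> half_plane" by force
    show "zeta_minus_pole N a holomorphic_on ball s (1 / 2)"
      using holomorphic_on_subset[OF zeta_minus_pole_holomorphic] sub ball_subset_cball by blast
    show "continuous_on (cball s (1 / 2)) (zeta_minus_pole N a)"
      using holomorphic_on_imp_continuous_on[OF holomorphic_on_subset[OF zeta_minus_pole_holomorphic sub]] .
    fix w assume "norm (s - w) = 1 / 2"
    then have w: "Re w \<ge> 3 / 2" using Re[of w] by (simp add: dist_norm)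
    have "norm (of_real a / (w - 1)) = a / norm (w - 1)" using a by (simp add: norm_divide)
    also have "\<dots> \<le> a / (1 / 2)"
      using w a complex_Re_le_cmod[of "w - 1"] by (intro divide_left_mono mult_pos_pos) auto
    finally have "norm (of_real a / (w - 1)) \<le> 2 * a" by simp
    moreover have "norm (beurling_zeta N w) \<le> norm (beurling_zeta N (of_real (3 / 2)))"
      using w by (intro norm_zeta_le) auto
    ultimately show "norm (zeta_minus_pole N a w) \<le> B"
      unfolding zeta_minus_pole_def B_def by (intro order_trans[OF norm_triangle_ineq4] add_mono)
  qed simp
  define D where "D = fact n * B / (1 / 2) ^ n"
  have D0: "D \<ge> 0" using a by (simp add: D_def B_def)
  have "norm ((deriv ^^ n) (zeta_minus_pole N a) (Complex \<sigma> t)) \<le> (C + D) * (1 + \<bar>t\<bar>) powr \<epsilon>" if "\<sigma> > 1" for \<sigma> t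
  proof (cases "\<sigma> \<le> 2")
    case True
    then have "norm ((deriv ^^ n) (zeta_minus_pole N a) (Complex \<sigma> t)) \<le> C * (1 + \<bar>t\<bar>) powr \<epsilon>"
      using C(2)[of "Complex \<sigma> t"] that by simp
    also have "\<dots> \<le> (C + D) * (1 + \<bar>t\<bar>) powr \<epsilon>" using D0 by (intro mult_right_mono) auto
    finally show ?thesis .
  next
    case False
    then have "norm ((deriv ^^ n) (zeta_minus_pole N a) (Complex \<sigma> t)) \<le> D * 1"
      using far[of "Complex \<sigma> t"] by (simp add: D_def)
    also have "\<dots> \<le> (C + D) * (1 + \<bar>t\<bar>) powr \<epsilon>"
      using D0 C(1) eps by (intro mult_mono ge_one_powr_ge_zero) auto
    finally show ?thesis .
  qed
  then show ?thesis by blast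
qed

lemma growth_if_global_growth:
  assumes "\<And>n. \<exists>C. \<forall>\<sigma>>1. \<forall>t. norm ((deriv ^^ n) (zeta_minus_pole N a) (Complex \<sigma> t)) \<le> C * (1 + \<bar>t\<bar>) powr \<epsilon>"
  shows "poly_growth \<epsilon> (zeta_minus_pole N a)"
  unfolding poly_growth_def
proof (intro conjI allI zeta_minus_pole_holomorphic)
  fix n
  obtain C where C: "\<And>\<sigma> t. \<sigma> > 1 \<Longrightarrow> norm ((deriv ^^ n) (zeta_minus_pole N a) (Complex \<sigma> t)) \<le> C * (1 + \<bar>t\<bar>) powr \<epsilon>"
    using assms[of n] by blast
  show "strip_bound \<epsilon> ((deriv ^^ n) (zeta_minus_pole N a))"
    by (rule strip_boundI[of _ C]) (use C in \<open>metis complex_surj\<close>)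
qed

end

section \<open>The integers and the primes\<close>

lemma poly_growth_from_deriv:
  assumes F: "F holomorphic_on half_plane" "strip_bound A F" and d: "poly_growth A (deriv F)"
  shows "poly_growth A F"
  unfolding poly_growth_def
proof (intro conjI allI F(1))
  fix n
  show "strip_bound A ((deriv ^^ n) F)"
  proof (cases n)
    case (Suc m)
    have "(deriv ^^ n) F = (deriv ^^ m) (deriv F)" by (simp only: Suc funpow_Suc_right comp_apply)
    then show ?thesis using poly_growthD(2)[OF d] by simp
  qed (simp add: F(2))
qed

lemma horizontal_variation:
  assumes F: "F holomorphic_on half_plane"
    and D: "\<And>w. 1 < Re w \<Longrightarrow> Re w \<le> 2 \<Longrightarrow> Im w = t \<Longrightarrow> norm (deriv F w) \<le> M"
    and x: "1 < x" "x \<le> y" "y \<le> 2"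
  shows "norm (F (Complex x t) - F (Complex y t)) \<le> M * (y - x)"
proof -
  have "norm (F (Complex x t) - F (Complex y t)) \<le> M * norm (Complex x t - Complex y t)"
  proof (rule field_differentiable_bound[of "closed_segment (Complex x t) (Complex y t)"])
    fix w assume "w \<in> closed_segment (Complex x t) (Complex y t)"
    then have w: "Re w \<in> {x..y}" "Im w = t"
      using x by (auto simp: closed_segment_same_Im closed_segment_eq_real_ivl)
    then have w': "1 < Re w" "Re w \<le> 2" using x by auto
    show "norm (deriv F w) \<le> M" by (rule D[OF w' w(2)])
    show "(F has_field_derivative deriv F w) (at w within closed_segment (Complex x t) (Complex y t))"
      using holomorphic_derivI[OF F open_half_plane] w' by (blast intro: has_field_derivative_at_within)
  qed auto
  also have "norm (Complex x t - Complex y t) = y - x" using x by (simp add: cmod_def)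
  finally show ?thesis .
qed

context beurling_system
begin

text \<open>Dividing by \<open>s / (s - 1)\<close>, the zeta function of the continuous system with prime density
  \<open>li_density\<close>, removes the pole without introducing growth.\<close>

definition zeta_ratio :: "complex \<Rightarrow> complex" where
  "zeta_ratio s = (s - 1) / s * beurling_zeta N s"

definition log_ratio :: "complex \<Rightarrow> complex" where
  "log_ratio s = log_zeta s - laplace li_density s"

lemma zeta_ratio_holomorphic: "zeta_ratio holomorphic_on half_plane"
  unfolding zeta_ratio_def[abs_def] by (intro holomorphic_intros zeta_holomorphic) auto

lemma log_zeta_holomorphic: "log_zeta holomorphic_on half_plane"
proof (rule holomorphic_transform)
  show "(\<lambda>s. s * laplace P_exp s) holomorphic_on half_plane"
    by (intro holomorphic_intros laplace_holomorphic transformable_P)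
qed (simp add: log_zeta_eq_laplace)

lemma log_ratio_holomorphic: "log_ratio holomorphic_on half_plane"
  unfolding log_ratio_def[abs_def]
  by (intro holomorphic_intros log_zeta_holomorphic laplace_holomorphic transformable_li_density)

lemma zeta_ratio_nz: "Re s > 1 \<Longrightarrow> zeta_ratio s \<noteq> 0"
  by (auto simp: zeta_ratio_def zeta_eq_exp)

lemma zeta_ratio_eq_exp:
  obtains \<kappa> :: real where "\<kappa> > 0" "\<And>s. Re s > 1 \<Longrightarrow> exp (laplace li_density s) = of_real \<kappa> * s / (s - 1)"
    "\<And>s. Re s > 1 \<Longrightarrow> zeta_ratio s = of_real \<kappa> * exp (log_ratio s)"
proof -
  obtain \<kappa> :: real where \<kappa>: "\<kappa> > 0" "\<And>s. Re s > 1 \<Longrightarrow> exp (laplace li_density s) = of_real \<kappa> * s / (s - 1)"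
    using exp_laplace_li_density by blast
  have "zeta_ratio s = of_real \<kappa> * exp (log_ratio s)" if s: "Re s > 1" for s
  proof -
    have "s \<noteq> 0" "s - 1 \<noteq> 0" using s by auto
    then show ?thesis
      using \<kappa> s by (simp add: zeta_ratio_def log_ratio_def zeta_eq_exp exp_diff)
  qed
  then show ?thesis using \<kappa> that by blast
qed

lemma log_ratio_deriv:
  assumes s: "Re s > 1" shows "deriv zeta_ratio s = zeta_ratio s * deriv log_ratio s"
proof -
  obtain \<kappa> :: real where \<kappa>: "\<And>s. Re s > 1 \<Longrightarrow> zeta_ratio s = of_real \<kappa> * exp (log_ratio s)"
    using zeta_ratio_eq_exp by metis
  have "(log_ratio has_field_derivative deriv log_ratio s) (at s)"
    using holomorphic_derivI[OF log_ratio_holomorphic open_half_plane] s by simp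
  then have "((\<lambda>s. of_real \<kappa> * exp (log_ratio s)) has_field_derivative
      (of_real \<kappa> * exp (log_ratio s)) * deriv log_ratio s) (at s)"
    by (auto intro!: derivative_eq_intros)
  then have "(zeta_ratio has_field_derivative (of_real \<kappa> * exp (log_ratio s)) * deriv log_ratio s) (at s)"
    by (rule has_field_derivative_transform_within_open[OF _ open_half_plane]) (use s \<kappa> in auto)
  then show ?thesis using \<kappa>[OF s] by (simp add: DERIV_imp_deriv)
qed

lemma log_ratio_eq_laplace:
  assumes "Re s > 1"
  shows "log_ratio s = s * (laplace P_exp s - laplace (primitive li_density) s)"
proof -
  have "s \<noteq> 0" using assms by auto
  then show ?thesis
    using assms by (simp add: log_ratio_def log_zeta_eq_laplace laplace_primitive transformable_li_density right_diff_distrib)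
qed

lemma P_log_small_if_growth:
  assumes "poly_growth A log_ratio"
  shows "log_small (\<lambda>v. P_exp v - primitive li_density v)"
proof (rule tauberian[OF transformable_P mono_P_exp transformable_li_density li_density_bounds])
  show "poly_growth A (\<lambda>s. s * (laplace P_exp s - laplace (primitive li_density) s))"
    by (rule poly_growth_cong[OF assms]) (simp add: log_ratio_eq_laplace)
qed

lemma zeta_ratio_growth:
  assumes a: "a \<ge> 0" and G: "poly_growth \<epsilon> (zeta_minus_pole N a)" and eps: "\<epsilon> > 0"
  shows "poly_growth \<epsilon> zeta_ratio"
proof (rule poly_growth_cong)
  have inv: "poly_growth 0 (\<lambda>s. 1 / s)" by (rule poly_growth_mono[OF poly_growth_inverse]) auto
  have "poly_growth (0 + \<epsilon>) (\<lambda>s. (1 - 1 / s) * zeta_minus_pole N a s)"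
    by (intro poly_growth_mult poly_growth_diff poly_growth_const inv G) auto
  moreover have "poly_growth \<epsilon> (\<lambda>s. of_real a * (1 / s))"
    using eps by (intro poly_growth_cmult poly_growth_mono[OF inv]) auto
  ultimately show "poly_growth \<epsilon> (\<lambda>s. (1 - 1 / s) * zeta_minus_pole N a s + of_real a * (1 / s))"
    by (intro poly_growth_add) auto
  fix s :: complex assume "Re s > 1"
  then have "s \<noteq> 0" "s - 1 \<noteq> 0" by auto
  then show "(1 - 1 / s) * zeta_minus_pole N a s + of_real a * (1 / s) = zeta_ratio s"
    by (simp add: zeta_ratio_def zeta_minus_pole_def field_simps)
qed

text \<open>The 3-4-1 inequality bounds \<open>Z = zeta_ratio\<close> from below by \<open>q \<theta>\<^sup>3 T ^ (- \<delta>)\<close> on the line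
  \<open>\<sigma> = 1 + \<theta> ^ 4\<close>, while \<open>Z\<close> varies by at most \<open>O(\<theta> ^ 4 T ^ \<delta>)\<close> to the left of it. For \<open>\<theta>\<close> a small
  multiple of \<open>T ^ (- 2 \<delta>)\<close> the variation is at most half of the lower bound. Altogether the loss
  is \<open>T ^ (- 7 \<delta>)\<close>.\<close>

lemma zeta_ratio_lower_far:
  assumes a: "a \<ge> 0" and G: "\<And>\<epsilon>. \<epsilon> > 0 \<Longrightarrow> poly_growth \<epsilon> (zeta_minus_pole N a)"
    and \<tau>: "\<tau> > 0" and eps: "\<epsilon> > 0"
  obtains c where "c > 0" "\<And>s. 1 < Re s \<Longrightarrow> Re s \<le> 2 \<Longrightarrow> \<bar>Im s\<bar> \<ge> \<tau> \<Longrightarrow>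
     norm (zeta_ratio s) \<ge> c * (1 + \<bar>Im s\<bar>) powr (- \<epsilon>)"
proof -
  define \<delta> where "\<delta> = \<epsilon> / 7"
  have \<delta>: "\<delta> > 0" using eps by (simp add: \<delta>_def)
  note Z = zeta_ratio_growth[OF a G[OF \<delta>] \<delta>]
  obtain C1 where C1: "C1 > 0" "\<And>s. 1 < Re s \<Longrightarrow> Re s \<le> 2 \<Longrightarrow> norm (zeta_ratio s) \<le> C1 * (1 + \<bar>Im s\<bar>) powr \<delta>"
    using strip_boundE[OF poly_growthD(3)[OF Z]] by metis
  obtain C2 where C2: "C2 > 0" "\<And>s. 1 < Re s \<Longrightarrow> Re s \<le> 2 \<Longrightarrow> norm (deriv zeta_ratio s) \<le> C2 * (1 + \<bar>Im s\<bar>) powr \<delta>"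
    using strip_boundE[OF poly_growthD(3)[OF poly_growth_deriv[OF Z]]] by metis
  obtain C3 where C3: "C3 > 0" "\<And>s. 1 < Re s \<Longrightarrow> Re s \<le> 3 \<Longrightarrow> norm (beurling_zeta N s) \<le> C3 / (Re s - 1)"
    using zeta_crude_if_growth[OF a G[OF \<delta>]] by metis
  define \<kappa> where "\<kappa> = 1 + 1 / \<tau>"
  have \<kappa>: "\<kappa> > 0" using \<tau> by (simp add: \<kappa>_def add_pos_pos)
  have zeta_le: "norm (beurling_zeta N s) \<le> \<kappa> * norm (zeta_ratio s)" if "1 < Re s" "\<bar>Im s\<bar> \<ge> \<tau>" for s
  proof -
    have nz: "s \<noteq> 0" "s - 1 \<noteq> 0" using that by auto
    have "\<tau> \<le> norm (s - 1)" using abs_Im_le_cmod[of "s - 1"] that by simp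
    then have "1 / norm (s - 1) \<le> 1 / \<tau>" using \<tau> nz by (intro divide_left_mono mult_pos_pos) auto
    moreover have "norm s \<le> norm (s - 1) + 1" using norm_triangle_ineq[of "s - 1" 1] by simp
    then have "norm s / norm (s - 1) \<le> 1 + 1 / norm (s - 1)" using nz by (simp add: field_simps)
    ultimately have "norm s / norm (s - 1) \<le> \<kappa>" by (simp add: \<kappa>_def)
    moreover have "beurling_zeta N s = s / (s - 1) * zeta_ratio s" using nz by (simp add: zeta_ratio_def)
    ultimately show ?thesis by (simp add: norm_mult norm_divide mult_right_mono flip: times_divide_eq_left)
  qed
  \<comment> \<open>3-4-1 gives \<open>|zeta_ratio s| ^ 4 \<ge> Q (\<sigma> - 1)\<^sup>3 T ^ (- \<delta>)\<close>; the fourth root is convenient to take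
    when \<open>\<sigma> - 1\<close> is itself a fourth power\<close>
  define Q where "Q = 1 / (\<kappa> ^ 4 * (C3 ^ 3 * (\<kappa> * (C1 * 2 powr \<delta>))))"
  have Q: "Q > 0" using \<kappa> C1(1) C3(1) by (simp add: Q_def)
  define q where "q = root 4 Q"
  have q: "q > 0" "q ^ 4 = Q" using Q by (auto simp: q_def)
  have low: "norm (zeta_ratio s) \<ge> q * \<theta> ^ 3 * (1 + \<bar>Im s\<bar>) powr (- \<delta>)"
    if s: "1 < Re s" "Re s \<le> 2" "\<bar>Im s\<bar> \<ge> \<tau>" and \<theta>: "\<theta> > 0" "\<theta> ^ 4 \<le> Re s - 1" for s \<theta>
  proof -
    define T where "T = 1 + \<bar>Im s\<bar>"
    have T: "T \<ge> 1" by (simp add: T_def)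
    define s2 where "s2 = Complex (Re s) (2 * Im s)"
    have "norm (zeta_ratio s2) \<le> C1 * (1 + \<bar>2 * Im s\<bar>) powr \<delta>" using C1(2)[of s2] s by (simp add: s2_def)
    also have "\<dots> \<le> C1 * (2 * T) powr \<delta>" using C1(1) \<delta> by (intro mult_left_mono powr_mono2) (auto simp: T_def)
    also have "\<dots> = C1 * 2 powr \<delta> * T powr \<delta>" using T by (simp add: powr_mult)
    finally have Z2: "norm (zeta_ratio s2) \<le> C1 * 2 powr \<delta> * T powr \<delta>" .
    have z2: "norm (beurling_zeta N s2) \<le> \<kappa> * (C1 * 2 powr \<delta> * T powr \<delta>)"
      by (rule order_trans[OF zeta_le mult_left_mono[OF Z2]]) (use s \<tau> \<kappa> in \<open>auto simp: s2_def\<close>)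
    have z1: "norm (beurling_zeta N s) ^ 4 \<le> (\<kappa> * norm (zeta_ratio s)) ^ 4"
      using s by (intro power_mono zeta_le) auto
    have z0: "norm (beurling_zeta N (of_real (Re s))) ^ 3 \<le> (C3 / \<theta> ^ 4) ^ 3"
    proof (rule power_mono)
      have "norm (beurling_zeta N (of_real (Re s))) \<le> C3 / (Re s - 1)" using C3(2)[of "of_real (Re s)"] s by simp
      also have "\<dots> \<le> C3 / \<theta> ^ 4" using \<theta> C3(1) s by (intro divide_left_mono mult_pos_pos) auto
      finally show "norm (beurling_zeta N (of_real (Re s))) \<le> C3 / \<theta> ^ 4" .
    qed simp
    have "1 \<le> norm (beurling_zeta N (of_real (Re s))) ^ 3 * norm (beurling_zeta N s) ^ 4 * norm (beurling_zeta N s2)"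
      using zeta_3_4_1[OF s(1), of "Im s"] by (simp add: s2_def)
    also have "\<dots> \<le> (C3 / \<theta> ^ 4) ^ 3 * (\<kappa> * norm (zeta_ratio s)) ^ 4 * (\<kappa> * (C1 * 2 powr \<delta> * T powr \<delta>))"
      using C3(1) \<theta> by (intro mult_mono z0 z1 z2) auto
    also have "\<dots> = (\<kappa> ^ 4 * (C3 ^ 3 * (\<kappa> * (C1 * 2 powr \<delta>)))) * (norm (zeta_ratio s) ^ 4 * T powr \<delta>) / (\<theta> ^ 4) ^ 3"
      by (simp add: power_divide power_mult_distrib)
    also have "\<dots> = (norm (zeta_ratio s) ^ 4 * T powr \<delta>) / (Q * (\<theta> ^ 4) ^ 3)"
      by (simp add: Q_def)
    finally have "Q * (\<theta> ^ 4) ^ 3 \<le> norm (zeta_ratio s) ^ 4 * T powr \<delta>"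
      using Q \<theta> by (simp add: field_simps)
    then have "Q * (\<theta> ^ 4) ^ 3 * T powr (- \<delta>) \<le> norm (zeta_ratio s) ^ 4 * T powr \<delta> * T powr (- \<delta>)"
      by (rule mult_right_mono) simp
    also have "\<dots> = norm (zeta_ratio s) ^ 4" using T by (simp add: mult.assoc flip: powr_add)
    finally have 1: "Q * (\<theta> ^ 4) ^ 3 * T powr (- \<delta>) \<le> norm (zeta_ratio s) ^ 4" .
    have "(T powr (- \<delta>)) ^ 4 \<le> T powr (- \<delta>)"
      using power_decreasing[of 1 4 "T powr (- \<delta>)"] powr_mono[of "- \<delta>" 0 T] T \<delta> by simp
    then have "Q * (\<theta> ^ 4) ^ 3 * (T powr (- \<delta>)) ^ 4 \<le> Q * (\<theta> ^ 4) ^ 3 * T powr (- \<delta>)"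
      using Q \<theta> by (intro mult_left_mono) auto
    moreover have "(q * \<theta> ^ 3 * T powr (- \<delta>)) ^ 4 = Q * (\<theta> ^ 4) ^ 3 * (T powr (- \<delta>)) ^ 4"
      by (simp add: power_mult_distrib q(2) flip: power_mult)
    ultimately have "(q * \<theta> ^ 3 * T powr (- \<delta>)) ^ 4 \<le> norm (zeta_ratio s) ^ 4" using 1 by linarith
    then have "q * \<theta> ^ 3 * T powr (- \<delta>) \<le> norm (zeta_ratio s)"
      by (subst (asm) power_mono_iff) (use q \<theta> in auto)
    then show ?thesis by (simp add: T_def)
  qed
  define \<mu> where "\<mu> = min 1 (q / (2 * C2))"
  have \<mu>: "\<mu> > 0" "\<mu> \<le> 1" "\<mu> \<le> q / (2 * C2)" using q C2(1) by (auto simp: \<mu>_def)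
  show ?thesis
  proof (rule that[of "q / 2 * \<mu> ^ 3"])
    show "q / 2 * \<mu> ^ 3 > 0" using q \<mu> by simp
    fix s assume s: "1 < Re s" "Re s \<le> 2" "\<bar>Im s\<bar> \<ge> \<tau>"
    define T where "T = 1 + \<bar>Im s\<bar>"
    have T: "T \<ge> 1" by (simp add: T_def)
    define X where "X = T powr (- \<delta>)"
    have X: "X > 0" "X \<le> 1" using T \<delta> powr_mono[of "- \<delta>" 0 T] by (auto simp: X_def)
    have XT: "X * T powr \<delta> = 1" using T by (simp add: X_def flip: powr_add)
    define \<theta> where "\<theta> = \<mu> * X\<^sup>2"
    have X2: "X\<^sup>2 \<le> 1" using X by (simp add: power_le_one)
    have \<theta>: "\<theta> > 0" "\<theta> \<le> 1" using \<mu> X X2 mult_mono[of \<mu> 1 "X\<^sup>2" 1] by (auto simp: \<theta>_def)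
    have \<theta>4: "\<theta> ^ 4 > 0" "\<theta> ^ 4 \<le> 1" using \<theta> by (auto simp: power_le_one)
    have target: "q / 2 * \<mu> ^ 3 * (1 + \<bar>Im s\<bar>) powr (- \<epsilon>) = q / 2 * \<theta> ^ 3 * X"
    proof -
      have "T powr (- \<epsilon>) = T powr (real 7 * (- \<delta>))" by (simp add: \<delta>_def)
      also have "\<dots> = X ^ 7" using T X(1) by (simp add: X_def powr_powr mult.commute flip: powr_realpow)
      finally show ?thesis by (simp add: \<theta>_def T_def power_mult_distrib flip: power_mult power_Suc2 power_add) 
    qed
    show "norm (zeta_ratio s) \<ge> q / 2 * \<mu> ^ 3 * (1 + \<bar>Im s\<bar>) powr (- \<epsilon>)"
    proof (cases "\<theta> ^ 4 \<le> Re s - 1")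
      case True
      have "q / 2 * \<theta> ^ 3 * X \<le> q * \<theta> ^ 3 * X"
        using q X \<theta> by (intro mult_right_mono) auto
      also have "\<dots> \<le> norm (zeta_ratio s)" using low[OF s \<theta>(1) True] by (simp add: X_def T_def)
      finally show ?thesis unfolding target .
    next
      case False
      define w where "w = Complex (1 + \<theta> ^ 4) (Im s)"
      have w: "norm (zeta_ratio w) \<ge> q * \<theta> ^ 3 * X"
        using low[of w \<theta>] s \<theta> \<theta>4 by (simp add: w_def X_def T_def)
      have "norm (zeta_ratio (Complex (Re s) (Im s)) - zeta_ratio (Complex (1 + \<theta> ^ 4) (Im s)))
          \<le> C2 * T powr \<delta> * (1 + \<theta> ^ 4 - Re s)"
      proof (rule horizontal_variation[OF zeta_ratio_holomorphic])
        show "norm (deriv zeta_ratio w) \<le> C2 * T powr \<delta>" if "1 < Re w" "Re w \<le> 2" "Im w = Im s" for w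
          using C2(2)[of w] that by (simp add: T_def)
      qed (use s False \<theta>4 in auto)
      also have "\<dots> \<le> C2 * T powr \<delta> * \<theta> ^ 4"
        using s C2(1) by (intro mult_left_mono) auto
      also have "\<dots> = (C2 * \<theta>) * T powr \<delta> * \<theta> ^ 3" by (simp add: power4_eq_xxxx power3_eq_cube)
      also have "\<dots> \<le> (q / 2 * X\<^sup>2) * T powr \<delta> * \<theta> ^ 3"
      proof (intro mult_right_mono)
        have "C2 * \<mu> \<le> q / 2" using \<mu>(3) C2(1) by (simp add: field_simps)
        then have "C2 * \<mu> * X\<^sup>2 \<le> q / 2 * X\<^sup>2" by (rule mult_right_mono) simp
        then show "C2 * \<theta> \<le> q / 2 * X\<^sup>2" by (simp add: \<theta>_def)
      qed (use \<theta> in auto)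
      also have "\<dots> = q / 2 * X * \<theta> ^ 3 * (X * T powr \<delta>)" by (simp add: power2_eq_square)
      also have "\<dots> = q / 2 * \<theta> ^ 3 * X" unfolding XT by simp
      finally have "norm (zeta_ratio s - zeta_ratio w) \<le> q / 2 * \<theta> ^ 3 * X" by (simp add: w_def)
      moreover have "norm (zeta_ratio w) - norm (zeta_ratio s) \<le> norm (zeta_ratio s - zeta_ratio w)"
        by (metis norm_minus_commute norm_triangle_ineq2)
      ultimately show ?thesis unfolding target using w by linarith
    qed
  qed
qed

text \<open>Three regions: away from the real axis the previous lemma applies; for \<open>Re s\<close> away from 1 the
  Euler product bound \<open>norm_zeta_ge\<close> suffices; near 1 the pole dominates, because
  \<open>(s - 1) zeta(s)\<close> is within \<open>a / 2\<close> of \<open>a\<close>.\<close>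

lemma zeta_ratio_inverse_bound:
  assumes a: "a > 0" and G: "\<And>\<epsilon>. \<epsilon> > 0 \<Longrightarrow> poly_growth \<epsilon> (zeta_minus_pole N a)" and eps: "\<epsilon> > 0"
  shows "strip_bound \<epsilon> (\<lambda>s. 1 / zeta_ratio s)"
proof -
  obtain B where B: "B > 0" "\<And>s. 1 < Re s \<Longrightarrow> Re s \<le> 2 \<Longrightarrow> norm (zeta_minus_pole N a s) \<le> B * (1 + \<bar>Im s\<bar>) powr 1"
    using strip_boundE[OF poly_growthD(3)[OF G[of 1]]] by (metis zero_less_one)
  \<comment> \<open>for \<open>|s - 1| \<le> \<rho>\<close> the bound on \<open>zeta_minus_pole\<close> is \<open>2 B\<close>, and \<open>2 B \<rho> \<le> a / 2\<close>\<close>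
  define \<rho> where "\<rho> = min 1 (a / (4 * B))"
  have \<rho>: "\<rho> > 0" "\<rho> \<le> 1" "\<rho> * (2 * B) \<le> a / 2" using a B(1) by (auto simp: \<rho>_def min_def field_simps)
  obtain c where c: "c > 0" "\<And>s. 1 < Re s \<Longrightarrow> Re s \<le> 2 \<Longrightarrow> \<bar>Im s\<bar> \<ge> \<rho> / 2 \<Longrightarrow>
     norm (zeta_ratio s) \<ge> c * (1 + \<bar>Im s\<bar>) powr (- \<epsilon>)"
    using zeta_ratio_lower_far[of a "\<rho> / 2" \<epsilon>] a G \<rho> eps by (metis half_gt_zero less_imp_le)
  define z where "z = norm (beurling_zeta N (of_real (1 + \<rho> / 2)))"
  define K where "K = 1 / c + 4 / a + (1 + 2 / \<rho>) * z"
  have z0: "z \<ge> 0" by (simp add: z_def)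
  have K: "1 / c \<le> K" "4 / a \<le> K" "(1 + 2 / \<rho>) * z \<le> K" "K \<ge> 0" using c a \<rho> z0 by (auto simp: K_def)
  show ?thesis
  proof (rule strip_boundI)
    fix s assume s: "1 < Re s" "Re s \<le> 2"
    have nz: "s \<noteq> 0" "s - 1 \<noteq> 0" using s by auto
    define T where "T = (1 + \<bar>Im s\<bar>) powr \<epsilon>"
    have T: "T \<ge> 1" using eps by (auto simp: T_def intro: ge_one_powr_ge_zero)
    consider "\<bar>Im s\<bar> \<ge> \<rho> / 2" | "Re s \<ge> 1 + \<rho> / 2" | "\<bar>Im s\<bar> < \<rho> / 2" "Re s < 1 + \<rho> / 2" by linarith
    then show "norm (1 / zeta_ratio s) \<le> K * (1 + \<bar>Im s\<bar>) powr \<epsilon>"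
    proof cases
      case 1
      have "norm (1 / zeta_ratio s) \<le> 1 / (c * (1 + \<bar>Im s\<bar>) powr (- \<epsilon>))"
        using c(2)[OF s 1] c(1) zeta_ratio_nz[OF s(1)] unfolding norm_divide norm_one
        by (intro divide_left_mono mult_pos_pos) auto
      also have "\<dots> = 1 / c * (1 + \<bar>Im s\<bar>) powr \<epsilon>" by (simp add: powr_minus divide_inverse)
      also have "\<dots> \<le> K * (1 + \<bar>Im s\<bar>) powr \<epsilon>" by (intro mult_right_mono K) auto
      finally show ?thesis .
    next
      case 2
      have zs: "norm (beurling_zeta N s) > 0" using s by (simp add: zeta_eq_exp)
      have zz: "1 \<le> norm (beurling_zeta N s) * z" unfolding z_def using 2 \<rho> by (intro norm_zeta_ge) auto
      have "norm (1 / zeta_ratio s) = norm s / norm (s - 1) * (1 / norm (beurling_zeta N s))"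
        by (simp add: zeta_ratio_def norm_mult norm_divide)
      also have "\<dots> \<le> (1 + 2 / \<rho>) * z"
      proof (rule mult_mono)
        have d: "norm (s - 1) \<ge> \<rho> / 2" using complex_Re_le_cmod[of "s - 1"] 2 by simp
        have "norm s \<le> norm (s - 1) + 1" using norm_triangle_ineq[of "s - 1" 1] by simp
        then have "norm s / norm (s - 1) \<le> 1 + 1 / norm (s - 1)" using nz by (simp add: field_simps)
        also have "1 / norm (s - 1) \<le> 1 / (\<rho> / 2)" using d \<rho> by (intro divide_left_mono mult_pos_pos) auto
        finally show "norm s / norm (s - 1) \<le> 1 + 2 / \<rho>" by simp
        show "1 / norm (beurling_zeta N s) \<le> z" using zz zs by (simp add: divide_le_eq mult.commute)
      qed (use \<rho> in auto)
      also have "\<dots> \<le> K * 1" using K by simp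
      also have "\<dots> \<le> K * T" using T K by (intro mult_left_mono) auto
      finally show ?thesis by (simp add: T_def)
    next
      case 3
      have d: "norm (s - 1) \<le> \<rho>" using cmod_le[of "s - 1"] 3 s by simp
      have "norm (zeta_minus_pole N a s) \<le> B * 2" 
        using B(2)[OF s] B(1) 3 \<rho> by (auto simp: powr_one intro: order_trans)
      then have "norm (s - 1) * norm (zeta_minus_pole N a s) \<le> \<rho> * (2 * B)"
        using d \<rho> by (intro mult_mono) auto
      then have small: "norm ((s - 1) * zeta_minus_pole N a s) \<le> a / 2" using \<rho>(3) by (simp add: norm_mult)
      have "(s - 1) * beurling_zeta N s = of_real a + (s - 1) * zeta_minus_pole N a s"
        using nz by (simp add: zeta_minus_pole_def field_simps)
      then have "norm ((s - 1) * beurling_zeta N s) \<ge> a - a / 2"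
        using small norm_diff_ineq[of "of_real a" "(s - 1) * zeta_minus_pole N a s"] a by simp
      then have ge: "norm ((s - 1) * beurling_zeta N s) \<ge> a / 2" by simp
      have "norm s \<le> 2" using norm_triangle_ineq[of "s - 1" 1] d \<rho> by simp
      have "norm (1 / zeta_ratio s) = norm s / norm ((s - 1) * beurling_zeta N s)"
        by (simp add: zeta_ratio_def norm_mult norm_divide)
      also have "\<dots> \<le> 2 / (a / 2)" using ge a \<open>norm s \<le> 2\<close> by (intro frac_le) auto
      also have "\<dots> \<le> K * 1" using K by simp
      also have "\<dots> \<le> K * T" using T K by (intro mult_left_mono) auto
      finally show ?thesis by (simp add: T_def)
    qed
  qed
qed

text \<open>The function \<open>J = log_ratio\<close> inherits its growth from \<open>J' = Z' / Z\<close>: integrating horizontally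
  from the line \<open>Re s = 2\<close>, where \<open>J\<close> is bounded, loses nothing.\<close>

theorem P_log_small_if_N_log_small:
  assumes a: "a > 0" and r: "log_small (\<lambda>v. N_exp v - primitive (exp_density a) v)"
  shows "log_small (\<lambda>v. P_exp v - primitive li_density v)"
proof -
  have a0: "a \<ge> 0" using a by simp
  have G: "poly_growth \<epsilon> (zeta_minus_pole N a)" if "\<epsilon> > 0" for \<epsilon>
    by (rule growth_all_eps[OF a0 growth_if_N_log_small[OF a0 r] that])
  have Z: "poly_growth \<epsilon> zeta_ratio" if "\<epsilon> > 0" for \<epsilon>
    by (rule zeta_ratio_growth[OF a0 G[OF that] that])
  have dJ: "poly_growth 1 (deriv log_ratio)"
  proof (rule poly_growth_divide[of _ zeta_ratio "deriv zeta_ratio"])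
    show "deriv log_ratio holomorphic_on half_plane"
      by (intro holomorphic_deriv log_ratio_holomorphic open_half_plane)
    show "deriv log_ratio s * zeta_ratio s = deriv zeta_ratio s" if "Re s > 1" for s
      using log_ratio_deriv[OF that] by (simp add: mult.commute)
  qed (use Z zeta_ratio_nz zeta_ratio_inverse_bound[OF a G] poly_growth_deriv in auto)
  obtain C where C: "C > 0" "\<And>s. 1 < Re s \<Longrightarrow> Re s \<le> 2 \<Longrightarrow> norm (deriv log_ratio s) \<le> C * (1 + \<bar>Im s\<bar>) powr 1"
    using strip_boundE[OF poly_growthD(3)[OF dJ]] by metis
  define D where "D = Re (log_zeta (of_real 2)) + (LINT v|lborel. \<bar>li_density v\<bar> * exp (- (2 * v)))"
  have D: "norm (log_ratio (Complex 2 t)) \<le> D" for t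
  proof -
    have "norm (log_zeta (Complex 2 t)) \<le> Re (log_zeta (of_real 2))"
      using norm_log_zeta_le[of "Complex 2 t"] by simp
    moreover have "norm (laplace li_density (Complex 2 t)) \<le> (LINT v|lborel. \<bar>li_density v\<bar> * exp (- (2 * v)))"
      using norm_laplace_le[of li_density "Complex 2 t"] by simp
    ultimately show ?thesis unfolding log_ratio_def D_def by (intro order_trans[OF norm_triangle_ineq4] add_mono)
  qed
  have D0: "D \<ge> 0" using order_trans[OF norm_ge_zero D] .
  have "strip_bound 1 log_ratio"
  proof (rule strip_boundI)
    fix s assume s: "1 < Re s" "Re s \<le> 2"
    have "norm (log_ratio (Complex (Re s) (Im s)) - log_ratio (Complex 2 (Im s))) \<le> C * (1 + \<bar>Im s\<bar>) powr 1 * (2 - Re s)"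
    proof (rule horizontal_variation[OF log_ratio_holomorphic])
      show "norm (deriv log_ratio w) \<le> C * (1 + \<bar>Im s\<bar>) powr 1" if "1 < Re w" "Re w \<le> 2" "Im w = Im s" for w
        using C(2)[of w] that by simp
    qed (use s in auto)
    also have "\<dots> \<le> C * (1 + \<bar>Im s\<bar>) powr 1 * 1"
      using s C(1) by (intro mult_left_mono) auto
    finally have "norm (log_ratio s) \<le> D + C * (1 + \<bar>Im s\<bar>) powr 1"
      using D[of "Im s"] norm_triangle_sub[of "log_ratio s" "log_ratio (Complex 2 (Im s))"] by simp
    also have "\<dots> \<le> (D + C) * (1 + \<bar>Im s\<bar>) powr 1"
      using mult_left_mono[of 1 "1 + \<bar>Im s\<bar>" D] D0 by (simp add: powr_one distrib_right)
    finally show "norm (log_ratio s) \<le> (D + C) * (1 + \<bar>Im s\<bar>) powr 1" .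
  qed
  from P_log_small_if_growth[OF poly_growth_from_deriv[OF log_ratio_holomorphic this dJ]] show ?thesis .
qed

lemma Re_laplace_li_density_le:
  assumes \<kappa>: "\<And>s. Re s > 1 \<Longrightarrow> exp (laplace li_density s) = of_real \<kappa> * s / (s - 1)" and s: "Re s > 1"
  shows "norm (laplace li_density s) \<le> Re (laplace li_density (of_real (Re s)))"
    "exp (Re (laplace li_density (of_real (Re s)))) = \<kappa> * Re s / (Re s - 1)"
proof -
  have "norm (laplace li_density s) \<le> (LINT v|lborel. \<bar>li_density v\<bar> * exp (- (Re s * v)))" by (rule norm_laplace_le)
  then show "norm (laplace li_density s) \<le> Re (laplace li_density (of_real (Re s)))"
    by (simp add: laplace_real li_density_bounds)
  have "complex_of_real (exp (Re (laplace li_density (of_real (Re s))))) = exp (laplace li_density (of_real (Re s)))"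
    by (simp add: laplace_real exp_of_real)
  also have "\<dots> = of_real (\<kappa> * Re s / (Re s - 1))" using \<kappa>[of "of_real (Re s)"] s by simp
  finally show "exp (Re (laplace li_density (of_real (Re s)))) = \<kappa> * Re s / (Re s - 1)"
    by (simp only: of_real_eq_iff)
qed

text \<open>The delicate point is a bound for \<open>Z = \<kappa> exp J\<close>, since growth of \<open>J\<close> of every positive order
  says nothing about \<open>exp J\<close>. It follows from \<open>|zeta(s)| \<le> zeta(Re s) = O(1 / (\<sigma> - 1))\<close> at
  distance \<open>1 / T\<close> from the line 1, and from \<open>J' = O(T)\<close> for smaller distances. The density \<open>a\<close> is
  the boundary value of \<open>Z\<close> at 1, which is positive because \<open>J\<close> extends continuously and is real
  on the real axis.\<close>

theorem N_log_small_if_P_log_small: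
  assumes r: "log_small (\<lambda>v. P_exp v - primitive li_density v)"
  shows "\<exists>a>0. log_small (\<lambda>v. N_exp v - primitive (exp_density a) v)"
proof -
  define \<gamma> where "\<gamma> = (\<lambda>v. P_exp v - primitive li_density v)"
  have ok: "transformable \<gamma>"
    unfolding \<gamma>_def by (intro transformable_diff transformable_P transformable_primitive transformable_li_density)
  have r: "log_small \<gamma>" using r by (simp add: \<gamma>_def)
  have J_eq: "log_ratio s = s * laplace \<gamma> s" if "Re s > 1" for s
    using that by (simp add: log_ratio_eq_laplace \<gamma>_def laplace_diff transformable_P transformable_primitive transformable_li_density)
  have J1: "poly_growth 1 log_ratio"
    by (rule poly_growth_cong[OF poly_growth_mult[OF poly_growth_ident abelian_growth[OF ok r], simplified]])
       (simp add: J_eq)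
  obtain \<kappa> :: real where \<kappa>: "\<kappa> > 0" "\<And>s. Re s > 1 \<Longrightarrow> exp (laplace li_density s) = of_real \<kappa> * s / (s - 1)"
    "\<And>s. Re s > 1 \<Longrightarrow> zeta_ratio s = of_real \<kappa> * exp (log_ratio s)"
    using zeta_ratio_eq_exp by metis
  have li: "norm (laplace li_density s) \<le> Re (laplace li_density (of_real (Re s)))"
    "exp (Re (laplace li_density (of_real (Re s)))) = \<kappa> * Re s / (Re s - 1)" if "Re s > 1" for s
    using Re_laplace_li_density_le[of \<kappa> s] \<kappa>(2) that by blast+
  obtain B where B: "B > 0" "\<And>s. 1 < Re s \<Longrightarrow> Re s \<le> 2 \<Longrightarrow> norm (log_ratio s) \<le> B * (1 + \<bar>Im s\<bar>) powr 1"
    using strip_boundE[OF poly_growthD(3)[OF J1]] by metis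
  have log_zeta_real: "Re (log_zeta (of_real \<sigma>)) \<le> B + Re (laplace li_density (of_real \<sigma>))" if "1 < \<sigma>" "\<sigma> \<le> 2" for \<sigma>
    using B(2)[of "of_real \<sigma>"] that complex_Re_le_cmod[of "log_ratio (of_real \<sigma>)"] by (simp add: log_ratio_def)
  define L2 where "L2 = Re (log_zeta (of_real 2))"
  have L2: "L2 \<ge> 0" unfolding L2_def using order_trans[OF norm_ge_zero norm_log_zeta_le[of 2]] by simp
  have crude: "norm (log_ratio s) \<le> (B + 6 * \<kappa> + 2 * L2) / (Re s - 1) ^ 1" if s: "1 < Re s" "Re s \<le> 3" for s
  proof -
    define d where "d = Re s - 1"
    have d: "d > 0" "d \<le> 2" using s by (auto simp: d_def)
    define lr where "lr = Re (laplace li_density (of_real (Re s)))"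
    have "lr \<le> exp lr" using exp_ge_add_one_self[of lr] by linarith
    also have "\<dots> = \<kappa> * Re s / d" unfolding lr_def d_def by (rule li(2)[OF s(1)])
    also have "\<dots> \<le> \<kappa> * 3 / d" using s \<kappa>(1) d by (intro divide_right_mono mult_left_mono) auto
    finally have l: "lr \<le> 3 * \<kappa> / d" by (simp add: mult.commute)
    have Ls: "Re (log_zeta (of_real (Re s))) \<le> (B + 3 * \<kappa> + 2 * L2) / d"
    proof (cases "Re s \<le> 2")
      case True
      have "B \<le> B / d" using d True s B(1) divide_left_mono[of d 1 B] by (simp add: d_def)
      then have "Re (log_zeta (of_real (Re s))) \<le> B / d + 3 * \<kappa> / d"
        using log_zeta_real[OF s(1) True] l by (simp add: lr_def)
      also have "\<dots> \<le> (B + 3 * \<kappa> + 2 * L2) / d" using d L2 by (simp add: divide_right_mono flip: add_divide_distrib)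
      finally show ?thesis .
    next
      case False
      then have "Re (log_zeta (of_real (Re s))) \<le> L2" unfolding L2_def by (intro log_zeta_real_antimono) auto
      also have "L2 = (2 * L2) / 2" by simp
      also have "\<dots> \<le> (B + 3 * \<kappa> + 2 * L2) / d" using d L2 B(1) \<kappa>(1) by (intro frac_le) auto
      finally show ?thesis .
    qed
    have "norm (log_ratio s) \<le> norm (log_zeta s) + norm (laplace li_density s)"
      unfolding log_ratio_def by (rule norm_triangle_ineq4)
    also have "\<dots> \<le> Re (log_zeta (of_real (Re s))) + lr"
      unfolding lr_def using norm_log_zeta_le[OF s(1)] li(1)[OF s(1)] by (rule add_mono)
    also have "\<dots> \<le> (B + 3 * \<kappa> + 2 * L2) / d + 3 * \<kappa> / d" using Ls l by (rule add_mono)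
    also have "\<dots> = (B + 6 * \<kappa> + 2 * L2) / d" by (simp flip: add_divide_distrib)
    finally show ?thesis by (simp add: d_def)
  qed
  have dJ: "poly_growth \<epsilon> (deriv log_ratio)" if "\<epsilon> > 0" for \<epsilon>
    by (rule poly_growth_deriv[OF interpolation[OF J1 crude that]])
  have Z1: "strip_bound 1 zeta_ratio"
  proof -
    obtain C where C: "C > 0" "\<And>s. 1 < Re s \<Longrightarrow> Re s \<le> 2 \<Longrightarrow> norm (deriv log_ratio s) \<le> C * (1 + \<bar>Im s\<bar>) powr 1"
      using strip_boundE[OF poly_growthD(3)[OF dJ[of 1]]] by (metis zero_less_one)
    have far: "norm (zeta_ratio s) \<le> 4 * \<kappa> * exp B / (Re s - 1)" if s: "1 < Re s" "Re s \<le> 2" for s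
    proof -
      have "norm ((s - 1) / s) \<le> 2"
      proof -
        have "norm s \<ge> 1" using complex_Re_le_cmod[of s] s by linarith
        moreover have "norm (s - 1) \<le> norm s + 1" using norm_triangle_ineq4[of s 1] by simp
        moreover have "norm s + 1 \<le> 2 * norm s" using calculation by simp
        ultimately show ?thesis by (simp add: norm_divide divide_le_eq)
      qed
      moreover have "norm (beurling_zeta N s) \<le> 2 * \<kappa> * exp B / (Re s - 1)"
      proof -
        have "norm (beurling_zeta N s) \<le> norm (beurling_zeta N (of_real (Re s)))" using s by (intro norm_zeta_le) auto
        also have "\<dots> = exp (Re (log_zeta (of_real (Re s))))" using s by (simp add: zeta_eq_exp)
        also have "\<dots> \<le> exp (B + Re (laplace li_density (of_real (Re s))))" using log_zeta_real s by simp
        also have "\<dots> = exp B * (\<kappa> * Re s / (Re s - 1))" by (simp only: exp_add li(2)[OF s(1)])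
        also have "\<dots> \<le> exp B * (\<kappa> * 2 / (Re s - 1))"
          using s \<kappa>(1) by (intro mult_left_mono divide_right_mono) auto
        finally show ?thesis by (simp add: mult_ac)
      qed
      ultimately have "norm (zeta_ratio s) \<le> 2 * (2 * \<kappa> * exp B / (Re s - 1))"
        unfolding zeta_ratio_def norm_mult by (intro mult_mono) auto
      then show ?thesis by simp
    qed
    show ?thesis
    proof (rule strip_boundI)
      fix s assume s: "1 < Re s" "Re s \<le> 2"
      define T where "T = 1 + \<bar>Im s\<bar>"
      have T: "T \<ge> 1" by (simp add: T_def)
      have K0: "4 * \<kappa> * exp B \<ge> 0" using \<kappa>(1) by simp
      have "norm (zeta_ratio s) \<le> 4 * \<kappa> * exp B * exp C * T"
      proof (cases "Re s - 1 \<ge> 1 / T")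
        case True
        have "norm (zeta_ratio s) \<le> 4 * \<kappa> * exp B / (Re s - 1)" by (rule far[OF s])
        also have "\<dots> \<le> 4 * \<kappa> * exp B / (1 / T)"
          using True T K0 s by (intro divide_left_mono) auto
        also have "\<dots> = 4 * \<kappa> * exp B * 1 * T" by simp
        also have "\<dots> \<le> 4 * \<kappa> * exp B * exp C * T"
          using K0 C(1) T by (intro mult_right_mono mult_left_mono) auto
        finally show ?thesis .
      next
        case False
        define w where "w = Complex (1 + 1 / T) (Im s)"
        have w: "1 < Re w" "Re w \<le> 2" using T by (auto simp: w_def)
        have "norm (log_ratio (Complex (Re s) (Im s)) - log_ratio (Complex (1 + 1 / T) (Im s))) \<le> C * T * (1 + 1 / T - Re s)"
        proof (rule horizontal_variation[OF log_ratio_holomorphic])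
          show "norm (deriv log_ratio w) \<le> C * T" if "1 < Re w" "Re w \<le> 2" "Im w = Im s" for w
            using C(2)[of w] that by (simp add: T_def)
        qed (use s T False in auto)
        also have "\<dots> \<le> C * T * (1 / T)" using C(1) T s by (intro mult_left_mono) auto
        also have "\<dots> = C" using T by simp
        finally have "norm (log_ratio s - log_ratio w) \<le> C" by (simp add: w_def)
        then have "Re (log_ratio s) - Re (log_ratio w) \<le> C"
          using complex_Re_le_cmod[of "log_ratio s - log_ratio w"] by simp
        then have "exp (Re (log_ratio s)) \<le> exp (Re (log_ratio w)) * exp C" by (simp flip: exp_add)
        then have "norm (zeta_ratio s) \<le> norm (zeta_ratio w) * exp C"
          using \<kappa> s w by (simp add: norm_mult mult.assoc)
        also have "\<dots> \<le> (4 * \<kappa> * exp B / (Re w - 1)) * exp C" by (intro mult_right_mono far w) auto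
        also have "\<dots> = 4 * \<kappa> * exp B * exp C * T" using T by (simp add: w_def)
        finally show ?thesis .
      qed
      then show "norm (zeta_ratio s) \<le> 4 * \<kappa> * exp B * exp C * (1 + \<bar>Im s\<bar>) powr 1"
        by (simp add: T_def powr_one)
    qed
  qed
  have Z: "poly_growth 2 zeta_ratio"
    by (rule poly_growth_ode[OF zeta_ratio_holomorphic Z1 _ dJ log_ratio_deriv]) auto
  define a where "a = \<kappa> * exp (LINT v|lborel. \<gamma> v * exp (- v))"
  have a: "a > 0" using \<kappa>(1) by (simp add: a_def)
  have a_eq: "complex_of_real a = of_real \<kappa> * exp (1 * laplace \<gamma> 1)"
    using laplace_real[of \<gamma> 1] by (simp add: a_def exp_of_real)
  have lim: "((\<lambda>\<theta>. zeta_ratio (1 + of_real \<theta> * (s - 1))) \<longlongrightarrow> of_real a) (at_right 0)" if s: "1 < Re s" for s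
  proof -
    have cont: "continuous_on {s. Re s \<ge> 1} (\<lambda>s. of_real \<kappa> * exp (s * laplace \<gamma> s))"
      using laplace_continuous_closed[OF ok r, of 0] by (auto intro!: continuous_intros)
    have "((\<lambda>\<theta>::real. 1 + of_real \<theta> * (s - 1)) \<longlongrightarrow> 1 + of_real 0 * (s - 1)) (at_right 0)"
      by (intro tendsto_intros)
    then have p: "((\<lambda>\<theta>::real. 1 + of_real \<theta> * (s - 1)) \<longlongrightarrow> 1) (at_right 0)" by simp
    have ev: "\<forall>\<^sub>F \<theta> in at_right (0::real). 1 < Re (1 + of_real \<theta> * (s - 1))"
      unfolding eventually_at_right_field using s by (intro exI[of _ 1]) auto
    have "((\<lambda>\<theta>::real. of_real \<kappa> * exp ((1 + of_real \<theta> * (s - 1)) * laplace \<gamma> (1 + of_real \<theta> * (s - 1))))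
        \<longlongrightarrow> of_real \<kappa> * exp (1 * laplace \<gamma> 1)) (at_right 0)"
      by (rule continuous_on_tendsto_compose[OF cont p])
         (use ev in \<open>auto elim: eventually_mono\<close>)
    moreover have "\<forall>\<^sub>F \<theta> in at_right (0::real).
        of_real \<kappa> * exp ((1 + of_real \<theta> * (s - 1)) * laplace \<gamma> (1 + of_real \<theta> * (s - 1))) = zeta_ratio (1 + of_real \<theta> * (s - 1))"
      using ev by eventually_elim (simp add: \<kappa>(3) J_eq)
    ultimately show ?thesis unfolding a_eq by (rule Lim_transform_eventually)
  qed
  have "poly_growth 2 (\<lambda>s. zeta_ratio s + (zeta_ratio s - of_real a) / (s - 1))"
    by (intro poly_growth_add Z poly_growth_difference_quotient lim) auto
  then have "poly_growth 2 (zeta_minus_pole N a)"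
  proof (rule poly_growth_cong)
    fix s :: complex assume "Re s > 1"
    then have nz: "s \<noteq> 0" "s - 1 \<noteq> 0" by auto
    then have "zeta_ratio s + zeta_ratio s / (s - 1) = beurling_zeta N s"
      by (simp add: zeta_ratio_def field_simps)
    then show "zeta_ratio s + (zeta_ratio s - of_real a) / (s - 1) = zeta_minus_pole N a s"
      by (simp add: zeta_minus_pole_def diff_divide_distrib)
  qed
  then show ?thesis using N_log_small_if_growth[of a] a by auto
qed

end

theorem theorem3:
  fixes N P :: "real \<Rightarrow> real"
  assumes "generalized_number_system N P"
  shows
    "((\<exists>a>0. \<forall>n::nat. (\<lambda>x. N x - a * x) \<in> O[at_top](\<lambda>x. x / ln x ^ n)) \<longleftrightarrow>
      (\<exists>a>0. \<exists>H. smooth_extension (zeta_minus_pole N a) H \<and>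
         (\<exists>\<epsilon>>0. \<forall>n::nat. (\<lambda>t::real. H n (Complex 1 t)) \<in> O[at_infinity](\<lambda>t. of_real (\<bar>t\<bar> powr \<epsilon>))))) \<and>
     ((\<exists>a>0. \<forall>n::nat. (\<lambda>x. N x - a * x) \<in> O[at_top](\<lambda>x. x / ln x ^ n)) \<longleftrightarrow>
      (\<exists>a>0. \<forall>\<epsilon>>0. \<forall>n::nat. \<exists>C::real. \<forall>\<sigma>>1. \<forall>t::real.
         norm ((deriv ^^ n) (zeta_minus_pole N a) (Complex \<sigma> t)) \<le> C * (1 + \<bar>t\<bar>) powr \<epsilon>)) \<and>
     ((\<exists>a>0. \<forall>n::nat. (\<lambda>x. N x - a * x) \<in> O[at_top](\<lambda>x. x / ln x ^ n)) \<longleftrightarrow>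
      (\<forall>n::nat. (\<lambda>x. P x - Li x) \<in> O[at_top](\<lambda>x. x / ln x ^ n)))"
proof -
  interpret beurling_system N P by unfold_locales (rule assms)
  let ?R = "\<lambda>a. log_small (\<lambda>v. N (exp v) - primitive (exp_density a) v)"
  have i: "(\<exists>a>0. \<forall>n::nat. (\<lambda>x. N x - a * x) \<in> O[at_top](\<lambda>x. x / ln x ^ n)) \<longleftrightarrow> (\<exists>a>0. ?R a)"
    using N_asymp_iff_log_small by (metis less_imp_le)
  have ii: "(\<exists>a>0. ?R a) \<longleftrightarrow>
      (\<exists>a>0. \<exists>H. smooth_extension (zeta_minus_pole N a) H \<and>
         (\<exists>\<epsilon>>0. \<forall>n::nat. (\<lambda>t::real. H n (Complex 1 t)) \<in> O[at_infinity](\<lambda>t. of_real (\<bar>t\<bar> powr \<epsilon>))))"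
    using smooth_extension_if_N_log_small N_log_small_if_growth growth_if_smooth_extension by (meson less_imp_le)
  have iii: "(\<exists>a>0. ?R a) \<longleftrightarrow>
      (\<exists>a>0. \<forall>\<epsilon>>0. \<forall>n::nat. \<exists>C::real. \<forall>\<sigma>>1. \<forall>t::real.
         norm ((deriv ^^ n) (zeta_minus_pole N a) (Complex \<sigma> t)) \<le> C * (1 + \<bar>t\<bar>) powr \<epsilon>)"
    (is "_ \<longleftrightarrow> (\<exists>a>0. ?B a)")
  proof
    assume "\<exists>a>0. ?R a"
    then obtain a where a: "a > 0" "?R a" by blast
    then have "poly_growth 1 (zeta_minus_pole N a)" by (simp add: growth_if_N_log_small)
    then have "poly_growth \<epsilon> (zeta_minus_pole N a)" if "\<epsilon> > 0" for \<epsilon>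
      using growth_all_eps that a by (meson less_imp_le)
    then have "?B a" using global_growth_if_growth a by (meson less_imp_le)
    then show "\<exists>a>0. ?B a" using a by blast
  next
    assume "\<exists>a>0. ?B a"
    then obtain a where a: "a > 0" "?B a" by blast
    then have "poly_growth 1 (zeta_minus_pole N a)" 
      by (intro growth_if_global_growth) (use zero_less_one in blast)
    then show "\<exists>a>0. ?R a" using N_log_small_if_growth a by (meson less_imp_le)
  qed
  have iv: "(\<exists>a>0. ?R a) \<longleftrightarrow> (\<forall>n::nat. (\<lambda>x. P x - Li x) \<in> O[at_top](\<lambda>x. x / ln x ^ n))"
    unfolding P_asymp_iff_log_small using P_log_small_if_N_log_small N_log_small_if_P_log_small by blast
  show ?thesis unfolding i using ii iii iv by blast
qed

end
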